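(* Let $\varphi_1$ be a Jacob's ladder and, for sufficiently large $T>0$, let $\overset{0}{T}=T$ and $\overset{r}{T}=\varphi_1^{-r}(T)=\varphi_1^{-1}(\overset{r-1}{T})$, $r=1,\dots,k$. Then for every fixed $k,l\in\mathbb N$, $$\frac{\int_{\overset{r-1}{T}}^{\overset{r}{T}}\left|\zeta\left(\frac12+it\right)\right|^2{\rm d}t}{\int_{\overset{r-1}{T}}^{\overset{r}{T}}|S_1(t)|^{2l}\,{\rm d}t}=\frac{1}{\bar c(l)}\ln\overset{r-1}{T}+\mathcal O(1),\qquad r=1,\dots,k,\ T\to\infty.$$
   Context: $\zeta$ is the Riemann zeta function; $S_1(t)=\frac1\pi\int_0^t\arg\zeta(\frac12+iu)\,{\rm d}u$ (with the standard determination of the argument by continuous variation). For $l\in\mathbb N$, $\bar c(l)>0$ denotes the constant in Selberg's mean-value formula $\int_T^{T+H}|S_1(t)|^{2l}{\rm d}t=\bar c(l)H+\mathcal O(H/\ln T)$, valid for $T^a\le H\le T$, $\frac12<a\le1$. $\vartheta(t)=-\frac t2\ln\pi+\operatorname{Im}\ln\Gamma\left(\frac14+\frac{it}{2}\right)$, $Z(t)=e^{i\vartheta(t)}\zeta(\frac12+it)$. A Jacob's ladder (Moser) is $\varphi_1(T)=\frac12\varphi(T)$, where $\varphi$ is a solution of $\int_0^{\mu[\varphi(T)]}Z^2(t)e^{-\frac{2}{\varphi(T)}t}\,{\rm d}t=\int_0^T Z^2(t)\,{\rm d}t$ with an admissible $\mu$ satisfying $\mu(y)\geq 7y\ln y$;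 $\varphi_1$ is increasing for large arguments, so its reverse iterates $\varphi_1^{-r}$ are defined for sufficiently large arguments. *)

theory Defs
  imports "HOL-Complex_Analysis.Complex_Analysis" "HOL-Library.Landau_Symbols"
begin

(* The analytic continuation of the Dirichlet series to the plane without 1;
   the value at the pole is set to 0, which makes the function unique. *)
definition zeta :: "complex \<Rightarrow> complex" where
  "zeta = (THE f. f holomorphic_on (UNIV - {1}) \<and>
                  (\<forall>s. Re s > 1 \<longrightarrow> (\<lambda>n. 1 / of_nat (Suc n) powr s) sums f s) \<and>
                  f 1 = 0)"

definition zeta_path :: "real \<Rightarrow> real \<Rightarrow> complex" where
  "zeta_path t = linepath 2 (Complex 2 t) +++ linepath (Complex 2 t) (Complex (1/2) t)"

(* The end value at 1/2 + it of an argument of zeta varying continuously along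
   zeta_path t, starting from arg zeta(2) = 0.  It is uniquely determined
   whenever the path meets neither the pole nor a zero. *)
definition arg_zeta_var :: "real \<Rightarrow> real" where
  "arg_zeta_var t = (THE \<theta>. \<exists>g. continuous_on {0..1} g \<and> g 0 = 0 \<and> g 1 = \<theta> \<and>
     (\<forall>x\<in>{0..1}. zeta (zeta_path t x) = rcis (cmod (zeta (zeta_path t x))) (g x)))"

(* arg zeta(1/2 + it).  At t = 0 and at ordinates of zeros, where continuous
   variation breaks down, the usual convention is the limit from the right. *)
definition arg_zeta :: "real \<Rightarrow> real" where
  "arg_zeta t =
     (if \<forall>x\<in>{0..1}. zeta_path t x \<noteq> 1 \<and> zeta (zeta_path t x) \<noteq> 0
      then arg_zeta_var t else Lim (at_right t) arg_zeta_var)"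

definition S1 :: "real \<Rightarrow> real" where
  "S1 t = 1 / pi * integral {0..t} arg_zeta"

(* c is the constant in Selberg's mean-value formula of order l; the implied
   constant may depend on l and a. *)
definition selberg_constant :: "nat \<Rightarrow> real \<Rightarrow> bool" where
  "selberg_constant l c \<longleftrightarrow> c > 0 \<and>
     (\<forall>a. 1/2 < a \<and> a \<le> 1 \<longrightarrow>
       (\<exists>C T\<^sub>0. \<forall>T\<ge>T\<^sub>0. \<forall>H. T powr a \<le> H \<and> H \<le> T \<longrightarrow>
          \<bar>integral {T..T+H} (\<lambda>t. \<bar>S1 t\<bar> ^ (2*l)) - c * H\<bar> \<le> C * (H / ln T)))"

(* ln_Gamma is the holomorphic branch off the non-positive reals that is real
   on the positive reals, not the principal logarithm of Gamma. *)
definition vartheta :: "real \<Rightarrow> real" where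
  "vartheta t = - (t / 2) * ln pi + Im (ln_Gamma (Complex (1/4) (t/2)))"

(* Z is real-valued by the functional equation; it is kept complex-typed here
   so that its defining formula can be used as it stands. *)
definition hardy_Z :: "real \<Rightarrow> complex" where
  "hardy_Z t = exp (\<i> * of_real (vartheta t)) * zeta (Complex (1/2) t)"

definition admissible :: "real \<Rightarrow> (real \<Rightarrow> real) \<Rightarrow> bool" where
  "admissible y\<^sub>0 \<mu> \<longleftrightarrow> y\<^sub>0 > 1 \<and> continuous_on {y\<^sub>0..} \<mu> \<and> mono_on {y\<^sub>0..} \<mu> \<and>
     (\<forall>y\<ge>y\<^sub>0. \<mu> y \<ge> 7 * y * ln y)"

(* \<phi>\<^sub>1 is a Jacob's ladder on [T\<^sub>0, \<infinity>); \<phi> takes values in the domain [y\<^sub>0, \<infinity>) of \<mu>.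
   The left-hand integral increases strictly and continuously with \<phi> T, and the
   right-hand one with T, so \<phi>\<^sub>1 is continuous and strictly increasing on [T\<^sub>0, \<infinity>)
   and unbounded there. *)
definition jacobs_ladder :: "real \<Rightarrow> (real \<Rightarrow> real) \<Rightarrow> bool" where
  "jacobs_ladder T\<^sub>0 \<phi>\<^sub>1 \<longleftrightarrow> T\<^sub>0 > 0 \<and>
     (\<exists>y\<^sub>0 \<mu> \<phi>. admissible y\<^sub>0 \<mu> \<and>
       (\<forall>T\<ge>T\<^sub>0. \<phi> T \<ge> y\<^sub>0 \<and>
          integral {0..\<mu> (\<phi> T)} (\<lambda>t. (hardy_Z t)\<^sup>2 * exp (of_real (- (2 / \<phi> T) * t))) =
            integral {0..T} (\<lambda>t. (hardy_Z t)\<^sup>2) \<and>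
          \<phi>\<^sub>1 T = \<phi> T / 2))"

definition reverse_iterate :: "real \<Rightarrow> (real \<Rightarrow> real) \<Rightarrow> nat \<Rightarrow> real \<Rightarrow> real" where
  "reverse_iterate T\<^sub>0 \<phi>\<^sub>1 r T = (inv_into {T\<^sub>0..} \<phi>\<^sub>1 ^^ r) T"

end

(*
The point is an asymptotic formula for the integral of |zeta(1/2+it)|^2, written Z(T) below, sharp
enough to be used over an interval of length V/ln V.  Let d(n) be the number of divisors of n.  The series
S(z) = sum d(n) exp(-n z) is an inverse Mellin transform of Gamma zeta^2 and 2 pi i-periodic.
Moving the line of integration to Re s = 1/2 past the double pole at 1 and applying the functional
equation gives S(z) = 2 pi (c - ln z)/z + A(z), where A integrates |zeta(1/2+it)|^2 against the kernel
(2 pi/z)^s / (2 cos(pi s/2)), s = 1/2 + it.  At z = 2 pi i exp(-i d) the kernel is essentially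
exp(-d t), so A(z) is the Laplace transform of |zeta|^2 at d up to a bounded error; periodicity
identifies S(z) with S(z - 2 pi i), where z - 2 pi i is close to 2 pi d.  Hence the Laplace transform
at d is (kappa - ln d)/d up to a smaller error, also for complex d.  Cauchy's inequality
for its Taylor coefficients, and the concentration of the Poisson distribution, then give
Z(T) = T (ln T + kappa + gamma - 1) + O(T/ln T).

For V = phi_1(U) the ladder equation says that Z(U) is the Laplace transform of |zeta|^2
at 1/V up to a negligible truncation, which is V (ln V + kappa) + O(sqrt V).  Hence Z(U) - Z(V) is
asymptotic to (1 - gamma) V with 1 - gamma > 0, so U - V has order V/ln V and
Z(U) - Z(V) = (U - V) (ln V + O(1)).  As U - V exceeds V^(3/4), Selberg's formula
evaluates the denominator as c (U - V) (1 + O(1/ln V)).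
*)

theory Submission
  imports Defs "HOL-Real_Asymp.Real_Asymp"
begin

section \<open>Continuation and functional equation of the zeta function\<close>

text \<open>The quotient is wanted up to O(1) on an interval of length of order V/ln V, so the mean
  square must be known up to O(V/ln V); a Tauberian argument from the leading term of the Laplace
  transform would leave o(V ln V). What makes more possible is a power-saving error for complex d
  that deteriorates only by a fixed power of \<open>norm d / Re d\<close>. On a circle around a real
  d whose radius falls short of d by d/(k+2), this costs a power of k. The first k + 1 Taylor
  coefficients add up to the integral of the squared zeta function against a smoothed indicator of
  relative width about k^(-1/2), so a power of ln T for k gives a sharp cutoff at negligible cost.
  The constants kappa and kappa + gamma - 1 differ because the average of the first harmonic numbers
  is ln (k + 1) + gamma - 1 up to O(1/k). \<open>zeta\<close> is a definite description, so its
  existence and its functional equation have to be established before anything else can be said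
  about it.\<close>

text \<open>Two integrations by parts move both derivatives onto the weight
  \<open>v * (1 - v) / 2\<close>, which vanishes at both ends and has slopes 1/2 and -1/2 there and
  second derivative -1. The slopes produce the trapezoidal rule, the second derivative the exact
  integral.\<close>

lemma has_integral_trapezoid:
  fixes f :: "real \<Rightarrow> 'a::banach"
  assumes "\<And>v. v \<in> {0..1} \<Longrightarrow> (F has_vector_derivative f v) (at v within {0..1})"
    and "\<And>v. v \<in> {0..1} \<Longrightarrow> (f has_vector_derivative f' v) (at v within {0..1})"
    and "\<And>v. v \<in> {0..1} \<Longrightarrow> (f' has_vector_derivative f'' v) (at v within {0..1})"
  shows "((\<lambda>v. (v * (1 - v) / 2) *\<^sub>R f'' v) has_integral
           (1/2) *\<^sub>R (f 0 + f 1) - (F 1 - F 0)) {0..1}"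
proof -
  define G where "G = (\<lambda>v. (v * (1 - v) / 2) *\<^sub>R f' v - ((1 - 2 * v) / 2) *\<^sub>R f v - F v)"
  have "((\<lambda>v. (v * (1 - v) / 2) *\<^sub>R f'' v) has_integral G 1 - G 0) {0..1}"
  proof (rule fundamental_theorem_of_calculus)
    fix v :: real assume v: "v \<in> {0..1}"
    have 1: "((\<lambda>v. v * (1 - v) / 2) has_real_derivative (1 - 2 * v) / 2) (at v within {0..1})"
      by (auto intro!: derivative_eq_intros)
    have 2: "((\<lambda>v. (1 - 2 * v) / 2) has_real_derivative (- 1)) (at v within {0..1})"
      by (auto intro!: derivative_eq_intros)
    show "(G has_vector_derivative (v * (1 - v) / 2) *\<^sub>R f'' v) (at v within {0..1})"
      unfolding G_def
      by (rule has_vector_derivative_eq_rhs,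
          (rule has_vector_derivative_diff has_vector_derivative_scaleR 1 2 assms[OF v])+) simp
  qed auto
  moreover have "G 1 - G 0 = (1/2) *\<^sub>R (f 0 + f 1) - (F 1 - F 0)"
    by (simp add: G_def algebra_simps)
  ultimately show ?thesis by simp
qed

text \<open>Error of the trapezoidal rule for \<open>x powr (- s)\<close> on
  \<open>[n + 1, n + 2]\<close>, with the factor \<open>s * (s + 1)\<close> of the second derivative
  removed. The exponent \<open>- s - 2\<close> is what lets the sum over \<open>n\<close> converge
  for \<open>Re s > -1\<close>.\<close>

definition trapezoid_error :: "nat \<Rightarrow> complex \<Rightarrow> complex" where
  "trapezoid_error n s = integral {0..1}
     (\<lambda>v. (v * (1 - v) / 2) *\<^sub>R of_real (real (Suc n) + v) powr (- s - 2))"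

lemma of_nat_Suc_plus_notin_nonpos_Reals:
  "v \<ge> 0 \<Longrightarrow> complex_of_real (real (Suc n) + v) \<notin> \<real>\<^sub>\<le>\<^sub>0"
  by (simp add: complex_nonpos_Reals_iff del: of_real_add of_nat_Suc)

lemma of_nat_Suc_plus_neq_0: "v \<ge> 0 \<Longrightarrow> 1 + complex_of_nat n + complex_of_real v \<noteq> 0"
  using of_nat_Suc_plus_notin_nonpos_Reals[of v n] by (intro notI) simp

lemma continuous_on_trapezoid_error_integrand:
  "continuous_on {0..1} (\<lambda>v. (v * (1 - v) / 2) *\<^sub>R complex_of_real (real (Suc n) + v) powr w)"
  by (intro continuous_intros) (use of_nat_Suc_plus_notin_nonpos_Reals of_nat_Suc_plus_neq_0 in auto)

lemma trapezoid_error_holomorphic: "trapezoid_error n holomorphic_on A"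
proof -
  have "(\<lambda>s. integral (cbox 0 1)
     (\<lambda>v. (v * (1 - v) / 2) *\<^sub>R complex_of_real (real (Suc n) + v) powr (- s - 2))) holomorphic_on UNIV"
  proof (rule leibniz_rule_holomorphic)
    fix s :: complex and v :: real assume "v \<in> cbox 0 1"
    hence v: "v \<ge> 0" by auto
    define x where "x = complex_of_real (real (Suc n) + v)"
    have "x \<noteq> 0" "x \<notin> \<real>\<^sub>\<le>\<^sub>0" unfolding x_def using of_nat_Suc_plus_notin_nonpos_Reals[OF v, of n] by force+
    thus "((\<lambda>s. (v * (1 - v) / 2) *\<^sub>R complex_of_real (real (Suc n) + v) powr (- s - 2)) has_field_derivative
       (v * (1 - v) / 2) *\<^sub>R (- Ln (complex_of_real (real (Suc n) + v)) * complex_of_real (real (Suc n) + v) powr (- s - 2)))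
         (at s within UNIV)"
      unfolding x_def[symmetric]
      by (auto intro!: derivative_eq_intros has_field_derivative_powr_right[THEN DERIV_chain2] simp: scaleR_conv_of_real)
  next
    show "(\<lambda>v. (v * (1 - v) / 2) *\<^sub>R complex_of_real (real (Suc n) + v) powr (- s - 2))
            integrable_on cbox 0 1" for s
      using integrable_continuous_real[OF continuous_on_trapezoid_error_integrand] by simp
  next
    show "continuous_on (UNIV \<times> cbox 0 1) (\<lambda>(s, v). (v * (1 - v) / 2) *\<^sub>R
       (- Ln (complex_of_real (real (Suc n) + v)) * complex_of_real (real (Suc n) + v) powr (- s - 2)))"
      unfolding case_prod_unfold
      by (intro continuous_intros) (use of_nat_Suc_plus_notin_nonpos_Reals of_nat_Suc_plus_neq_0 in auto)
  qed auto
  thus ?thesis unfolding trapezoid_error_def [abs_def] cbox_interval by (rule holomorphic_on_subset) auto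
qed

lemma norm_trapezoid_error_le:
  assumes "Re s \<ge> -2"
  shows "norm (trapezoid_error n s) \<le> real (Suc n) powr (- Re s - 2)"
proof -
  have "norm (trapezoid_error n s) \<le> integral {0..1} (\<lambda>_::real. real (Suc n) powr (- Re s - 2))"
    unfolding trapezoid_error_def
  proof (rule integral_norm_bound_integral)
    show "(\<lambda>v. (v * (1 - v) / 2) *\<^sub>R complex_of_real (real (Suc n) + v) powr (- s - 2)) integrable_on {0..1}"
      using integrable_continuous_real[OF continuous_on_trapezoid_error_integrand] by simp
    fix v :: real assume v: "v \<in> {0..1}"
    have 1: "\<bar>v * (1 - v) / 2\<bar> \<le> 1"
      using v mult_mono[of v 1 "1-v" 1] by (auto simp: abs_mult)
    have 2: "norm (complex_of_real (real (Suc n) + v) powr (- s - 2)) \<le> real (Suc n) powr (- Re s - 2)"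
    proof -
      have "norm (complex_of_real (real (Suc n) + v) powr (- s - 2)) = (real (Suc n) + v) powr (- Re s - 2)"
        using v by (subst norm_powr_real_powr) (auto simp flip: of_real_add)
      also have "\<dots> \<le> real (Suc n) powr (- Re s - 2)"
        using v assms by (intro powr_mono2') auto
      finally show ?thesis .
    qed
    have "norm ((v * (1 - v) / 2) *\<^sub>R complex_of_real (real (Suc n) + v) powr (- s - 2)) \<le> 1 * real (Suc n) powr (- Re s - 2)"
      unfolding norm_scaleR by (intro mult_mono 1 2) auto
    thus "norm ((v * (1 - v) / 2) *\<^sub>R complex_of_real (real (Suc n) + v) powr (- s - 2)) \<le> real (Suc n) powr (- Re s - 2)"
      by simp
  qed auto
  thus ?thesis by simp
qed

lemma trapezoid_error_eq:
  assumes "s \<noteq> 1"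
  shows "s * (s + 1) * trapezoid_error n s =
    (of_nat (Suc n) powr (-s) + of_nat (Suc (Suc n)) powr (-s)) / 2
     - (of_nat (Suc (Suc n)) powr (1-s) - of_nat (Suc n) powr (1-s)) / (1 - s)"
proof -
  define x where "x = (\<lambda>v. complex_of_real (real (Suc n) + v))"
  have d: "((\<lambda>v. x v powr a) has_vector_derivative a * x v powr (a - 1)) (at v within {0..1})"
    if "v \<in> {0..1}" for a v
  proof -
    have "x v \<notin> \<real>\<^sub>\<le>\<^sub>0"
      using that of_nat_Suc_plus_notin_nonpos_Reals[of v n] by (auto simp: x_def)
    hence "((\<lambda>z. z powr a) has_field_derivative a * x v powr (a - 1)) (at (x v) within range x)"
      by (auto intro!: derivative_eq_intros)
    moreover have "(x has_vector_derivative 1) (at v within {0..1})"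
      unfolding x_def by (auto intro!: derivative_eq_intros simp flip: of_real_add)
    ultimately show ?thesis
      using field_vector_diff_chain_within[of x 1 v "{0..1}" "\<lambda>z. z powr a" "a * x v powr (a - 1)"]
      by (auto simp: o_def intro: has_field_derivative_subset)
  qed
  have "((\<lambda>v. (v * (1 - v) / 2) *\<^sub>R ((-s) * ((-s-1) * x v powr (-s-1-1)))) has_integral
     (1/2) *\<^sub>R (x 0 powr (-s) + x 1 powr (-s)) - (x 1 powr (1-s) / (1-s) - x 0 powr (1-s) / (1-s))) {0..1}"
  proof (rule has_integral_trapezoid)
    fix v :: real assume v: "v \<in> {0..1}"
    show "((\<lambda>v. x v powr (1-s) / (1-s)) has_vector_derivative x v powr (-s)) (at v within {0..1})"
      using has_vector_derivative_divide[OF d[OF v, of "1-s"], of "1-s"] assms by simp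
    show "((\<lambda>v. x v powr (-s)) has_vector_derivative (-s) * x v powr (-s-1)) (at v within {0..1})"
      using d[OF v, of "-s"] by simp
    show "((\<lambda>v. (-s) * x v powr (-s-1)) has_vector_derivative (-s) * ((-s-1) * x v powr (-s-1-1))) (at v within {0..1})"
      by (rule has_vector_derivative_mult_right[OF d[OF v, of "-s-1"]])
  qed
  hence "integral {0..1} (\<lambda>v. (v * (1 - v) / 2) *\<^sub>R ((-s) * ((-s-1) * x v powr (-s-1-1)))) =
     (1/2) *\<^sub>R (x 0 powr (-s) + x 1 powr (-s)) - (x 1 powr (1-s) / (1-s) - x 0 powr (1-s) / (1-s))"
    by (rule integral_unique)
  also have "(\<lambda>v. (v * (1 - v) / 2) *\<^sub>R ((-s) * ((-s-1) * x v powr (-s-1-1)))) =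
      (\<lambda>v. (s * (s + 1)) * ((v * (1 - v) / 2) *\<^sub>R x v powr (- s - 2)))"
  proof (rule ext, goal_cases)
    case (1 v)
    have e: "- s - 1 - 1 = - s - 2" by simp
    show ?case unfolding e scaleR_conv_of_real by (simp add: field_simps)
  qed
  also have "integral {0..1} \<dots> = s * (s + 1) * trapezoid_error n s"
    unfolding trapezoid_error_def x_def by (rule integral_mult_right)
  finally have "s * (s + 1) * trapezoid_error n s = (1/2) *\<^sub>R (x 0 powr (-s) + x 1 powr (-s))
      - (x 1 powr (1-s) / (1-s) - x 0 powr (1-s) / (1-s))" .
  moreover have "x 0 = of_nat (Suc n)" "x 1 = of_nat (Suc (Suc n))" by (auto simp: x_def)
  ultimately show ?thesis by (simp add: scaleR_conv_of_real diff_divide_distrib)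
qed

definition trapezoid_error_sum :: "complex \<Rightarrow> complex" where
  "trapezoid_error_sum s = (\<Sum>n. trapezoid_error n s)"

lemma summable_norm_trapezoid_error:
  assumes "Re s > -1"
  shows "summable (\<lambda>n. norm (trapezoid_error n s))"
proof (rule summable_comparison_test)
  show "\<exists>N. \<forall>n\<ge>N. norm (norm (trapezoid_error n s)) \<le> real (Suc n) powr (- Re s - 2)"
    using norm_trapezoid_error_le[of s] assms by auto
  show "summable (\<lambda>n. real (Suc n) powr (- Re s - 2))"
    using summable_real_powr_iff[of "- Re s - 2"] assms by (subst summable_Suc_iff) auto
qed

lemma summable_trapezoid_error: "Re s > -1 \<Longrightarrow> summable (\<lambda>n. trapezoid_error n s)"
  by (rule summable_norm_cancel[OF summable_norm_trapezoid_error])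

lemma trapezoid_error_sum_holomorphic: "trapezoid_error_sum holomorphic_on {s. Re s > -1}"
proof (rule holomorphic_uniform_sequence)
  show "open {s. Re s > -1}" by (rule open_halfspace_Re_gt)
  show "(\<lambda>s. \<Sum>i<n. trapezoid_error i s) holomorphic_on {s. Re s > -1}" for n
    by (intro holomorphic_intros trapezoid_error_holomorphic)
  fix x assume "x \<in> {s. Re s > -1}"
  hence x: "Re x > -1" by auto
  define d where "d = (Re x + 1) / 2"
  have d: "d > 0" using x by (simp add: d_def)
  have r: "Re s \<ge> Re x - d" if "s \<in> cball x d" for s
    using abs_Re_le_cmod[of "x - s"] that by (auto simp: dist_norm)
  have xd: "Re x - d > -1" using x by (simp add: d_def field_simps)
  have "uniform_limit (cball x d) (\<lambda>n s. \<Sum>i<n. trapezoid_error i s) (\<lambda>s. suminf (\<lambda>i. trapezoid_error i s)) sequentially"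
  proof (rule Weierstrass_m_test)
    show "norm (trapezoid_error n s) \<le> real (Suc n) powr (- (Re x - d) - 2)" if "s \<in> cball x d" for n s
    proof -
      have "norm (trapezoid_error n s) \<le> real (Suc n) powr (- Re s - 2)"
        using r[OF that] xd by (intro norm_trapezoid_error_le) auto
      also have "\<dots> \<le> real (Suc n) powr (- (Re x - d) - 2)"
        using r[OF that] by (intro powr_mono) auto
      finally show ?thesis .
    qed
    show "summable (\<lambda>n. real (Suc n) powr (- (Re x - d) - 2))"
      using summable_real_powr_iff[of "- (Re x - d) - 2"] xd by (subst summable_Suc_iff) auto
  qed
  moreover have "cball x d \<subseteq> {s. Re s > -1}" using r xd by force
  ultimately show "\<exists>d>0. cball x d \<subseteq> {s. Re s > -1} \<and>
         uniform_limit (cball x d) (\<lambda>n s. \<Sum>i<n. trapezoid_error i s) trapezoid_error_sum sequentially"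
    using d unfolding trapezoid_error_sum_def [abs_def] by blast
qed

text \<open>Summing \<open>trapezoid_error\<close> over \<open>n\<close> is the Euler--Maclaurin formula for \<open>\<Sum>n. n powr (- s)\<close>,
  which converges in the larger half-plane \<open>Re s > -1\<close>.\<close>

definition zeta_right :: "complex \<Rightarrow> complex" where
  "zeta_right s = 1 / (s - 1) + 1 / 2 + s * (s + 1) * trapezoid_error_sum s"

lemma zeta_right_holomorphic: "zeta_right holomorphic_on {s. Re s > -1} - {1}"
  unfolding zeta_right_def [abs_def]
  by (intro holomorphic_intros holomorphic_on_subset[OF trapezoid_error_sum_holomorphic]) auto

text \<open>The identities \<open>trapezoid_error_eq\<close> telescope: a partial sum equals the
  Euler-Maclaurin expression plus boundary terms with exponents \<open>- s\<close> and
  \<open>1 - s\<close>. Both vanish in the limit exactly because \<open>Re s > 1\<close>.\<close>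

lemma zeta_right_sums:
  assumes "Re s > 1"
  shows "(\<lambda>n. 1 / of_nat (Suc n) powr s) sums zeta_right s"
proof -
  have s1: "s \<noteq> 1" using assms by auto
  define P where "P = (\<lambda>N. \<Sum>n<N. 1 / of_nat (Suc n) powr s :: complex)"
  have eq: "P N = 1 / (s - 1) + 1 / 2 + (\<Sum>n<N. s * (s + 1) * trapezoid_error n s)
     - of_nat (Suc N) powr (-s) / 2 + of_nat (Suc N) powr (1-s) / (1-s)" for N
  proof (induction N)
    case 0
    have "1 / (1 - s) = - (1 / (s - 1))" using s1 by (simp add: divide_simps)
    thus ?case by (simp add: P_def)
  next
    case (Suc N)
    have "P (Suc N) = P N + of_nat (Suc N) powr (-s)"
      by (simp add: P_def powr_minus divide_inverse)
    also have "P N + of_nat (Suc N) powr (-s) = 1 / (s - 1) + 1 / 2 + (\<Sum>n<N. s * (s + 1) * trapezoid_error n s)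
        + of_nat (Suc N) powr (-s) / 2 + of_nat (Suc N) powr (1-s) / (1-s)"
      unfolding Suc by simp
    also have "\<dots> = 1 / (s - 1) + 1 / 2 + ((\<Sum>n<N. s * (s + 1) * trapezoid_error n s) + s * (s + 1) * trapezoid_error N s)
        - of_nat (Suc (Suc N)) powr (-s) / 2 + of_nat (Suc (Suc N)) powr (1-s) / (1-s)"
      unfolding trapezoid_error_eq[OF s1, of N] by (simp add: diff_divide_distrib add_divide_distrib)
    finally show ?case by simp
  qed
  have lim: "(\<lambda>N. of_nat (Suc N) powr w :: complex) \<longlonglongrightarrow> 0" if "Re w < 0" for w
  proof -
    have "(\<lambda>N. real (Suc N) powr Re w) \<longlonglongrightarrow> 0"
      using LIMSEQ_Suc[OF tendsto_neg_powr[OF that filterlim_real_sequentially]] .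
    thus ?thesis
      by (rule Lim_transform_bound[rotated]) (auto simp: norm_powr_real_powr)
  qed
  have "(\<lambda>N. \<Sum>n<N. s * (s + 1) * trapezoid_error n s) \<longlonglongrightarrow> s * (s + 1) * trapezoid_error_sum s"
    using sums_mult[OF summable_sums[OF summable_trapezoid_error]] assms unfolding trapezoid_error_sum_def sums_def by simp
  hence "(\<lambda>N. 1 / (s - 1) + 1 / 2 + (\<Sum>n<N. s * (s + 1) * trapezoid_error n s)
     - of_nat (Suc N) powr (-s) / 2 + of_nat (Suc N) powr (1-s) / (1-s))
     \<longlonglongrightarrow> 1 / (s - 1) + 1 / 2 + s * (s + 1) * trapezoid_error_sum s - 0 / 2 + 0 / (1 - s)"
    using assms s1 by (intro tendsto_intros lim) auto
  thus ?thesis unfolding sums_def zeta_right_def using eq by (simp add: P_def)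
qed

section \<open>Functional equation, on a real segment and then in a strip\<close>

text \<open>Logarithmic derivative of Euler's reflection formula, with the left side differentiated
  as a product and the right side directly.\<close>

lemma Digamma_reflection:
  fixes z :: complex
  assumes "z \<notin> \<int>"
  shows "Digamma (1 - z) - Digamma z = of_real pi * cot (of_real pi * z)"
proof -
  have z: "z \<notin> \<int>\<^sub>\<le>\<^sub>0" "1 - z \<notin> \<int>\<^sub>\<le>\<^sub>0"
    using assms nonpos_Ints_subset_Ints by (auto dest: Ints_diff[OF Ints_1])
  have s: "sin (of_real pi * z) \<noteq> 0"
    using assms by (auto simp: sin_eq_0 mult.commute)
  have "((\<lambda>z. Gamma z * Gamma (1 - z)) has_field_derivative
      Gamma z * Gamma (1 - z) * (Digamma z - Digamma (1 - z))) (at z)"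
    using z by (auto intro!: derivative_eq_intros simp: algebra_simps)
  moreover have "((\<lambda>z. Gamma z * Gamma (1 - z)) has_field_derivative
      - (of_real pi / sin (of_real pi * z)) * (of_real pi * cot (of_real pi * z))) (at z)"
    unfolding Gamma_reflection_complex using s
    by (auto intro!: derivative_eq_intros simp: cot_def divide_simps)
  ultimately have "Gamma z * Gamma (1 - z) * (Digamma z - Digamma (1 - z)) =
      - (of_real pi / sin (of_real pi * z)) * (of_real pi * cot (of_real pi * z))"
    by (rule DERIV_unique)
  hence "(of_real pi / sin (of_real pi * z)) * (Digamma z - Digamma (1 - z)) =
      (of_real pi / sin (of_real pi * z)) * (- (of_real pi * cot (of_real pi * z)))"
    unfolding Gamma_reflection_complex by simp
  hence "Digamma z - Digamma (1 - z) = - (of_real pi * cot (of_real pi * z))"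
    by (subst (asm) mult_cancel_left) (use s in simp)
  thus ?thesis by (simp add: algebra_simps)
qed

text \<open>The right side is \<open>coth (u / 2) / 2 - 1 / u\<close>. At the imaginary point
  \<open>z = \<i> * u / (2 * pi)\<close> the cotangent of \<open>Digamma_reflection\<close> becomes
  hyperbolic, and subtracting the Digamma series at \<open>1 - z\<close> and \<open>1 + z\<close>
  term by term gives the partial fractions.\<close>

lemma coth_partial_fractions:
  fixes u :: real
  assumes u: "u > 0"
  shows "(\<lambda>m. 2 * u / (u\<^sup>2 + (2 * pi * real (Suc m))\<^sup>2)) sums
           ((1 + exp (- u)) / (2 * (1 - exp (- u))) - 1 / u)"
proof -
  define z where "z = \<i> * of_real (u / (2 * pi))"
  have z0: "z \<noteq> 0" using u by (simp add: z_def)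
  have zZ: "z \<notin> \<int>"
  proof
    assume "z \<in> \<int>"
    hence "Im z = 0" by (auto elim!: Ints_cases)
    thus False using u by (simp add: z_def)
  qed
  have "z + 1 \<noteq> 0" "1 - z \<noteq> 0" using u by (auto simp: z_def complex_eq_iff)
  from sums_diff[OF summable_sums[OF summable_Digamma[OF this(2)]] summable_sums[OF summable_Digamma[OF this(1)]]]
  have "(\<lambda>n. inverse (z + 1 + of_nat n) - inverse (1 - z + of_nat n)) sums
     (Digamma (1 - z) - Digamma (z + 1))"
    by (simp add: Digamma_def)
  also have "Digamma (1 - z) - Digamma (z + 1) = of_real pi * cot (of_real pi * z) - 1 / z"
    using Digamma_reflection[OF zZ] Digamma_plus1[OF z0] by (simp add: algebra_simps)
  finally have "(\<lambda>n. \<i> / (2 * of_real pi) * (inverse (z + 1 + of_nat n) - inverse (1 - z + of_nat n))) sums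
     (\<i> / (2 * of_real pi) * (of_real pi * cot (of_real pi * z) - 1 / z))"
    by (rule sums_mult)
  also have "(\<lambda>n. \<i> / (2 * of_real pi) * (inverse (z + 1 + of_nat n) - inverse (1 - z + of_nat n))) =
    (\<lambda>n. of_real (2 * u / (u\<^sup>2 + (2 * pi * real (Suc n))\<^sup>2)))"
  proof
    fix n :: nat
    have nz: "z + 1 + of_nat n \<noteq> 0" "1 - z + of_nat n \<noteq> 0"
      using u by (auto simp: z_def complex_eq_iff)
    have "(z + 1 + of_nat n) * (1 - z + of_nat n) = (of_nat (Suc n))\<^sup>2 - z\<^sup>2"
      by (simp add: power2_eq_square algebra_simps)
    also have "z\<^sup>2 = - of_real ((u / (2 * pi))\<^sup>2)"
      by (simp add: z_def power_mult_distrib power_divide)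
    finally have p: "(z + 1 + of_nat n) * (1 - z + of_nat n) = of_real ((real (Suc n))\<^sup>2 + (u / (2 * pi))\<^sup>2)"
      by simp
    have "inverse (z + 1 + of_nat n) - inverse (1 - z + of_nat n) =
        - 2 * z / ((z + 1 + of_nat n) * (1 - z + of_nat n))"
      using nz by (simp add: field_simps)
    hence "\<i> / (2 * of_real pi) * (inverse (z + 1 + of_nat n) - inverse (1 - z + of_nat n)) =
       of_real ((u / (2 * pi\<^sup>2)) / ((real (Suc n))\<^sup>2 + (u / (2 * pi))\<^sup>2))"
      unfolding p by (simp add: z_def power2_eq_square)
    also have "(u / (2 * pi\<^sup>2)) / ((real (Suc n))\<^sup>2 + (u / (2 * pi))\<^sup>2) = 2 * u / (u\<^sup>2 + (2 * pi * real (Suc n))\<^sup>2)"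
    proof -
      define X where "X = (real (Suc n))\<^sup>2 + (u / (2 * pi))\<^sup>2"
      have "X > 0" unfolding X_def by (intro add_pos_nonneg) auto
      moreover have "u\<^sup>2 + (2 * pi * real (Suc n))\<^sup>2 = 4 * pi\<^sup>2 * X"
        by (simp add: X_def power_mult_distrib power_divide distrib_left del: of_nat_Suc)
      ultimately show ?thesis
        unfolding X_def[symmetric] by (simp add: divide_simps)
    qed
    finally show "\<i> / (2 * of_real pi) * (inverse (z + 1 + of_nat n) - inverse (1 - z + of_nat n)) =
       of_real (2 * u / (u\<^sup>2 + (2 * pi * real (Suc n))\<^sup>2))" .
  qed
  also have "\<i> / (2 * of_real pi) * (of_real pi * cot (of_real pi * z) - 1 / z) =
      of_real ((1 + exp (- u)) / (2 * (1 - exp (- u))) - 1 / u)"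
  proof -
    have pz: "of_real pi * z = \<i> * of_real (u / 2)" by (simp add: z_def)
    define E where "E = exp (u / 2)"
    have E: "E > 1" "exp (- u) = 1 / (E * E)" using u
      by (auto simp: E_def exp_minus divide_simps simp flip: exp_add)
    have "\<i> * (\<i> * complex_of_real (u / 2)) = of_real (- (u / 2))"
      by (simp only: mult.assoc[symmetric] i_squared) simp
    hence e: "exp (\<i> * (\<i> * complex_of_real (u / 2))) = of_real (1 / E)"
      "exp (- (\<i> * (\<i> * complex_of_real (u / 2)))) = of_real E"
      by (simp_all only: of_real_minus[symmetric] exp_of_real E_def exp_minus minus_minus inverse_eq_divide)
    have "cot (\<i> * complex_of_real (u / 2)) = - \<i> * of_real ((1 + exp (- u)) / (1 - exp (- u)))"
    proof -
      have EE: "E * E > 1" using E(1) by (metis less_1_mult)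
      have "cot (\<i> * complex_of_real (u / 2)) = \<i> * of_real ((1 / E + E) / (1 / E - E))"
      proof -
        have "(A / 2) / (B / (2 * \<i>)) = \<i> * (A / B)" for A B :: complex
          by (cases "B = 0") (simp_all add: divide_simps)
        thus ?thesis
          unfolding cot_def sin_exp_eq cos_exp_eq e unfolding of_real_divide of_real_add of_real_diff .
      qed
      also have "(1 / E + E) / (1 / E - E) = - ((1 + exp (- u)) / (1 - exp (- u)))"
        unfolding E(2) using E(1) EE by (simp add: divide_simps) (simp add: algebra_simps)
      finally show ?thesis by simp
    qed
    moreover define c where "c = (1 + exp (- u)) / (1 - exp (- u))"
    ultimately have cot: "cot (\<i> * complex_of_real (u / 2)) = - \<i> * of_real c" by simp
    have e: "(1 + exp (- u)) / (2 * (1 - exp (- u))) = c / 2" by (simp add: c_def)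
    show ?thesis unfolding pz cot e using u by (simp add: z_def field_simps)
  qed
  finally show ?thesis unfolding sums_of_real_iff .
qed

lemma nn_integral_Gamma_scaled:
  fixes x p :: real
  assumes x: "x > 0" and p: "p > 0"
  shows "(\<integral>\<^sup>+u. ennreal (u powr (p - 1) * exp (- x * u)) * indicator {0<..} u \<partial>lborel)
           = ennreal (Gamma p * x powr (- p))"
proof -
  have "ennreal (Gamma p) = (\<integral>\<^sup>+t. ennreal (indicator {0..} t * t powr (p - 1) / exp t) \<partial>lborel)"
    by (rule Gamma_conv_nn_integral_real[OF p])
  also have "\<dots> = \<bar>x\<bar> * (\<integral>\<^sup>+u. ennreal (indicator {0..} (0 + x * u) * (0 + x * u) powr (p - 1) / exp (0 + x * u)) \<partial>lborel)"
    using x by (intro nn_integral_real_affine) auto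
  also have "(\<integral>\<^sup>+u. ennreal (indicator {0..} (0 + x * u) * (0 + x * u) powr (p - 1) / exp (0 + x * u)) \<partial>lborel)
     = (\<integral>\<^sup>+u. ennreal (x powr (p - 1)) * (ennreal (u powr (p - 1) * exp (- x * u)) * indicator {0<..} u) \<partial>lborel)"
  proof (intro nn_integral_cong, goal_cases)
    case (1 u)
    consider "u < 0" | "u = 0" | "u > 0" by linarith
    thus ?case
      using x by cases (auto simp: zero_le_mult_iff powr_mult exp_minus divide_inverse ennreal_mult' mult_ac)
  qed
  also have "\<dots> = ennreal (x powr (p - 1)) * (\<integral>\<^sup>+u. ennreal (u powr (p - 1) * exp (- x * u)) * indicator {0<..} u \<partial>lborel)"
    by (intro nn_integral_cmult) auto
  finally have "ennreal (x powr (- p)) * ennreal (Gamma p) = ennreal (x powr (- p)) * (ennreal \<bar>x\<bar> * (ennreal (x powr (p - 1)) *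
     (\<integral>\<^sup>+u. ennreal (u powr (p - 1) * exp (- x * u)) * indicator {0<..} u \<partial>lborel)))"
    by simp
  also have "\<dots> = ennreal (x powr (- p) * (x * x powr (p - 1))) *
     (\<integral>\<^sup>+u. ennreal (u powr (p - 1) * exp (- x * u)) * indicator {0<..} u \<partial>lborel)"
    using x by (simp add: ennreal_mult' mult_ac)
  also have "x powr (- p) * (x * x powr (p - 1)) = 1"
    using x by (simp add: powr_minus powr_diff)
  finally show ?thesis
    using p by (subst mult.commute) (simp add: ennreal_mult' Gamma_real_nonneg)
qed

text \<open>The substitution \<open>u = a * sqrt (y / (1 - y))\<close> turns the integral into a
  multiple of \<open>Beta p q\<close> with \<open>p + q = 1\<close>, which the reflection formula of
  Gamma evaluates.\<close>

lemma nn_integral_powr_over_sum_squares: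
  fixes a s :: real
  assumes a: "a > 0" and s: "-1 < s" "s < 1"
  shows "(\<integral>\<^sup>+u. ennreal (u powr s / (u\<^sup>2 + a\<^sup>2)) * indicator {0<..} u \<partial>lborel)
           = ennreal (a powr (s - 1) * pi / (2 * cos (pi * s / 2)))"
proof -
  define p q where "p = (1 + s) / 2" and "q = (1 - s) / 2"
  have pq: "p > 0" "q > 0" "p + q = 1" using s by (auto simp: p_def q_def field_simps)
  define g where "g = (\<lambda>y::real. a * (y / (1 - y)) powr (1/2))"
  define g' where "g' = (\<lambda>y::real. a / 2 * (y powr (-1/2) * (1 - y) powr (-3/2)))"
  define f where "f = (\<lambda>u::real. u powr s / (u\<^sup>2 + a\<^sup>2))"
  have B: "((\<lambda>y. y powr (p - 1) * (1 - y) powr (q - 1)) has_integral Beta p q) {0..1}"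
    by (rule has_integral_Beta_real) fact+
  have Bv: "Beta p q = pi / cos (pi * s / 2)"
  proof -
    have "q = 1 - p" using pq by simp
    have "complex_of_real (Gamma p * Gamma (1 - p)) = of_real (pi / sin (pi * p))"
    proof -
      have e: "1 - complex_of_real p = of_real (1 - p)" "of_real pi * complex_of_real p = of_real (pi * p)"
        by simp_all
      show ?thesis
        using Gamma_reflection_complex[of "of_real p"]
        unfolding e Gamma_complex_of_real sin_of_real of_real_mult[symmetric] of_real_divide[symmetric] .
    qed
    hence "Gamma p * Gamma (1 - p) = pi / sin (pi * p)"
      unfolding of_real_eq_iff .
    also have "sin (pi * p) = cos (pi * s / 2)"
      using sin_cos_eq[of "pi * p"] cos_minus[of "pi * s / 2"] by (simp add: p_def field_simps)
    finally show ?thesis using pq by (simp add: Beta_def \<open>q = 1 - p\<close>)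
  qed
  have eq: "\<bar>g' y\<bar> * f (g y) = a powr (s - 1) / 2 * (y powr (p - 1) * (1 - y) powr (q - 1))"
    if y: "y \<in> {0<..<1}" for y
  proof -
    have gy: "g y = a * (y powr (1/2) * (1 - y) powr (- (1/2)))"
      using y by (simp add: g_def powr_divide powr_minus field_simps)
    have "(g y)\<^sup>2 = a\<^sup>2 * (y / (1 - y))"
      using y by (simp add: g_def power_mult_distrib powr_half_sqrt)
    hence "(g y)\<^sup>2 + a\<^sup>2 = a\<^sup>2 * (1 - y) powr (-1)"
      using y by (simp add: powr_minus field_simps)
    hence "f (g y) = (a powr s * (y powr (s/2) * (1 - y) powr (- (s/2)))) / (a\<^sup>2 * (1 - y) powr (-1))"
      unfolding f_def gy using y a by (simp add: powr_mult powr_powr)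
    also have "\<dots> = a powr (s - 2) * y powr (s/2) * ((1 - y) powr (- (s/2)) * (1 - y) powr 1)"
      using y a by (simp add: powr_diff powr_minus field_simps)
    finally have "\<bar>g' y\<bar> * f (g y) = (a powr 1 * a powr (s - 2)) / 2 * ((y powr (-1/2) * y powr (s/2)) *
        ((1 - y) powr (-3/2) * ((1 - y) powr (- (s/2)) * (1 - y) powr 1)))"
      using a y by (simp add: g'_def abs_mult)
    also have "\<dots> = a powr (s - 1) / 2 * (y powr (p - 1) * (1 - y) powr (q - 1))"
    proof -
      have e: "1 + (s - 2) = s - 1" "-1/2 + s/2 = p - 1" "-3/2 + (- (s/2) + 1) = q - 1"
        by (simp_all add: p_def q_def field_simps)
      show ?thesis unfolding powr_add[symmetric] e by simp
    qed
    finally show ?thesis .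
  qed
  have "((\<lambda>y. a powr (s - 1) / 2 * (y powr (p - 1) * (1 - y) powr (q - 1))) has_integral
           a powr (s - 1) / 2 * Beta p q) {0..1}"
    by (rule has_integral_mult_right[OF B])
  hence "((\<lambda>y. a powr (s - 1) / 2 * (y powr (p - 1) * (1 - y) powr (q - 1))) has_integral
           a powr (s - 1) / 2 * Beta p q) {0<..<1}"
    by (simp add: has_integral_Icc_iff_Ioo)
  hence hi: "((\<lambda>y. \<bar>g' y\<bar> * f (g y)) has_integral a powr (s - 1) / 2 * Beta p q) {0<..<1}"
    by (rule has_integral_eq[rotated]) (use eq in auto)
  have fnn: "f u \<ge> 0" for u by (simp add: f_def)
  have "(\<lambda>y. \<bar>g' y\<bar> * f (g y)) absolutely_integrable_on {0<..<1} \<and>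
        integral {0<..<1} (\<lambda>y. \<bar>g' y\<bar> * f (g y)) = a powr (s - 1) / 2 * Beta p q"
    using hi fnn by (auto intro!: nonnegative_absolutely_integrable_1 dest: integral_unique)
  moreover have "(g has_field_derivative g' y) (at y within {0<..<1})" if y: "y \<in> {0<..<1}" for y
  proof -
    have "((\<lambda>y. y / (1 - y)) has_field_derivative 1 / (1 - y)\<^sup>2) (at y)"
      using y by (auto intro!: derivative_eq_intros simp: power2_eq_square divide_simps)
    from DERIV_powr[OF this _ DERIV_const, of "1/2"] y
    have "((\<lambda>y. (y / (1 - y)) powr (1/2)) has_field_derivative
        (y / (1 - y)) powr (1/2) * (1 / (1 - y)\<^sup>2 * (1/2) / (y / (1 - y)))) (at y)"
      by simp
    from DERIV_cmult[OF this, of a]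
    have "(g has_field_derivative a * ((y / (1 - y)) powr (1/2) * (1 / (1 - y)\<^sup>2 * (1/2) / (y / (1 - y))))) (at y)"
      by (simp add: g_def)
    also have "a * ((y / (1 - y)) powr (1/2) * (1 / (1 - y)\<^sup>2 * (1/2) / (y / (1 - y)))) = g' y"
    proof -
      have "(1 - y)\<^sup>2 = (1 - y) powr 2" using y by simp
      hence "a * ((y / (1 - y)) powr (1/2) * (1 / (1 - y)\<^sup>2 * (1/2) / (y / (1 - y)))) =
        a / 2 * ((y powr (1/2) * y powr (-1)) * ((1 - y) powr (-1/2) * (1 - y) powr (-2) * (1 - y) powr 1))"
        using y by (simp add: powr_divide powr_minus field_simps)
      also have "\<dots> = g' y"
        unfolding powr_add[symmetric] g'_def by simp
      finally show ?thesis .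
    qed
    finally show ?thesis by (rule has_field_derivative_at_within)
  qed
  moreover have ginv: "y = (g y)\<^sup>2 / (a\<^sup>2 + (g y)\<^sup>2)" if y: "y \<in> {0<..<1}" for y
  proof -
    have "(g y)\<^sup>2 = a\<^sup>2 * (y / (1 - y))"
      using y by (simp add: g_def power_mult_distrib powr_half_sqrt)
    moreover have "a\<^sup>2 + a\<^sup>2 * (y / (1 - y)) = a\<^sup>2 / (1 - y)"
      using y by (simp add: field_simps)
    ultimately show ?thesis using y a by simp
  qed
  moreover have "inj_on g {0<..<1}" by (rule inj_onI) (metis ginv)
  moreover have "g ` {0<..<1} = {0<..}"
  proof (intro equalityI subsetI)
    fix u assume "u \<in> g ` {0<..<1}" thus "u \<in> {0<..}" using a by (auto simp: g_def)
  next
    fix u :: real assume u: "u \<in> {0<..}"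
    define y where "y = u\<^sup>2 / (a\<^sup>2 + u\<^sup>2)"
    have pos: "a\<^sup>2 + u\<^sup>2 > 0" using a by (simp add: add_pos_nonneg)
    have "1 - y = a\<^sup>2 / (a\<^sup>2 + u\<^sup>2)" using pos a unfolding y_def by (simp add: divide_simps)
    hence "y / (1 - y) = (u / a)\<^sup>2" using pos a by (simp add: y_def power_divide)
    hence "g y = u" using a u by (simp add: g_def powr_half_sqrt)
    moreover have "y \<in> {0<..<1}" using pos u a by (auto simp: y_def field_simps)
    ultimately show "u \<in> g ` {0<..<1}" by blast
  qed
  ultimately have "f absolutely_integrable_on {0<..} \<and> integral {0<..} f = a powr (s - 1) / 2 * Beta p q"
    using has_absolute_integral_change_of_variables_1'[of "{0<..<1}" g g' f "a powr (s - 1) / 2 * Beta p q"]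
    by auto
  hence "(f has_integral a powr (s - 1) / 2 * Beta p q) {0<..}"
    using has_integral_iff set_lebesgue_integral_eq_integral(1) by blast
  from nn_integral_has_integral_lebesgue'[OF fnn this] show ?thesis
    by (simp add: f_def Bv mult.commute)
qed

text \<open>\<open>has_integral_trapezoid\<close> for \<open>exp (- (v * u)) / u\<^sup>2\<close>,
  whose second derivative in \<open>v\<close> is the exponential itself.\<close>

lemma nn_integral_trapezoid_exp:
  fixes u :: real
  assumes u: "u > 0"
  shows "(\<integral>\<^sup>+v. ennreal (v * (1 - v) / 2 * exp (- (v * u))) * indicator {0<..<1} v \<partial>lborel) =
           ennreal ((1 + exp (- u)) / (2 * u\<^sup>2) - (1 - exp (- u)) / u ^ 3)"
proof -
  have d: "((\<lambda>v. c * exp (- (v * u))) has_vector_derivative - c * u * exp (- (v * u))) (at v within A)" for c v A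
    by (auto intro!: derivative_eq_intros simp flip: has_real_derivative_iff_has_vector_derivative)
  have "((\<lambda>v. (v * (1 - v) / 2) *\<^sub>R (1 * exp (- (v * u)))) has_integral
           (1/2) *\<^sub>R ((1 / u\<^sup>2) * exp (- (0 * u)) + (1 / u\<^sup>2) * exp (- (1 * u)))
            - ((- 1 / u ^ 3) * exp (- (1 * u)) - (- 1 / u ^ 3) * exp (- (0 * u)))) {0..1}"
  proof (rule has_integral_trapezoid)
    fix v :: real
    show "((\<lambda>v. (- 1 / u ^ 3) * exp (- (v * u))) has_vector_derivative (1 / u\<^sup>2) * exp (- (v * u))) (at v within {0..1})"
      using d[of "- 1 / u ^ 3" v] u by (simp add: power2_eq_square power3_eq_cube)
    show "((\<lambda>v. (1 / u\<^sup>2) * exp (- (v * u))) has_vector_derivative (- 1 / u) * exp (- (v * u))) (at v within {0..1})"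
      using d[of "1 / u\<^sup>2" v] u by (simp add: power2_eq_square)
    show "((\<lambda>v. (- 1 / u) * exp (- (v * u))) has_vector_derivative 1 * exp (- (v * u))) (at v within {0..1})"
      using d[of "- 1 / u" v] u by simp
  qed
  also have "(1/2) *\<^sub>R ((1 / u\<^sup>2) * exp (- (0 * u)) + (1 / u\<^sup>2) * exp (- (1 * u)))
            - ((- 1 / u ^ 3) * exp (- (1 * u)) - (- 1 / u ^ 3) * exp (- (0 * u))) =
       (1 + exp (- u)) / (2 * u\<^sup>2) - (1 - exp (- u)) / u ^ 3"
    by (simp add: add_divide_distrib diff_divide_distrib)
  finally have "((\<lambda>v. v * (1 - v) / 2 * exp (- (v * u))) has_integral
      (1 + exp (- u)) / (2 * u\<^sup>2) - (1 - exp (- u)) / u ^ 3) {0<..<1}"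
    by (simp add: has_integral_Icc_iff_Ioo)
  from nn_integral_has_integral_lebesgue'[OF _ this] show ?thesis
    by simp
qed

lemma trapezoid_error_of_real:
  "trapezoid_error n (of_real s) = of_real (integral {0..1} (\<lambda>v. v * (1 - v) / 2 * (real (Suc n) + v) powr (- s - 2)))"
proof -
  have "trapezoid_error n (of_real s) = integral {0..1} (\<lambda>v. of_real (v * (1 - v) / 2 * (real (Suc n) + v) powr (- s - 2)))"
    unfolding trapezoid_error_def
  proof (rule integral_cong, goal_cases)
    case (1 v)
    have e: "- complex_of_real s - 2 = of_real (- s - 2)" by simp
    have "complex_of_real (real (Suc n) + v) powr of_real (- s - 2) = of_real ((real (Suc n) + v) powr (- s - 2))"
      using 1 by (intro powr_of_real) auto
    thus ?case unfolding e by (simp only: scaleR_conv_of_real of_real_mult)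
  qed
  also have "\<dots> = of_real (integral {0..1} (\<lambda>v. v * (1 - v) / 2 * (real (Suc n) + v) powr (- s - 2)))"
    by (rule integral_unique[OF has_integral_of_real[OF integrable_integral]])
       (auto intro!: integrable_continuous_real continuous_intros)
  finally show ?thesis .
qed

context
  fixes s :: real
  assumes s: "-1 < s" "s < 0"
begin

text \<open>Both sides are the integral over \<open>u > 0\<close> of \<open>u powr (s - 1) * (coth (u / 2) / 2 - 1 / u)\<close>: the left
  one expands \<open>1 / (1 - exp (- u))\<close> geometrically, the right one uses \<open>coth_partial_fractions\<close>.\<close>

lemma suminf_nn_integral_trapezoid:
  "ennreal (Gamma (s + 2)) *
     (\<Sum>n. \<integral>\<^sup>+v. ennreal (v * (1 - v) / 2 * (real n + v) powr (- s - 2)) * indicator {0<..<1} v \<partial>lborel)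
   = (\<Sum>m. ennreal ((2 * pi * real (Suc m)) powr (s - 1) * pi / cos (pi * s / 2)))"
proof -
  define b where "b = (\<lambda>v::real. v * (1 - v) / 2)"
  define \<beta> where "\<beta> = (\<lambda>u::real. (1 + exp (- u)) / (2 * u\<^sup>2) - (1 - exp (- u)) / u ^ 3)"
  have [measurable]: "b \<in> borel_measurable borel" unfolding b_def by measurable
  have [measurable]: "\<beta> \<in> borel_measurable borel" unfolding \<beta>_def by measurable
  have b: "b v \<ge> 0" if "v \<in> {0<..<1}" for v using that by (auto simp: b_def)
  have coth: "(\<lambda>m. 2 * u / (u\<^sup>2 + (2 * pi * real (Suc m))\<^sup>2)) sums (u\<^sup>2 * \<beta> u / (1 - exp (- u)))"
    if u: "u > 0" for u
  proof -
    have "u\<^sup>2 * \<beta> u / (1 - exp (- u)) = (1 + exp (- u)) / (2 * (1 - exp (- u))) - 1 / u"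
      using u by (simp add: \<beta>_def field_simps power2_eq_square power3_eq_cube)
    thus ?thesis using coth_partial_fractions[OF u] by simp
  qed
  \<comment> \<open>Positivity is read off from the positive terms of the partial fraction
    series.\<close>
  have \<beta>: "\<beta> u \<ge> 0" if u: "u > 0" for u
  proof -
    have "u\<^sup>2 * \<beta> u / (1 - exp (- u)) \<ge> 0"
      using u by (intro sums_le[OF _ sums_zero coth[OF u]]) (auto intro!: divide_nonneg_nonneg)
    thus ?thesis using u by (simp add: zero_le_divide_iff zero_le_mult_iff)
  qed
  \<comment> \<open>Each power of \<open>n + v\<close> becomes a Gamma integral in \<open>u\<close>,
    after which the \<open>v\<close>-integral can be done in closed form. All integrands are
    nonnegative, so Tonelli allows the exchange without a convergence check.\<close>
  have Gamma_times: "ennreal (Gamma (s + 2)) *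
      (\<integral>\<^sup>+v. ennreal (b v * (real n + v) powr (- s - 2)) * indicator {0<..<1} v \<partial>lborel) =
      (\<integral>\<^sup>+u. ennreal (u powr (s + 1) * \<beta> u * exp (- u) ^ n) * indicator {0<..} u \<partial>lborel)" for n
  proof -
    have "ennreal (Gamma (s + 2)) *
      (\<integral>\<^sup>+v. ennreal (b v * (real n + v) powr (- s - 2)) * indicator {0<..<1} v \<partial>lborel) =
      (\<integral>\<^sup>+v. ennreal (Gamma (s + 2)) * (ennreal (b v * (real n + v) powr (- s - 2)) * indicator {0<..<1} v) \<partial>lborel)"
      by (rule nn_integral_cmult[symmetric]) measurable
    also have "\<dots> = (\<integral>\<^sup>+v. (\<integral>\<^sup>+u. ennreal (b v) * indicator {0<..<1} v *
        (ennreal (u powr (s + 1) * exp (- (real n + v) * u)) * indicator {0<..} u) \<partial>lborel) \<partial>lborel)"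
    proof (intro nn_integral_cong, goal_cases)
      case (1 v)
      show ?case
      proof (cases "v \<in> {0<..<1}")
        case True
        have "(\<integral>\<^sup>+u. ennreal (b v) * indicator {0<..<1} v *
          (ennreal (u powr (s + 1) * exp (- (real n + v) * u)) * indicator {0<..} u) \<partial>lborel) =
          ennreal (b v) * (\<integral>\<^sup>+u. (ennreal (u powr (s + 1) * exp (- (real n + v) * u)) * indicator {0<..} u) \<partial>lborel)"
          using True by (subst nn_integral_cmult) auto
        also have "(\<integral>\<^sup>+u. (ennreal (u powr (s + 1) * exp (- (real n + v) * u)) * indicator {0<..} u) \<partial>lborel) =
           ennreal (Gamma (s + 2) * (real n + v) powr (- s - 2))"
          using nn_integral_Gamma_scaled[of "real n + v" "s + 2"] True s by (simp add: add_ac)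
        finally show ?thesis using True b[OF True] s
          by (simp add: ennreal_mult' Gamma_real_nonneg mult_ac)
      qed auto
    qed
    also have "\<dots> = (\<integral>\<^sup>+u. (\<integral>\<^sup>+v. ennreal (b v) * indicator {0<..<1} v *
        (ennreal (u powr (s + 1) * exp (- (real n + v) * u)) * indicator {0<..} u) \<partial>lborel) \<partial>lborel)"
      by (rule lborel_pair.Fubini') measurable
    also have "\<dots> = (\<integral>\<^sup>+u. ennreal (u powr (s + 1) * \<beta> u * exp (- u) ^ n) * indicator {0<..} u \<partial>lborel)"
    proof (intro nn_integral_cong, goal_cases)
      case (1 u)
      show ?case
      proof (cases "u > 0")
        case True
        have "(\<integral>\<^sup>+v. ennreal (b v) * indicator {0<..<1} v *
            (ennreal (u powr (s + 1) * exp (- (real n + v) * u)) * indicator {0<..} u) \<partial>lborel) =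
          (\<integral>\<^sup>+v. ennreal (u powr (s + 1) * exp (- u) ^ n) * (ennreal (b v * exp (- (v * u))) * indicator {0<..<1} v) \<partial>lborel)"
        proof (intro nn_integral_cong, goal_cases)
          case (1 v)
          have "exp (- (real n + v) * u) = exp (- u) ^ n * exp (- (v * u))"
            unfolding exp_of_nat_mult[symmetric] exp_add[symmetric] by (simp add: algebra_simps)
          thus ?case using True b[of v]
            by (cases "v \<in> {0<..<1}") (simp_all add: ennreal_mult' mult_ac)
        qed
        also have "\<dots> = ennreal (u powr (s + 1) * exp (- u) ^ n) * ennreal (\<beta> u)"
          unfolding \<beta>_def b_def
          by (subst nn_integral_cmult, measurable) (simp only: nn_integral_trapezoid_exp[OF True])
        finally show ?thesis using True \<beta>[OF True] by (simp add: ennreal_mult' mult_ac)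
      qed auto
    qed
    finally show ?thesis .
  qed
  have "ennreal (Gamma (s + 2)) *
     (\<Sum>n. \<integral>\<^sup>+v. ennreal (b v * (real n + v) powr (- s - 2)) * indicator {0<..<1} v \<partial>lborel)
    = (\<Sum>n. \<integral>\<^sup>+u. ennreal (u powr (s + 1) * \<beta> u * exp (- u) ^ n) * indicator {0<..} u \<partial>lborel)"
    by (subst ennreal_suminf_cmult[symmetric]) (simp add: Gamma_times)
  also have "\<dots> = (\<integral>\<^sup>+u. (\<Sum>n. ennreal (u powr (s + 1) * \<beta> u * exp (- u) ^ n) * indicator {0<..} u) \<partial>lborel)"
    by (rule nn_integral_suminf[symmetric]) measurable
  also have "\<dots> = (\<integral>\<^sup>+u. (\<Sum>m. ennreal 2 * (ennreal (u powr s / (u\<^sup>2 + (2 * pi * real (Suc m))\<^sup>2)) * indicator {0<..} u)) \<partial>lborel)"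
  proof (intro nn_integral_cong, goal_cases)
    case (1 u)
    show ?case
    proof (cases "u > 0")
      case True
      have "(\<lambda>n. u powr (s + 1) * \<beta> u * exp (- u) ^ n) sums (u powr (s + 1) * \<beta> u * (1 / (1 - exp (- u))))"
        using True by (intro sums_mult geometric_sums) auto
      hence "(\<Sum>n. ennreal (u powr (s + 1) * \<beta> u * exp (- u) ^ n)) = ennreal (u powr (s + 1) * \<beta> u * (1 / (1 - exp (- u))))"
        using \<beta>[OF True] by (intro suminf_ennreal_eq) auto
      also have "u powr (s + 1) * \<beta> u * (1 / (1 - exp (- u))) = u powr (s - 1) * (u\<^sup>2 * \<beta> u / (1 - exp (- u)))"
      proof -
        have "u powr (s + 1) = u powr (s - 1) * u\<^sup>2"
          using True powr_add[of u "s - 1" 2] by (simp add: add.commute)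
        thus ?thesis by simp
      qed
      also have "ennreal \<dots> = (\<Sum>m. ennreal (u powr (s - 1) * (2 * u / (u\<^sup>2 + (2 * pi * real (Suc m))\<^sup>2))))"
        using True by (intro suminf_ennreal_eq[symmetric] sums_mult coth) (auto intro!: mult_nonneg_nonneg divide_nonneg_nonneg)
      also have "(\<lambda>m. u powr (s - 1) * (2 * u / (u\<^sup>2 + (2 * pi * real (Suc m))\<^sup>2))) =
          (\<lambda>m. 2 * (u powr s / (u\<^sup>2 + (2 * pi * real (Suc m))\<^sup>2)))"
        using True by (simp add: powr_diff mult.commute)
      also have "(\<lambda>m. ennreal (2 * (u powr s / (u\<^sup>2 + (2 * pi * real (Suc m))\<^sup>2)))) =
          (\<lambda>m. ennreal 2 * ennreal (u powr s / (u\<^sup>2 + (2 * pi * real (Suc m))\<^sup>2)))"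
        by (intro ext ennreal_mult') simp
      finally show ?thesis using True by simp
    qed auto
  qed
  also have "\<dots> = (\<Sum>m. \<integral>\<^sup>+u. ennreal 2 * (ennreal (u powr s / (u\<^sup>2 + (2 * pi * real (Suc m))\<^sup>2)) * indicator {0<..} u) \<partial>lborel)"
    by (rule nn_integral_suminf) measurable
  also have "\<dots> = (\<Sum>m. ennreal ((2 * pi * real (Suc m)) powr (s - 1) * pi / cos (pi * s / 2)))"
  proof (intro suminf_cong, goal_cases)
    case (1 m)
    have "(\<integral>\<^sup>+u. ennreal 2 * (ennreal (u powr s / (u\<^sup>2 + (2 * pi * real (Suc m))\<^sup>2)) * indicator {0<..} u) \<partial>lborel)
       = ennreal 2 * ennreal ((2 * pi * real (Suc m)) powr (s - 1) * pi / (2 * cos (pi * s / 2)))"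
      using s by (subst nn_integral_cmult, measurable) (subst nn_integral_powr_over_sum_squares, auto)
    also have "\<dots> = ennreal (2 * ((2 * pi * real (Suc m)) powr (s - 1) * pi / (2 * cos (pi * s / 2))))"
      by (rule ennreal_mult'[symmetric]) simp
    finally show ?case by simp
  qed
  finally show ?thesis by (simp add: b_def)
qed

text \<open>The sum over \<open>n\<close> in \<open>suminf_nn_integral_trapezoid\<close> starts with
  the interval \<open>[0, 1]\<close>, which is missing from \<open>trapezoid_error_sum\<close>. Its
  term \<open>t0\<close> is finite because \<open>s < 0\<close>, and \<open>s * (s + 1) * t0\<close>
  is exactly the elementary part \<open>1 / (s - 1) + 1 / 2\<close> of \<open>zeta_right\<close>.
  The other side is the Dirichlet series at \<open>1 - s > 1\<close>.\<close>

lemma zeta_right_reflection_real: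
  "of_real (Gamma (s + 2)) * zeta_right (of_real s) =
     of_real (s * (s + 1) * ((2 * pi) powr (s - 1) * pi / cos (pi * s / 2))) * zeta_right (1 - of_real s)"
proof -
  define t where "t = (\<lambda>n. integral {0..1} (\<lambda>v. v * (1 - v) / 2 * (real (Suc n) + v) powr (- s - 2)))"
  define t0 where "t0 = 1 / (2 * (- s) * (1 - s))"
  have t_nonneg: "t n \<ge> 0" for n
    unfolding t_def by (rule integral_nonneg) (auto intro!: integrable_continuous_real continuous_intros)
  have trapezoid_error_t: "trapezoid_error n (of_real s) = of_real (t n)" for n
    by (simp add: trapezoid_error_of_real t_def)
  have "summable (\<lambda>n. complex_of_real (t n))"
    using summable_trapezoid_error[of "of_real s"] s by (simp add: trapezoid_error_t)
  hence sum_t: "summable t" unfolding summable_of_real_iff .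
  have trapezoid_error_sum: "trapezoid_error_sum (of_real s) = of_real (suminf t)"
    unfolding trapezoid_error_sum_def trapezoid_error_t by (rule suminf_of_real[OF sum_t, symmetric])
  have \<tau>: "(\<integral>\<^sup>+v. ennreal (v * (1 - v) / 2 * (real n + v) powr (- s - 2)) * indicator {0<..<1} v \<partial>lborel) =
      ennreal (case n of 0 \<Rightarrow> t0 | Suc m \<Rightarrow> t m)" for n
  proof (cases n)
    case 0
    have "((\<lambda>v. v powr (- s - 1)) has_integral 1 powr (- s - 1 + 1) / (- s - 1 + 1)) {0..1}"
         "((\<lambda>v. v powr (- s)) has_integral 1 powr (- s + 1) / (- s + 1)) {0..1}"
      using s by (intro has_integral_powr_from_0; simp)+
    from has_integral_mult_right[OF has_integral_diff[OF this], of "1/2"]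
    have "((\<lambda>v. 1/2 * (v powr (- s - 1) - v powr (- s))) has_integral 1/2 * (1 / (- s) - 1 / (1 - s))) {0<..<1}"
      by (simp add: has_integral_Icc_iff_Ioo)
    also have "1/2 * (1 / (- s) - 1 / (1 - s)) = t0"
      using s by (simp add: t0_def field_simps)
    finally have "((\<lambda>v. v * (1 - v) / 2 * (real n + v) powr (- s - 2)) has_integral t0) {0<..<1}"
    proof (rule has_integral_eq[rotated], goal_cases)
      case (1 v)
      have "v powr (- s - 1) = v * v powr (- s - 2)" "v powr (- s) = v * (v * v powr (- s - 2))"
        using 1 by (simp_all add: powr_diff powr_minus power2_eq_square field_simps)
      thus ?case using 0 by (simp add: algebra_simps)
    qed
    from nn_integral_has_integral_lebesgue'[OF _ this] show ?thesis using 0 by simp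
  next
    case (Suc m)
    have "((\<lambda>v. v * (1 - v) / 2 * (real n + v) powr (- s - 2)) has_integral t m) {0..1}"
      unfolding t_def Suc by (intro integrable_integral) (auto intro!: integrable_continuous_real continuous_intros)
    hence "((\<lambda>v. v * (1 - v) / 2 * (real n + v) powr (- s - 2)) has_integral t m) {0<..<1}"
      by (simp add: has_integral_Icc_iff_Ioo)
    from nn_integral_has_integral_lebesgue'[OF _ this] show ?thesis using Suc by simp
  qed
  define Z where "Z = (\<Sum>m. real (Suc m) powr (s - 1))"
  define K where "K = (2 * pi) powr (s - 1) * pi / cos (pi * s / 2)"
  have cpos: "cos (pi * s / 2) > 0"
    using s mult_strict_left_mono[of "-1" s pi] mult_strict_left_mono[of s 0 pi]
    by (intro cos_gt_zero_pi) auto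
  have K: "K > 0" using cpos by (simp add: K_def)
  have sumZ: "summable (\<lambda>m. real (Suc m) powr (s - 1))"
    using summable_real_powr_iff[of "s - 1"] s by (subst summable_Suc_iff) auto
  have Zc: "zeta_right (1 - of_real s) = of_real Z"
  proof -
    have "(\<lambda>n. 1 / of_nat (Suc n) powr (1 - complex_of_real s)) sums zeta_right (1 - of_real s)"
      by (rule zeta_right_sums) (use s in auto)
    also have "(\<lambda>n. 1 / of_nat (Suc n) powr (1 - complex_of_real s)) = (\<lambda>n. of_real (real (Suc n) powr (s - 1)))"
    proof
      fix n
      have "of_nat (Suc n) powr (1 - complex_of_real s) = of_real (real (Suc n) powr (1 - s))"
        using powr_of_real[of "real (Suc n)" "1 - s"] by simp
      moreover have "real (Suc n) powr (s - 1) = 1 / real (Suc n) powr (1 - s)"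
        by (metis minus_diff_eq powr_minus_divide)
      ultimately show "1 / of_nat (Suc n) powr (1 - complex_of_real s) = of_real (real (Suc n) powr (s - 1))"
        by simp
    qed
    finally show ?thesis
      using sums_of_real[OF summable_sums[OF sumZ]] unfolding Z_def by (rule sums_unique2)
  qed
  have "(\<Sum>n. ennreal (case n of 0 \<Rightarrow> t0 | Suc m \<Rightarrow> t m)) = ennreal (t0 + suminf t)"
  proof -
    have "(\<lambda>n. case n of 0 \<Rightarrow> t0 | Suc m \<Rightarrow> t m) sums (t0 + suminf t)"
      using sums_Suc[of "\<lambda>n. case n of 0 \<Rightarrow> t0 | Suc m \<Rightarrow> t m" "suminf t"] summable_sums[OF sum_t]
      by (simp add: add.commute[of t0])
    moreover have "t0 \<ge> 0" unfolding t0_def using s by (intro divide_nonneg_nonneg mult_nonneg_nonneg) auto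
    ultimately show ?thesis using t_nonneg
      by (intro suminf_ennreal_eq) (auto split: nat.splits)
  qed
  hence "ennreal (Gamma (s + 2)) * ennreal (t0 + suminf t) =
    (\<Sum>m. ennreal ((2 * pi * real (Suc m)) powr (s - 1) * pi / cos (pi * s / 2)))"
    using suminf_nn_integral_trapezoid unfolding \<tau> by simp
  also have "(\<lambda>m. (2 * pi * real (Suc m)) powr (s - 1) * pi / cos (pi * s / 2)) = (\<lambda>m. K * real (Suc m) powr (s - 1))"
    by (auto simp: K_def powr_mult)
  also have "(\<Sum>m. ennreal (K * real (Suc m) powr (s - 1))) = ennreal (K * Z)"
    using K sumZ unfolding Z_def by (intro suminf_ennreal_eq sums_mult summable_sums) auto
  finally have "ennreal (Gamma (s + 2) * (t0 + suminf t)) = ennreal (K * Z)"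
    using s by (simp add: ennreal_mult' Gamma_real_nonneg)
  moreover have "t0 \<ge> 0" unfolding t0_def using s by (intro divide_nonneg_nonneg mult_nonneg_nonneg) auto
  moreover have "suminf t \<ge> 0" "Z \<ge> 0" "Gamma (s + 2) \<ge> 0" "K \<ge> 0"
    using s K t_nonneg sum_t sumZ unfolding Z_def
    by (auto simp: suminf_nonneg)
  ultimately have eq: "Gamma (s + 2) * (t0 + suminf t) = K * Z"
    by (subst (asm) ennreal_inj) auto
  have "zeta_right (of_real s) = of_real (s * (s + 1) * (t0 + suminf t))"
  proof -
    have "1 / (s - 1) + 1 / 2 = s * (s + 1) * t0"
      using s by (simp add: t0_def divide_simps) (simp add: algebra_simps)
    hence "1 / (s - 1) + 1 / 2 + s * (s + 1) * suminf t = s * (s + 1) * (t0 + suminf t)"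
      by (simp add: algebra_simps)
    from arg_cong[OF this, of complex_of_real] show ?thesis
      unfolding zeta_right_def trapezoid_error_sum by simp
  qed
  hence "of_real (Gamma (s + 2)) * zeta_right (of_real s) = of_real (s * (s + 1) * (Gamma (s + 2) * (t0 + suminf t)))"
    by simp
  also have "\<dots> = of_real (s * (s + 1) * K) * zeta_right (1 - of_real s)"
    unfolding eq Zc by simp
  finally show ?thesis unfolding K_def .
qed

end

text \<open>Identity theorem on the strip, which \<open>s \<mapsto> 1 - s\<close> maps to itself,
  with the poles 0 and 1 removed. The real segment \<open>(-1, 0)\<close>, where
  \<open>zeta_right_reflection_real\<close> applies, accumulates at -1/2 inside this domain.\<close>

lemma zeta_right_reflection:
  assumes "-1 < Re s" "Re s < 2" "s \<noteq> 0" "s \<noteq> 1"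
  shows "zeta_right (1 - s) = 2 * (2 * of_real pi) powr (- s) * cos (of_real pi * s / 2) * Gamma s * zeta_right s"
proof -
  define S where "S = {s. -1 < Re s \<and> Re s < 2} - {0, 1}"
  define f where "f = (\<lambda>s. zeta_right (1 - s) -
     2 * (2 * of_real pi) powr (- s) * cos (of_real pi * s / 2) * Gamma s * zeta_right s)"
  have strip: "{s. -1 < Re s \<and> Re s < 2} = {s. Re s > -1} \<inter> {s. Re s < 2}" by auto
  have S_open: "open S"
    unfolding S_def strip by (intro open_Diff open_Int open_halfspace_Re_gt open_halfspace_Re_lt) auto
  have S_conn: "connected S"
    unfolding S_def strip
    by (intro connected_open_delete_finite open_Int open_halfspace_Re_gt open_halfspace_Re_lt
        convex_connected convex_Int convex_halfspace_Re_gt convex_halfspace_Re_lt) auto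
  have hol: "f holomorphic_on S"
  proof -
    have "zeta_right \<circ> (\<lambda>s. 1 - s) holomorphic_on S"
      by (intro holomorphic_on_compose_gen[OF _ zeta_right_holomorphic] holomorphic_intros) (auto simp: S_def)
    moreover have "zeta_right holomorphic_on S"
      by (rule holomorphic_on_subset[OF zeta_right_holomorphic]) (auto simp: S_def)
    moreover have "S \<inter> \<int>\<^sub>\<le>\<^sub>0 = {}"
      by (auto simp: S_def elim!: nonpos_Ints_cases')
    ultimately show ?thesis
      unfolding f_def by (auto intro!: holomorphic_intros simp: o_def)
  qed
  have zero: "f z = 0" if z: "z \<in> of_real ` {-1<..<0}" for z
  proof -
    obtain x where x: "z = of_real x" "-1 < x" "x < 0" using z by auto
    define C where "C = cos (pi * x / 2)"
    have C: "C > 0"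
      unfolding C_def using x mult_strict_left_mono[of "-1" x pi] mult_strict_left_mono[of x 0 pi]
      by (intro cos_gt_zero_pi) auto
    have "x \<notin> \<int>\<^sub>\<le>\<^sub>0" "x + 1 \<notin> \<int>\<^sub>\<le>\<^sub>0"
      using x by (auto elim!: nonpos_Ints_cases')
    hence G: "Gamma (x + 2) = x * (x + 1) * Gamma x"
      using Gamma_plus1[of "x + 1"] Gamma_plus1[of x] by (simp add: add_ac mult_ac)
    have xx: "x * (x + 1) \<noteq> 0" using x by auto
    have "of_real (x * (x + 1)) * (of_real (Gamma x) * zeta_right z) =
        of_real (x * (x + 1)) * (of_real ((2 * pi) powr (x - 1) * pi / C) * zeta_right (1 - z))"
      using zeta_right_reflection_real[of x] x unfolding G C_def by (simp add: mult_ac)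
    hence "of_real (Gamma x) * zeta_right z = of_real ((2 * pi) powr (x - 1) * pi / C) * zeta_right (1 - z)"
      by (subst (asm) mult_cancel_left) (use xx in \<open>simp del: of_real_mult of_real_add\<close>)
    hence "of_real (2 * (2 * pi) powr (-x) * C) * (of_real (Gamma x) * zeta_right z) =
       of_real (2 * (2 * pi) powr (-x) * C * ((2 * pi) powr (x - 1) * pi / C)) * zeta_right (1 - z)"
      by simp
    also have "2 * (2 * pi) powr (-x) * C * ((2 * pi) powr (x - 1) * pi / C) = 1"
      using C by (simp add: powr_diff powr_minus)
    finally have "zeta_right (1 - z) = of_real (2 * (2 * pi) powr (-x) * C) * (of_real (Gamma x) * zeta_right z)"
      by simp
    moreover have "(2 * complex_of_real pi) powr (- z) = of_real ((2 * pi) powr (-x))"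
      using powr_of_real[of "2 * pi" "-x"] x by simp
    moreover have "cos (of_real pi * z / 2) = complex_of_real C"
      unfolding C_def x cos_of_real[symmetric] by simp
    ultimately show ?thesis
      unfolding f_def by (simp add: x Gamma_complex_of_real)
  qed
  have lim: "complex_of_real (-1/2) islimpt of_real ` {-1<..<0}"
  proof -
    have "complex_of_real (-1/2) islimpt of_real ` ball (-1/2) (1/2)"
    proof (rule islimpt_isCont_image)
      show "eventually (\<lambda>y. complex_of_real y \<noteq> of_real (-1/2)) (at (-1/2))"
        unfolding of_real_eq_iff eventually_at_filter by simp
    qed (auto simp: islimpt_ball)
    moreover have "ball (-1/2) (1/2) = {-1<..<0::real}"
      by (simp add: ball_eq_greaterThanLessThan)
    ultimately show ?thesis by simp
  qed
  have "of_real ` {-1<..<0} \<subseteq> S" "of_real (-1/2) \<in> S" "s \<in> S"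
    using assms by (auto simp: S_def complex_eq_iff)
  hence "f s = 0"
    using analytic_continuation[OF hol S_open S_conn _ _ lim zero] by blast
  thus ?thesis by (simp add: f_def)
qed

section \<open>Existence and uniqueness of zeta, and its symmetries\<close>

text \<open>The witness glues \<open>zeta_right\<close> on \<open>Re s > -1\<close> to its
  reflection \<open>g\<close> on \<open>Re s < 0\<close>; the functional equation makes them agree
  on the overlap. Uniqueness is the identity theorem on the connected punctured plane.\<close>

lemma zeta_characterization:
  "zeta holomorphic_on (UNIV - {1}) \<and>
   (\<forall>s. Re s > 1 \<longrightarrow> (\<lambda>n. 1 / of_nat (Suc n) powr s) sums zeta s) \<and> zeta 1 = 0"
proof -
  define P where "P = (\<lambda>f. f holomorphic_on (UNIV - {1}) \<and>
                  (\<forall>s. Re s > 1 \<longrightarrow> (\<lambda>n. 1 / of_nat (Suc n) powr s) sums f s) \<and> f 1 = 0)"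
  define g where "g = (\<lambda>s. 2 * (2 * of_real pi) powr (- (1 - s)) * cos (of_real pi * (1 - s) / 2) * Gamma (1 - s) * zeta_right (1 - s))"
  define h where "h = (\<lambda>s. if s = 1 then 0 else if Re s > -1 then zeta_right s else g s)"
  have "h holomorphic_on ({s. Re s > -1} - {1}) \<union> {s. Re s < 0}"
  proof (rule holomorphic_on_Un)
    show "h holomorphic_on {s. Re s > -1} - {1}"
      by (rule holomorphic_transform[OF zeta_right_holomorphic]) (auto simp: h_def)
    have "zeta_right \<circ> (\<lambda>s. 1 - s) holomorphic_on {s. Re s < 0}"
      by (intro holomorphic_on_compose_gen[OF _ zeta_right_holomorphic] holomorphic_intros) auto
    moreover have "1 - s \<notin> \<int>\<^sub>\<le>\<^sub>0" if "Re s < 0" for s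
      using that by (auto elim!: nonpos_Ints_cases' simp: complex_eq_iff)
    ultimately have "g holomorphic_on {s. Re s < 0}"
      unfolding g_def by (auto intro!: holomorphic_intros simp: o_def)
    thus "h holomorphic_on {s. Re s < 0}"
    proof (rule holomorphic_transform)
      fix s assume s: "s \<in> {s. Re s < 0}"
      show "g s = h s"
        using s zeta_right_reflection[of "1 - s"] by (cases "s = 0") (auto simp: h_def g_def)
    qed
    show "open ({s. -1 < Re s} - {1})" by (intro open_Diff open_halfspace_Re_gt) auto
    show "open {s. Re s < 0}" by (rule open_halfspace_Re_lt)
  qed
  also have "({s. Re s > -1} - {1}) \<union> {s. Re s < 0} = UNIV - {1}" by auto
  finally have "P h"
    unfolding P_def using zeta_right_sums by (auto simp: h_def)
  moreover have "f = h" if f: "P f" for f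
  proof
    fix s
    show "f s = h s"
    proof (cases "s = 1")
      case True
      thus ?thesis using f \<open>P h\<close> by (simp add: P_def)
    next
      case False
      have "f s - h s = 0"
      proof (rule analytic_continuation[of "\<lambda>s. f s - h s" "UNIV - {1}" "{s. Re s > 1}" 2])
        show "(\<lambda>s. f s - h s) holomorphic_on UNIV - {1}"
          using f \<open>P h\<close> unfolding P_def by (intro holomorphic_intros) auto
        show "connected (UNIV - {1 :: complex})"
          using connected_punctured_universe[of "1 :: complex"] by (simp add: Compl_eq_Diff_UNIV)
        show "(2 :: complex) islimpt {s. Re s > 1}"
          by (rule interior_limit_point) (simp add: interior_open open_halfspace_Re_gt)
        show "f z - h z = 0" if "z \<in> {s. Re s > 1}" for z
        proof -
          have "(\<lambda>n. 1 / of_nat (Suc n) powr z) sums f z" "(\<lambda>n. 1 / of_nat (Suc n) powr z) sums h z"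
            using f \<open>P h\<close> that unfolding P_def by blast+
          thus ?thesis using sums_unique2 by auto
        qed
      qed (use False in auto)
      thus ?thesis by simp
    qed
  qed
  ultimately have "P (THE f. P f)" by (rule theI)
  thus ?thesis unfolding P_def zeta_def .
qed

lemma zeta_holomorphic: "1 \<notin> A \<Longrightarrow> zeta holomorphic_on A"
  by (rule holomorphic_on_subset[OF conjunct1[OF zeta_characterization]]) auto

lemma zeta_sums: "Re s > 1 \<Longrightarrow> (\<lambda>n. 1 / of_nat (Suc n) powr s) sums zeta s"
  using zeta_characterization by blast

lemma zeta_eq_zeta_right:
  assumes "Re s > -1" "s \<noteq> 1"
  shows "zeta s = zeta_right s"
proof -
  have "zeta s - zeta_right s = 0"
  proof (rule analytic_continuation[of "\<lambda>s. zeta s - zeta_right s" "{s. Re s > -1} - {1}" "{s. Re s > 1}" 2])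
    show "(\<lambda>s. zeta s - zeta_right s) holomorphic_on {s. Re s > -1} - {1}"
      by (intro holomorphic_intros zeta_holomorphic zeta_right_holomorphic) auto
    show "open ({s. -1 < Re s} - {1})" by (intro open_Diff open_halfspace_Re_gt) auto
    show "connected ({s. -1 < Re s} - {1})"
      by (intro connected_open_delete convex_connected convex_halfspace_Re_gt open_halfspace_Re_gt) auto
    show "(2 :: complex) islimpt {s. Re s > 1}"
      by (rule interior_limit_point) (simp add: interior_open open_halfspace_Re_gt)
    show "zeta z - zeta_right z = 0" if "z \<in> {s. Re s > 1}" for z
      using zeta_sums[of z] zeta_right_sums[of z] that by (auto dest: sums_unique2)
  qed (use assms in auto)
  thus ?thesis by simp
qed

lemma zeta_reflection:
  assumes "0 < Re s" "Re s < 1"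
  shows "zeta (1 - s) = 2 * (2 * of_real pi) powr (- s) * cos (of_real pi * s / 2) * Gamma s * zeta s"
proof -
  have "s \<noteq> 0" "s \<noteq> 1" using assms by auto
  thus ?thesis
    using zeta_right_reflection[of s] zeta_eq_zeta_right[of s] zeta_eq_zeta_right[of "1 - s"] assms by auto
qed

text \<open>The Dirichlet series has real coefficients, so both sides agree for
  \<open>Re s > 1\<close> and hence everywhere off 1; at 1 the value set by convention is
  real.\<close>

lemma zeta_cnj: "zeta (cnj s) = cnj (zeta s)"
proof (cases "s = 1")
  case True
  thus ?thesis using zeta_characterization by simp
next
  case False
  have "zeta s - cnj (zeta (cnj s)) = 0"
  proof (rule analytic_continuation[of "\<lambda>s. zeta s - cnj (zeta (cnj s))" "UNIV - {1}" "{s. Re s > 1}" 2])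
    have "(cnj \<circ> zeta \<circ> cnj) holomorphic_on UNIV - {1}"
      by (intro holomorphic_on_compose_cnj_cnj zeta_holomorphic) (auto simp: complex_eq_iff image_iff)
    thus "(\<lambda>s. zeta s - cnj (zeta (cnj s))) holomorphic_on UNIV - {1}"
      by (intro holomorphic_intros zeta_holomorphic) (auto simp: o_def)
    show "connected (UNIV - {1 :: complex})"
      using connected_punctured_universe[of "1 :: complex"] by (simp add: Compl_eq_Diff_UNIV)
    show "(2 :: complex) islimpt {s. Re s > 1}"
      by (rule interior_limit_point) (simp add: interior_open open_halfspace_Re_gt)
    fix z assume z: "z \<in> {s. Re s > 1}"
    have "(\<lambda>n. cnj (1 / of_nat (Suc n) powr cnj z)) sums cnj (zeta (cnj z))"
      using zeta_sums[of "cnj z"] z by (subst sums_cnj) auto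
    also have "(\<lambda>n. cnj (1 / of_nat (Suc n) powr cnj z)) = (\<lambda>n. 1 / of_nat (Suc n) powr z)"
      by (simp add: cnj_powr del: of_nat_Suc)
    finally show "zeta z - cnj (zeta (cnj z)) = 0"
      using zeta_sums[of z] z by (auto dest: sums_unique2)
  qed (use False in auto)
  thus ?thesis by (metis complex_cnj_cnj eq_iff_diff_eq_0)
qed

section \<open>Growth of zeta and Gamma on vertical lines\<close>

lemma power_le_fact_exp:
  fixes x :: real
  assumes "x \<ge> 0"
  shows "x ^ k \<le> fact k * exp x"
proof -
  have "(\<Sum>n\<in>{k}. x ^ n /\<^sub>R fact n) \<le> (\<Sum>n. x ^ n /\<^sub>R fact n)"
    using assms by (intro sum_le_suminf summable_exp_generic) auto
  thus ?thesis by (simp add: exp_def field_simps scaleR_conv_of_real)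
qed

lemma
  fixes e :: real
  assumes e: "e > 0"
  shows integrable_exp_abs: "integrable lborel (\<lambda>t. exp (- e * \<bar>t\<bar>))"
    and integral_exp_abs_le: "(\<integral>t. exp (- e * \<bar>t\<bar>) \<partial>lborel) \<le> 2 / e"
proof -
  define f where "f = (\<lambda>t::real. ennreal (exp (- e * t)) * indicator {0..} t)"
  have [measurable]: "f \<in> borel_measurable borel" unfolding f_def by measurable
  have 1: "(\<integral>\<^sup>+t. f t \<partial>lborel) = ennreal (1 / e)"
    unfolding f_def
    using nn_integral_has_integral_lebesgue'[OF _ has_integral_exp_minus_to_infinity[OF e, of 0]] by simp
  have 2: "(\<integral>\<^sup>+t. f (- t) \<partial>lborel) = ennreal (1 / e)"
    using nn_integral_real_affine[of f "-1" 0] 1 by simp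
  have "(\<integral>\<^sup>+t. ennreal (exp (- e * \<bar>t\<bar>)) \<partial>lborel) \<le> (\<integral>\<^sup>+t. f t + f (- t) \<partial>lborel)"
    by (intro nn_integral_mono) (auto simp: f_def indicator_def)
  also have "\<dots> = ennreal (1 / e) + ennreal (1 / e)"
    using 1 2 by (subst nn_integral_add) auto
  also have "\<dots> = ennreal (2 / e)" using e by (simp flip: ennreal_plus)
  finally have *: "(\<integral>\<^sup>+t. ennreal (exp (- e * \<bar>t\<bar>)) \<partial>lborel) \<le> ennreal (2 / e)" .
  show int: "integrable lborel (\<lambda>t. exp (- e * \<bar>t\<bar>))"
    using * by (intro integrableI_nonneg) (auto simp: less_top[symmetric] top_unique)
  have "ennreal (\<integral>t. exp (- e * \<bar>t\<bar>) \<partial>lborel) \<le> ennreal (2 / e)"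
    using * nn_integral_eq_integral[OF int] by simp
  thus "(\<integral>t. exp (- e * \<bar>t\<bar>) \<partial>lborel) \<le> 2 / e"
    using e by (subst (asm) ennreal_le_iff) auto
qed

text \<open>Half of the decay rate absorbs the polynomial, at the price of a factor
  \<open>1 / e ^ k\<close>. The dependence on \<open>e\<close> is kept explicit because the rate
  tends to 0 near the boundary of the right half-plane.\<close>

lemma power_exp_abs_bound:
  fixes e t :: real
  assumes e: "0 < e" "e \<le> 2"
  shows "(1 + \<bar>t\<bar>) ^ k * exp (- e * \<bar>t\<bar>) \<le> fact k * 2 ^ k * exp 1 / e ^ k * exp (- (e / 2) * \<bar>t\<bar>)"
proof -
  have "(e * (1 + \<bar>t\<bar>) / 2) ^ k \<le> fact k * exp (e * (1 + \<bar>t\<bar>) / 2)"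
    using e by (intro power_le_fact_exp) auto
  also have "\<dots> \<le> fact k * (exp 1 * exp (e / 2 * \<bar>t\<bar>))"
    unfolding exp_add[symmetric] using e by (simp add: algebra_simps)
  finally have "(1 + \<bar>t\<bar>) ^ k \<le> fact k * 2 ^ k * exp 1 / e ^ k * exp (e / 2 * \<bar>t\<bar>)"
    using e unfolding power_mult_distrib power_divide by (simp add: divide_simps mult_ac)
  hence "(1 + \<bar>t\<bar>) ^ k * exp (- e * \<bar>t\<bar>) \<le> fact k * 2 ^ k * exp 1 / e ^ k * exp (e / 2 * \<bar>t\<bar>) * exp (- e * \<bar>t\<bar>)"
    by (rule mult_right_mono) simp
  also have "\<dots> = fact k * 2 ^ k * exp 1 / e ^ k * exp (- (e / 2) * \<bar>t\<bar>)"
    by (simp add: mult.assoc flip: exp_add)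
  finally show ?thesis .
qed

lemma integrable_power_exp_abs:
  fixes e :: real
  assumes e: "e > 0"
  shows "integrable lborel (\<lambda>t. (1 + \<bar>t\<bar>) ^ k * exp (- e * \<bar>t\<bar>))"
proof -
  define e' where "e' = min e 2"
  have e': "e' > 0" "e' \<le> 2" "e' \<le> e" using e by (auto simp: e'_def)
  show ?thesis
  proof (rule Bochner_Integration.integrable_bound)
    show "integrable lborel (\<lambda>t. fact k * 2 ^ k * exp 1 / e' ^ k * exp (- (e' / 2) * \<bar>t\<bar>))"
      using e' by (intro integrable_mult_right integrable_exp_abs) auto
    show "AE t in lborel. norm ((1 + \<bar>t\<bar>) ^ k * exp (- e * \<bar>t\<bar>)) \<le>
       norm (fact k * 2 ^ k * exp 1 / e' ^ k * exp (- (e' / 2) * \<bar>t\<bar>))"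
    proof (rule AE_I2)
      fix t :: real
      have "(1 + \<bar>t\<bar>) ^ k * exp (- e * \<bar>t\<bar>) \<le> (1 + \<bar>t\<bar>) ^ k * exp (- e' * \<bar>t\<bar>)"
        using e' by (intro mult_left_mono) (auto intro: mult_right_mono)
      also note power_exp_abs_bound[OF e'(1,2), of t k]
      finally show "norm ((1 + \<bar>t\<bar>) ^ k * exp (- e * \<bar>t\<bar>)) \<le>
       norm (fact k * 2 ^ k * exp 1 / e' ^ k * exp (- (e' / 2) * \<bar>t\<bar>))"
        using e' by (simp add: abs_mult)
    qed
  qed measurable
qed

lemma integral_power_exp_abs_le:
  fixes e :: real
  assumes e: "0 < e" "e \<le> 2"
  shows "(\<integral>t. (1 + \<bar>t\<bar>) ^ k * exp (- e * \<bar>t\<bar>) \<partial>lborel) \<le> 4 * fact k * 2 ^ k * exp 1 / e ^ Suc k"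
proof -
  have "(\<integral>t. (1 + \<bar>t\<bar>) ^ k * exp (- e * \<bar>t\<bar>) \<partial>lborel) \<le>
     (\<integral>t. fact k * 2 ^ k * exp 1 / e ^ k * exp (- (e / 2) * \<bar>t\<bar>) \<partial>lborel)"
    using e power_exp_abs_bound[OF e]
    by (intro integral_mono integrable_mult_right integrable_power_exp_abs integrable_exp_abs) auto
  also have "\<dots> = fact k * 2 ^ k * exp 1 / e ^ k * (\<integral>t. exp (- (e / 2) * \<bar>t\<bar>) \<partial>lborel)"
    by (rule integral_mult_right_zero)
  also have "\<dots> \<le> fact k * 2 ^ k * exp 1 / e ^ k * (2 / (e / 2))"
    using integral_exp_abs_le[of "e / 2"] e by (intro mult_left_mono) auto
  finally show ?thesis by (simp add: mult_ac)
qed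

text \<open>A bound away from the real axis suffices, since that is all that is available in strips
  containing a pole; continuity takes care of the compact rest.\<close>

lemma integrable_continuous_power_exp_bound:
  fixes g :: "real \<Rightarrow> complex"
  assumes g: "continuous_on UNIV g" and e: "e > 0"
    and bound: "\<And>t. \<bar>t\<bar> \<ge> 1 \<Longrightarrow> norm (g t) \<le> B * (1 + \<bar>t\<bar>) ^ k * exp (- e * \<bar>t\<bar>)"
  shows "integrable lborel g"
proof -
  have "compact (g ` {-1..1})"
    by (intro compact_continuous_image continuous_on_subset[OF g]) auto
  from compact_imp_bounded[OF this] obtain M where M': "\<forall>z\<in>g ` {-1..1}. norm z \<le> M"
    unfolding bounded_iff by blast
  have M: "norm (g t) \<le> M" if "\<bar>t\<bar> \<le> 1" for t
    using M' that by (auto simp: abs_le_iff)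
  define C where "C = max B (max 0 M * exp e)"
  have "norm (g t) \<le> C * ((1 + \<bar>t\<bar>) ^ k * exp (- e * \<bar>t\<bar>))" for t
  proof (cases "\<bar>t\<bar> \<ge> 1")
    case True
    have "norm (g t) \<le> B * ((1 + \<bar>t\<bar>) ^ k * exp (- e * \<bar>t\<bar>))"
      using bound[OF True] by (simp add: mult.assoc)
    also have "\<dots> \<le> C * ((1 + \<bar>t\<bar>) ^ k * exp (- e * \<bar>t\<bar>))"
      by (intro mult_right_mono) (auto simp: C_def)
    finally show ?thesis .
  next
    case False
    have "norm (g t) \<le> max 0 M * (exp e * (1 * exp (- e)))"
    proof -
      have "norm (g t) \<le> max 0 M" using M[of t] False by simp
      moreover have "exp e * (1 * exp (- e)) = 1" by (simp flip: exp_add)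
      ultimately show ?thesis by simp
    qed
    also have "\<dots> \<le> max 0 M * (exp e * ((1 + \<bar>t\<bar>) ^ k * exp (- e * \<bar>t\<bar>)))"
      using False e mult_left_mono[of "\<bar>t\<bar>" 1 e]
      by (intro mult_left_mono mult_mono one_le_power) auto
    also have "\<dots> \<le> C * ((1 + \<bar>t\<bar>) ^ k * exp (- e * \<bar>t\<bar>))"
      unfolding mult.assoc[symmetric] by (intro mult_right_mono) (auto simp: C_def)
    finally show ?thesis .
  qed
  hence *: "norm (g t) \<le> norm (C * ((1 + \<bar>t\<bar>) ^ k * exp (- e * \<bar>t\<bar>)))" for t
    by (metis abs_ge_self dual_order.trans real_norm_def)
  show ?thesis
  proof (rule Bochner_Integration.integrable_bound)
    show "integrable lborel (\<lambda>t. C * ((1 + \<bar>t\<bar>) ^ k * exp (- e * \<bar>t\<bar>)))"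
      by (intro integrable_mult_right integrable_power_exp_abs e)
    show "g \<in> borel_measurable lborel"
      using borel_measurable_continuous_onI[OF g] by simp
  qed (use * in auto)
qed

section \<open>Zeta and Gamma in vertical strips\<close>

text \<open>The degree 2 comes from the factor \<open>s * (s + 1)\<close> in
  \<open>zeta_right\<close>, whose series is uniformly bounded for \<open>Re s \<ge> 1/2\<close>;
  the distance 1/2 from the pole controls \<open>1 / (s - 1)\<close>.\<close>

lemma zeta_polynomial_bound:
  obtains C where "C > 0"
    "\<And>s. 1/2 \<le> Re s \<Longrightarrow> Re s \<le> 3/2 \<Longrightarrow> norm (s - 1) \<ge> 1/2 \<Longrightarrow> norm (zeta s) \<le> C * (1 + \<bar>Im s\<bar>) ^ 2"
proof -
  define M where "M = (\<Sum>n. real (Suc n) powr (-5/2))"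
  have sum: "summable (\<lambda>n. real (Suc n) powr (-5/2))"
    using summable_real_powr_iff[of "-5/2"] by (subst summable_Suc_iff) auto
  have M: "M \<ge> 0" unfolding M_def by (intro suminf_nonneg sum) auto
  have "norm (zeta s) \<le> (5/2 + M * (5/2)\<^sup>2) * (1 + \<bar>Im s\<bar>) ^ 2"
    if s: "1/2 \<le> Re s" "Re s \<le> 3/2" "norm (s - 1) \<ge> 1/2" for s
  proof -
    have tr: "norm (trapezoid_error n s) \<le> real (Suc n) powr (-5/2)" for n
    proof -
      have "norm (trapezoid_error n s) \<le> real (Suc n) powr (- Re s - 2)"
        using s by (intro norm_trapezoid_error_le) auto
      also have "\<dots> \<le> real (Suc n) powr (-5/2)"
        using s by (intro powr_mono) auto
      finally show ?thesis .
    qed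
    have "norm (trapezoid_error_sum s) \<le> M"
      unfolding trapezoid_error_sum_def M_def
      by (rule order.trans[OF summable_norm[OF summable_norm_trapezoid_error] suminf_le[OF tr summable_norm_trapezoid_error sum]])
         (use s in auto)
    moreover have "norm s \<le> 5/2 * (1 + \<bar>Im s\<bar>)" "norm (s + 1) \<le> 5/2 * (1 + \<bar>Im s\<bar>)"
      using cmod_le[of s] cmod_le[of "s + 1"] s by auto
    ultimately have "norm (s * (s + 1) * trapezoid_error_sum s) \<le> (5/2 * (1 + \<bar>Im s\<bar>)) * (5/2 * (1 + \<bar>Im s\<bar>)) * M"
      unfolding norm_mult by (intro mult_mono mult_nonneg_nonneg) auto
    moreover have "norm (1 / (s - 1)) \<le> 2"

    proof -
      have "1 / norm (s - 1) \<le> 1 / (1 / 2)" using s by (intro divide_left_mono) auto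
      thus ?thesis by (simp add: norm_divide)
    qed
    moreover have "zeta s = 1 / (s - 1) + 1 / 2 + s * (s + 1) * trapezoid_error_sum s"
    proof -
      have "s \<noteq> 1" using s(3) by auto
      thus ?thesis using s zeta_eq_zeta_right[of s] by (simp add: zeta_right_def)
    qed
    ultimately have "norm (zeta s) \<le> 2 + 1 / 2 + (5/2 * (1 + \<bar>Im s\<bar>)) * (5/2 * (1 + \<bar>Im s\<bar>)) * M"
      by (auto intro!: norm_triangle_le add_mono)
    also have "\<dots> \<le> 5/2 * (1 + \<bar>Im s\<bar>) ^ 2 + (5/2 * (1 + \<bar>Im s\<bar>)) * (5/2 * (1 + \<bar>Im s\<bar>)) * M"
      by (simp add: one_le_power)
    also have "\<dots> = (5/2 + M * (5/2)\<^sup>2) * (1 + \<bar>Im s\<bar>) ^ 2"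
      by (simp add: algebra_simps power2_eq_square)
    finally show ?thesis .
  qed
  moreover have "5/2 + M * (5/2)\<^sup>2 > 0" using M by (intro add_pos_nonneg) auto
  ultimately show ?thesis using that by blast
qed

text \<open>On this line \<open>1 - s\<close> is the conjugate of \<open>s\<close>, so the
  reflection formula yields the exact value \<open>pi / cosh (pi * t)\<close> of the squared
  modulus.\<close>

lemma norm_Gamma_half_line: "norm (Gamma (Complex (1/2) t)) \<le> 3 * exp (- (pi / 2) * \<bar>t\<bar>)"
proof -
  define s where "s = Complex (1/2) t"
  have s1: "1 - s = cnj s" by (simp add: s_def complex_eq_iff)
  have "sin (of_real pi * s) = cos (of_real pi * s - of_real (pi/2))"
    by (simp add: cos_diff cos_of_real sin_of_real)
  also have "of_real pi * s - of_real (pi/2) = \<i> * of_real (pi * t)"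
    by (simp add: s_def complex_eq_iff)
  also have "cos (\<i> * of_real (pi * t)) = of_real (cosh (pi * t))"
  proof -
    have "\<i> * (\<i> * complex_of_real (pi * t)) = of_real (- (pi * t))"
      by (simp only: mult.assoc[symmetric] i_squared) simp
    thus ?thesis
      by (simp only: cos_exp_eq cosh_def of_real_minus[symmetric] exp_of_real minus_minus)
         (simp add: scaleR_conv_of_real add.commute)
  qed
  finally have "Gamma s * cnj (Gamma s) = of_real (pi / cosh (pi * t))"
    using Gamma_reflection_complex[of s] by (simp add: s1 cnj_Gamma)
  hence "of_real ((norm (Gamma s))\<^sup>2) = complex_of_real (pi / cosh (pi * t))"
    using complex_norm_square[of "Gamma s"] by simp
  hence eq: "(norm (Gamma s))\<^sup>2 = pi / cosh (pi * t)" unfolding of_real_eq_iff .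
  have "cosh (pi * t) \<ge> exp (pi * \<bar>t\<bar>) / 2"
    by (cases "t \<ge> 0") (auto simp: cosh_def field_simps)
  hence "pi / cosh (pi * t) \<le> pi / (exp (pi * \<bar>t\<bar>) / 2)"
    by (intro divide_left_mono) auto
  also have "\<dots> = 2 * pi * exp (- (pi * \<bar>t\<bar>))" by (simp add: exp_minus field_simps)
  also have "\<dots> \<le> 3\<^sup>2 * exp (- (pi * \<bar>t\<bar>))"
    using pi_less_4 by (intro mult_right_mono) auto
  also have "exp (- (pi * \<bar>t\<bar>)) = (exp (- (pi / 2) * \<bar>t\<bar>))\<^sup>2"
    by (simp add: power2_eq_square flip: exp_add)
  finally have "(norm (Gamma s))\<^sup>2 \<le> (3 * exp (- (pi / 2) * \<bar>t\<bar>))\<^sup>2"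
    by (simp add: eq power_mult_distrib)
  thus ?thesis unfolding s_def by (rule power2_le_imp_le) simp
qed

text \<open>Each factor \<open>(\<sigma> + k) / norm (\<sigma> + k + \<i> t)\<close> of Euler's limit increases with \<open>\<sigma>\<close>.\<close>

lemma norm_Gamma_over_Gamma_mono:
  assumes a: "0 < a" "a \<le> b"
  shows "norm (Gamma (Complex a t)) * Gamma b \<le> norm (Gamma (Complex b t)) * Gamma a"
proof -
  have fac: "(a + real k) * norm (Complex (b + real k) t) \<le> (b + real k) * norm (Complex (a + real k) t)" for k
  proof (rule power2_le_imp_le)
    have 1: "a + real k \<le> b + real k" "0 < a + real k" using a by auto
    hence "(a + real k)\<^sup>2 * t\<^sup>2 \<le> (b + real k)\<^sup>2 * t\<^sup>2"
      by (intro mult_right_mono power_mono) auto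
    thus "((a + real k) * norm (Complex (b + real k) t))\<^sup>2 \<le> ((b + real k) * norm (Complex (a + real k) t))\<^sup>2"
      unfolding power_mult_distrib cmod_power2 by (simp add: distrib_left mult.commute)
  qed (use a in auto)
  have ser: "norm (Gamma_series (Complex x t) n) = fact n * n powr x / (\<Prod>k\<le>n. norm (Complex (x + real k) t))"
    if "n > 0" for x n
  proof -
    have "norm (exp (Complex x t * of_real (ln (of_nat n)))) = n powr x"
      using that by (simp add: powr_def mult.commute)
    moreover have "norm (pochhammer (Complex x t) (n + 1)) = (\<Prod>k\<le>n. norm (Complex (x + real k) t))"
      by (simp add: pochhammer_prod prod_norm[symmetric] atLeast0LessThan lessThan_Suc_atMost Complex_eq add_ac)
    ultimately show ?thesis
      by (simp add: Gamma_series_def norm_mult norm_divide)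
  qed
  have serr: "Gamma_series x n = fact n * n powr x / (\<Prod>k\<le>n. x + real k)" if "n > 0" for x :: real and n
    using that by (simp add: Gamma_series_def pochhammer_prod atLeast0LessThan lessThan_Suc_atMost powr_def mult.commute)
  have "eventually (\<lambda>n. norm (Gamma_series (Complex a t) n) * Gamma_series b n \<le>
      norm (Gamma_series (Complex b t) n) * Gamma_series a n) sequentially"
    using eventually_gt_at_top[of 0]
  proof eventually_elim
    case (elim n)
    define P where "P = (\<lambda>x. \<Prod>k\<le>n. norm (Complex (x + real k) t))"
    define Q where "Q = (\<lambda>x. \<Prod>k\<le>n. x + real k)"
    have "Complex (x + real k) t \<noteq> 0" if "x > 0" for x k
      using that by (auto simp: complex_eq_iff)
    hence pos: "P a > 0" "P b > 0" "Q a > 0" "Q b > 0"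
      using a unfolding P_def Q_def by (auto intro!: prod_pos)
    have "Q a * P b \<le> Q b * P a"
      unfolding P_def Q_def prod.distrib[symmetric] using fac a by (intro prod_mono) auto
    hence "1 / (P a * Q b) \<le> 1 / (P b * Q a)"
      using pos by (intro divide_left_mono) (auto simp: mult_ac)
    hence "fact n * n powr a * (fact n * n powr b) * (1 / (P a * Q b)) \<le> fact n * n powr a * (fact n * n powr b) * (1 / (P b * Q a))"
      by (intro mult_left_mono) auto
    moreover have "norm (Gamma_series (Complex x t) n) = fact n * n powr x / P x"
      "Gamma_series x n = fact n * n powr x / Q x" for x
      by (simp_all add: ser[OF elim] serr[OF elim] P_def Q_def)
    ultimately show ?case by (simp add: mult_ac)
  qed
  thus ?thesis
    by (intro tendsto_le[OF sequentially_bot _ _]) (auto intro!: tendsto_intros Gamma_series_LIMSEQ)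
qed

lemma norm_Gamma_strip_bound:
  obtains C where "C > 0"
    "\<And>s. 1/2 \<le> Re s \<Longrightarrow> Re s \<le> 3/2 \<Longrightarrow> norm (Gamma s) \<le> C * (1 + \<bar>Im s\<bar>) * exp (- (pi / 2) * \<bar>Im s\<bar>)"
proof -
  have "compact (Gamma ` {1/2..3/2::real})"
    by (intro compact_continuous_image continuous_on_Gamma) (auto elim!: nonpos_Ints_cases')
  from compact_imp_bounded[OF this] obtain M where M': "\<forall>z\<in>Gamma ` {1/2..3/2::real}. norm z \<le> M"
    unfolding bounded_iff by blast
  have M: "Gamma x \<le> M" if "1/2 \<le> x" "x \<le> 3/2" for x
    using bspec[OF M', of "Gamma x"] that by auto
  define G where "G = Gamma (3/2 :: real)"
  have G: "G > 0" unfolding G_def by simp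
  have "M \<ge> 0" using M[of 1] by simp
  have "norm (Gamma s) \<le> (M * 3 / G + 1) * (1 + \<bar>Im s\<bar>) * exp (- (pi / 2) * \<bar>Im s\<bar>)"
    if s: "1/2 \<le> Re s" "Re s \<le> 3/2" for s
  proof -
    define t where "t = Im s"
    have "Gamma (Complex (3/2) t) = Complex (1/2) t * Gamma (Complex (1/2) t)"
    proof -
      have "Complex (1/2) t \<notin> \<int>\<^sub>\<le>\<^sub>0" by (auto elim!: nonpos_Ints_cases' simp: complex_eq_iff)
      moreover have "Complex (1/2) t + 1 = Complex (3/2) t" by (simp add: complex_eq_iff)
      ultimately show ?thesis using Gamma_plus1 by metis
    qed
    hence "norm (Gamma (Complex (3/2) t)) \<le> (1 + \<bar>t\<bar>) * (3 * exp (- (pi / 2) * \<bar>t\<bar>))"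
    proof (rule ssubst)
      have "norm (Complex (1/2) t) \<le> 1 + \<bar>t\<bar>" using cmod_le[of "Complex (1/2) t"] by simp
      hence "norm (Complex (1/2) t) * norm (Gamma (Complex (1/2) t)) \<le> (1 + \<bar>t\<bar>) * (3 * exp (- (pi / 2) * \<bar>t\<bar>))"
        by (intro mult_mono norm_Gamma_half_line) auto
      thus "norm (Complex (1/2) t * Gamma (Complex (1/2) t)) \<le> (1 + \<bar>t\<bar>) * (3 * exp (- (pi / 2) * \<bar>t\<bar>))"
        by (simp only: norm_mult)
    qed
    moreover have "norm (Gamma s) * G \<le> norm (Gamma (Complex (3/2) t)) * Gamma (Re s)"
      using norm_Gamma_over_Gamma_mono[of "Re s" "3/2" t] s by (simp add: t_def G_def)
    moreover have "norm (Gamma (Complex (3/2) t)) * Gamma (Re s) \<le> norm (Gamma (Complex (3/2) t)) * M"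
      using M s by (intro mult_left_mono) auto
    ultimately have "norm (Gamma s) * G \<le> (1 + \<bar>t\<bar>) * (3 * exp (- (pi / 2) * \<bar>t\<bar>)) * M"
      using \<open>M \<ge> 0\<close> by (meson mult_right_mono order.trans)
    hence "norm (Gamma s) \<le> M * 3 / G * ((1 + \<bar>t\<bar>) * exp (- (pi / 2) * \<bar>t\<bar>))"
      using G by (simp add: field_simps)
    also have "\<dots> \<le> (M * 3 / G + 1) * ((1 + \<bar>t\<bar>) * exp (- (pi / 2) * \<bar>t\<bar>))"
      by (intro mult_right_mono) auto
    finally show ?thesis by (simp add: t_def mult.assoc)
  qed
  moreover have "M * 3 / G + 1 > 0" using \<open>M \<ge> 0\<close> G by (intro add_nonneg_pos) auto
  ultimately show ?thesis using that by blast
qed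

section \<open>Shifting a vertical line of integration across one pole\<close>

lemma power_exp_abs_tendsto_0:
  fixes e :: real
  assumes e: "e > 0"
  shows "(\<lambda>n. (1 + real n) ^ k * exp (- e * real n)) \<longlonglongrightarrow> 0"
proof -
  define e' where "e' = min e 2"
  have e': "e' > 0" "e' \<le> 2" "e' \<le> e" using e by (auto simp: e'_def)
  have "e' / 2 > 0" using e' by simp
  hence "(\<lambda>n. exp (- (e' / 2) * real n)) \<longlonglongrightarrow> 0" by real_asymp
  hence *: "(\<lambda>n. fact k * 2 ^ k * exp 1 / e' ^ k * exp (- (e' / 2) * real n)) \<longlonglongrightarrow> 0"
    by (rule tendsto_mult_right_zero)
  show ?thesis
  proof (rule tendsto_sandwich[OF _ _ tendsto_const *])
    show "eventually (\<lambda>n. (1 + real n) ^ k * exp (- e * real n) \<le>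
        fact k * 2 ^ k * exp 1 / e' ^ k * exp (- (e' / 2) * real n)) sequentially"
    proof (intro always_eventually allI)
      fix n
      have "(1 + real n) ^ k * exp (- e * real n) \<le> (1 + real n) ^ k * exp (- e' * real n)"
        using e' by (intro mult_left_mono) (auto intro: mult_right_mono)
      also have "\<dots> \<le> fact k * 2 ^ k * exp 1 / e' ^ k * exp (- (e' / 2) * real n)"
        using power_exp_abs_bound[OF e'(1,2), of "real n" k] by simp
      finally show "(1 + real n) ^ k * exp (- e * real n) \<le> \<dots>" .
    qed
  qed auto
qed

lemma tendsto_integral_symmetric_interval:
  fixes g :: "real \<Rightarrow> complex"
  assumes g: "integrable lborel g"
  shows "(\<lambda>n. integral {- real n..real n} g) \<longlonglongrightarrow> integral\<^sup>L lborel g"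
proof -
  have "(\<lambda>n. \<integral>t. indicator {- real n..real n} t *\<^sub>R g t \<partial>lborel) \<longlonglongrightarrow> integral\<^sup>L lborel g"
  proof (rule integral_dominated_convergence)
    show "integrable lborel (\<lambda>t. norm (g t))" using g by simp
    show "AE t in lborel. (\<lambda>n. indicator {- real n..real n} t *\<^sub>R g t) \<longlonglongrightarrow> g t"
    proof (rule AE_I2)
      fix t :: real
      have "eventually (\<lambda>n. indicator {- real n..real n} t *\<^sub>R g t = g t) sequentially"
        using eventually_ge_at_top[of "nat \<lceil>\<bar>t\<bar>\<rceil>"]
        by eventually_elim (auto simp: indicator_def abs_le_iff nat_le_iff ceiling_le_iff)
      thus "(\<lambda>n. indicator {- real n..real n} t *\<^sub>R g t) \<longlonglongrightarrow> g t"
        by (rule tendsto_eventually)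
    qed
  qed (use g in \<open>auto simp: indicator_def\<close>)
  moreover have "(\<integral>t. indicator {- real n..real n} t *\<^sub>R g t \<partial>lborel) = integral {- real n..real n} g" for n
  proof -
    have "set_integrable lborel {- real n..real n} g"
      unfolding set_integrable_def using g by (intro integrable_mult_indicator) auto
    from set_borel_integral_eq_integral(2)[OF this] show ?thesis
      by (simp add: set_lebesgue_integral_def)
  qed
  ultimately show ?thesis by simp
qed

context
  fixes f :: "complex \<Rightarrow> complex" and a b a' b' p e B :: real and k :: nat
  assumes order: "a' < a" "a < p" "p < b" "b < b'" and e: "e > 0"
    and hol: "f holomorphic_on {s. a' < Re s \<and> Re s < b'} - {of_real p}"
    and bound: "\<And>s. a \<le> Re s \<Longrightarrow> Re s \<le> b \<Longrightarrow> \<bar>Im s\<bar> \<ge> 1 \<Longrightarrow>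
                  norm (f s) \<le> B * (1 + \<bar>Im s\<bar>) ^ k * exp (- e * \<bar>Im s\<bar>)"
begin

lemma integrable_vertical_line:
  assumes c: "c = a \<or> c = b"
  shows "integrable lborel (\<lambda>t. f (Complex c t))"
proof (rule integrable_continuous_power_exp_bound[OF _ e])
  have "continuous_on (range (Complex c)) f"
    by (rule continuous_on_subset[OF holomorphic_on_imp_continuous_on[OF hol]])
       (use c order in \<open>auto simp: complex_eq_iff\<close>)
  hence "continuous_on UNIV (f \<circ> Complex c)"
    by (rule continuous_on_compose[rotated]) (auto simp: Complex_eq intro!: continuous_intros)
  thus "continuous_on UNIV (\<lambda>t. f (Complex c t))" by (simp add: o_def)
  show "norm (f (Complex c t)) \<le> B * (1 + \<bar>t\<bar>) ^ k * exp (- e * \<bar>t\<bar>)" if "\<bar>t\<bar> \<ge> 1" for t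
    using bound[of "Complex c t"] c that order by auto
qed

lemma integral_vertical_line_shift:
  "(\<integral>t. f (Complex b t) \<partial>lborel) - (\<integral>t. f (Complex a t) \<partial>lborel) = 2 * of_real pi * residue f (of_real p)"
proof -
  define S where "S = {s. a' < Re s \<and> Re s < b'}"
  have strip: "S = {s. Re s > a'} \<inter> {s. Re s < b'}" by (auto simp: S_def)
  have S: "open S" "connected S"
    unfolding strip by (auto intro!: convex_connected convex_Int convex_halfspace_Re_gt convex_halfspace_Re_lt
        open_Int open_halfspace_Re_gt open_halfspace_Re_lt)
  have cont: "continuous_on (S - {of_real p}) f"
    using hol unfolding S_def by (rule holomorphic_on_imp_continuous_on)
  \<comment> \<open>\<open>D n\<close> is \<open>\<i>\<close> times the defect of the claim on the
    segment of height \<open>n\<close>. By the residue theorem on a rectangle it is minus the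
    contribution of the horizontal sides, which the assumed decay sends to 0.\<close>
  define D where "D = (\<lambda>n. \<i> * integral {- real n..real n} (\<lambda>t. f (Complex b t)) -
     \<i> * integral {- real n..real n} (\<lambda>t. f (Complex a t)) - 2 * pi * \<i> * residue f (of_real p))"
  have bound_D: "norm (D n) \<le> 2 * (B * (1 + real n) ^ k * exp (- e * real n)) * (b - a)"
    if n: "n \<ge> 1" for n
  proof -
    define R where "R = real n"
    have R: "R \<ge> 1" using n by (simp add: R_def)
    define a1 a2 a3 a4 where "a1 = Complex a (-R)" and "a2 = Complex b (-R)" and "a3 = Complex b R" and "a4 = Complex a R"
    define \<gamma> where "\<gamma> = rectpath a1 a3"
    have \<gamma>: "\<gamma> = linepath a1 a2 +++ linepath a2 a3 +++ linepath a3 a4 +++ linepath a4 a1"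
      by (simp add: \<gamma>_def rectpath_def Let_def a1_def a2_def a3_def a4_def)
    have seg: "closed_segment a1 a2 = {s. Im s = -R \<and> Re s \<in> {a..b}}"
      "closed_segment a3 a4 = {s. Im s = R \<and> Re s \<in> {a..b}}"
      "closed_segment a2 a3 = {s. Re s = b \<and> Im s \<in> {-R..R}}"
      "closed_segment a4 a1 = {s. Re s = a \<and> Im s \<in> {-R..R}}"
      using order R unfolding a1_def a2_def a3_def a4_def
      by (simp_all add: closed_segment_same_Im closed_segment_same_Re closed_segment_eq_real_ivl conj_commute)
    have sub: "closed_segment a1 a2 \<subseteq> S - {of_real p}" "closed_segment a2 a3 \<subseteq> S - {of_real p}"
      "closed_segment a3 a4 \<subseteq> S - {of_real p}" "closed_segment a4 a1 \<subseteq> S - {of_real p}"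
      unfolding seg S_def using order R by auto
    have ci: "f contour_integrable_on linepath a1 a2" "f contour_integrable_on linepath a2 a3"
      "f contour_integrable_on linepath a3 a4" "f contour_integrable_on linepath a4 a1"
      using sub by (auto intro!: contour_integrable_continuous_linepath continuous_on_subset[OF cont])
    have img: "path_image \<gamma> \<subseteq> S - {of_real p}"
      unfolding \<gamma> using sub by (simp add: path_image_join)
    have "contour_integral \<gamma> f = 2 * pi * \<i> * (\<Sum>q\<in>{of_real p}. winding_number \<gamma> q * residue f q)"
    proof (rule Residue_theorem[OF S])
      show "f holomorphic_on S - {of_real p}" using hol by (simp add: S_def)
      show "valid_path \<gamma>" "pathfinish \<gamma> = pathstart \<gamma>" by (simp_all add: \<gamma>_def)
      show "\<forall>z. z \<notin> S \<longrightarrow> winding_number \<gamma> z = 0"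
      proof (intro allI impI)
        fix z assume "z \<notin> S"
        hence "z \<notin> cbox a1 a3"
          using order by (auto simp: S_def a1_def a3_def in_cbox_complex_iff)
        thus "winding_number \<gamma> z = 0"
          unfolding \<gamma>_def using order R
          by (intro winding_number_rectpath_outside) (auto simp: a1_def a3_def)
      qed
    qed (use img in auto)
    moreover have "winding_number \<gamma> (of_real p) = 1"
      unfolding \<gamma>_def using order R by (intro winding_number_rectpath) (auto simp: a1_def a3_def in_box_complex_iff)
    ultimately have "2 * pi * \<i> * residue f (of_real p) = contour_integral \<gamma> f" by simp
    also have "\<dots> = contour_integral (linepath a1 a2) f + (contour_integral (linepath a2 a3) f +
        (contour_integral (linepath a3 a4) f + contour_integral (linepath a4 a1) f))"
      unfolding \<gamma> using ci by (simp add: contour_integrable_joinI valid_path_join)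
    also have "contour_integral (linepath a2 a3) f = \<i> * integral {-R..R} (\<lambda>t. f (Complex b t))"
    proof -
      have "(f has_contour_integral contour_integral (linepath a2 a3) f) (linepath a2 a3)"
        using ci(2) by (rule has_contour_integral_integral)
      hence "((\<lambda>x. f (Complex b x)) has_integral -\<i> * contour_integral (linepath a2 a3) f) {-R..R}"
        using R by (subst (asm) has_contour_integral_linepath_same_Re_iff) (auto simp: a2_def a3_def)
      hence "integral {-R..R} (\<lambda>x. f (Complex b x)) = -\<i> * contour_integral (linepath a2 a3) f"
        by (rule integral_unique)
      thus ?thesis by simp
    qed
    also have "contour_integral (linepath a4 a1) f = - (\<i> * integral {-R..R} (\<lambda>t. f (Complex a t)))"
    proof -
      have cont41: "continuous_on (closed_segment a4 a1) f" using sub(4) continuous_on_subset[OF cont] by blast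
      have "f contour_integrable_on linepath a1 a4"
        using cont41 by (intro contour_integrable_continuous_linepath) (simp add: closed_segment_commute)
      hence "(f has_contour_integral contour_integral (linepath a1 a4) f) (linepath a1 a4)"
        by (rule has_contour_integral_integral)
      hence "((\<lambda>x. f (Complex a x)) has_integral -\<i> * contour_integral (linepath a1 a4) f) {-R..R}"
        using R by (subst (asm) has_contour_integral_linepath_same_Re_iff) (auto simp: a1_def a4_def)
      hence "integral {-R..R} (\<lambda>x. f (Complex a x)) = -\<i> * contour_integral (linepath a1 a4) f"
        by (rule integral_unique)
      thus ?thesis using contour_integral_reverse_linepath[OF cont41] by simp
    qed
    finally have "D n = - (contour_integral (linepath a1 a2) f + contour_integral (linepath a3 a4) f)"
      unfolding D_def R_def by simp
    hence "norm (D n) \<le> norm (contour_integral (linepath a1 a2) f) + norm (contour_integral (linepath a3 a4) f)"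
      by (metis norm_minus_cancel norm_triangle_ineq)
    also have "\<dots> \<le> (B * (1 + R) ^ k * exp (- e * R)) * norm (a2 - a1) + (B * (1 + R) ^ k * exp (- e * R)) * norm (a4 - a3)"
    proof -
      have le: "norm (f s) \<le> B * (1 + R) ^ k * exp (- e * R)" if "a \<le> Re s" "Re s \<le> b" "\<bar>Im s\<bar> = R" for s
        using bound[of s] that R by simp
      have B0: "0 \<le> B * (1 + R) ^ k * exp (- e * R)"
        using le[of "Complex a R"] order R by (intro order.trans[OF norm_ge_zero]) auto
      show ?thesis
        using R by (intro add_mono contour_integral_bound_linepath ci B0 le) (auto simp: seg)
    qed
    also have "norm (a2 - a1) = b - a" using order by (simp add: a1_def a2_def cmod_def)
    also have "norm (a4 - a3) = b - a" using order by (simp add: a3_def a4_def cmod_def)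
    finally show ?thesis by (simp add: R_def mult_ac)
  qed
  have "D \<longlonglongrightarrow> 0"
  proof (rule Lim_null_comparison)
    show "eventually (\<lambda>n. norm (D n) \<le> (2 * B * (b - a)) * ((1 + real n) ^ k * exp (- e * real n))) sequentially"
      using eventually_ge_at_top[of 1]
    proof eventually_elim
      case (elim n)
      have "2 * (B * (1 + real n) ^ k * exp (- e * real n)) * (b - a) =
          (2 * B * (b - a)) * ((1 + real n) ^ k * exp (- e * real n))"
        by (simp only: mult_ac)
      thus ?case using bound_D[OF elim] by (simp only:)
    qed
    show "(\<lambda>n. (2 * B * (b - a)) * ((1 + real n) ^ k * exp (- e * real n))) \<longlonglongrightarrow> 0"
      by (intro tendsto_mult_right_zero power_exp_abs_tendsto_0 e)
  qed
  moreover have "D \<longlonglongrightarrow> \<i> * (\<integral>t. f (Complex b t) \<partial>lborel) - \<i> * (\<integral>t. f (Complex a t) \<partial>lborel)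
      - 2 * pi * \<i> * residue f (of_real p)"
    unfolding D_def by (intro tendsto_intros tendsto_integral_symmetric_interval integrable_vertical_line) auto
  ultimately have "\<i> * (\<integral>t. f (Complex b t) \<partial>lborel) - \<i> * (\<integral>t. f (Complex a t) \<partial>lborel)
      - 2 * pi * \<i> * residue f (of_real p) = 0"
    using LIMSEQ_unique by metis
  hence "\<i> * ((\<integral>t. f (Complex b t) \<partial>lborel) - (\<integral>t. f (Complex a t) \<partial>lborel)) =
      \<i> * (2 * of_real pi * residue f (of_real p))"
    by (simp add: algebra_simps)
  thus ?thesis by (subst (asm) mult_cancel_left) simp
qed

end

section \<open>The Cahen-Mellin integral\<close>

lemma norm_integral_le:
  fixes f :: "'a \<Rightarrow> 'b::{banach, second_countable_topology}"
  assumes "integrable M g" "\<And>x. norm (f x) \<le> g x"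
  shows "norm (integral\<^sup>L M f) \<le> integral\<^sup>L M g"
  by (rule order.trans[OF integral_norm_bound integral_mono'])
     (use assms in \<open>auto intro: order.trans[OF norm_ge_zero]\<close>)

lemma norm_powr_uminus_le:
  fixes z s :: complex
  assumes "z \<noteq> 0"
  shows "norm (z powr (- s)) \<le> exp (\<bar>Re s\<bar> * \<bar>ln (norm z)\<bar>) * exp (\<bar>Im (Ln z)\<bar> * \<bar>Im s\<bar>)"
proof -
  have "norm (z powr (- s)) = exp (- (Re s * ln (norm z)) + Im (Ln z) * Im s)"
    using assms by (simp add: powr_def mult.commute)
  also have "\<dots> \<le> exp (\<bar>Re s\<bar> * \<bar>ln (norm z)\<bar> + \<bar>Im (Ln z)\<bar> * \<bar>Im s\<bar>)"
    using abs_ge_minus_self[of "Re s * ln (norm z)"] abs_ge_self[of "Im (Ln z) * Im s"]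
    by (simp add: abs_mult add_mono)
  finally show ?thesis by (simp add: exp_add)
qed

lemma abs_Im_Ln_less: "Re z > 0 \<Longrightarrow> \<bar>Im (Ln z)\<bar> < pi / 2"
  using Re_Ln_pos_lt[of z] by force

text \<open>Moving left by one unit divides by \<open>s\<close>, and \<open>norm s \<ge> 1\<close>
  off the strip \<open>\<bar>Im s\<bar> < 1\<close>. Hence the constant does not depend on how far
  left the line lies.\<close>

lemma norm_Gamma_left_strip_bound:
  obtains C where "C > 0"
    "\<And>n s. 1/2 - real n \<le> Re s \<Longrightarrow> Re s \<le> 3/2 \<Longrightarrow> \<bar>Im s\<bar> \<ge> 1 \<Longrightarrow>
       norm (Gamma s) \<le> C * (1 + \<bar>Im s\<bar>) * exp (- (pi / 2) * \<bar>Im s\<bar>)"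
proof -
  obtain C where C: "C > 0"
    "\<And>s. 1/2 \<le> Re s \<Longrightarrow> Re s \<le> 3/2 \<Longrightarrow> norm (Gamma s) \<le> C * (1 + \<bar>Im s\<bar>) * exp (- (pi / 2) * \<bar>Im s\<bar>)"
    using norm_Gamma_strip_bound by blast
  have "norm (Gamma s) \<le> C * (1 + \<bar>Im s\<bar>) * exp (- (pi / 2) * \<bar>Im s\<bar>)"
    if "1/2 - real n \<le> Re s" "Re s \<le> 3/2" "\<bar>Im s\<bar> \<ge> 1" for n s
    using that
  proof (induction n arbitrary: s)
    case 0
    thus ?case using C(2)[of s] by simp
  next
    case (Suc n)
    show ?case
    proof (cases "Re s \<ge> 1/2")
      case True
      thus ?thesis using C(2)[of s] Suc.prems by simp
    next
      case False
      have "s \<notin> \<int>\<^sub>\<le>\<^sub>0" using Suc.prems(3) by (auto elim!: nonpos_Ints_cases')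
      hence "Gamma (s + 1) = s * Gamma s" by (rule Gamma_plus1)
      moreover have "norm s \<ge> 1" using abs_Im_le_cmod[of s] Suc.prems by linarith
      ultimately have "norm (Gamma s) \<le> norm (Gamma (s + 1))"
        by (simp add: norm_mult mult_le_cancel_right1)
      also have "\<dots> \<le> C * (1 + \<bar>Im s\<bar>) * exp (- (pi / 2) * \<bar>Im s\<bar>)"
        using Suc.IH[of "s + 1"] Suc.prems False by simp
      finally show ?thesis .
    qed
  qed
  thus ?thesis using that C(1) by blast
qed

context
  fixes z :: complex
  assumes z: "Re z > 0"
begin

lemma right_half_plane_nonzero: "z \<noteq> 0"
  using z by auto

text \<open>The inverse Mellin integral of Gamma along \<open>Re s = c\<close>, without the factor
  \<open>1 / (2 * pi)\<close>.\<close>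

definition mellin_exp :: "real \<Rightarrow> complex" where
  "mellin_exp c = (\<integral>t. Gamma (Complex c t) * z powr (- Complex c t) \<partial>lborel)"

lemma
  assumes order: "a' < a" "a < p" "p < b" "b < b'" and b: "b \<le> 3/2"
    and hol: "Gamma holomorphic_on {s. a' < Re s \<and> Re s < b'} - {of_real p}"
  shows integrable_mellin_exp: "c = a \<or> c = b \<Longrightarrow> integrable lborel (\<lambda>t. Gamma (Complex c t) * z powr (- Complex c t))"
    and mellin_exp_shift: "mellin_exp b - mellin_exp a =
      2 * of_real pi * residue (\<lambda>s. Gamma s * z powr (- s)) (of_real p)"
proof -
  obtain C where C: "C > 0"
    "\<And>n s. 1/2 - real n \<le> Re s \<Longrightarrow> Re s \<le> 3/2 \<Longrightarrow> \<bar>Im s\<bar> \<ge> 1 \<Longrightarrow>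
       norm (Gamma s) \<le> C * (1 + \<bar>Im s\<bar>) * exp (- (pi / 2) * \<bar>Im s\<bar>)"
    using norm_Gamma_left_strip_bound by metis
  define M where "M = max \<bar>a\<bar> \<bar>b\<bar>"
  define e where "e = pi / 2 - \<bar>Im (Ln z)\<bar>"
  have e: "e > 0" using abs_Im_Ln_less[OF z] by (simp add: e_def)
  obtain n where n: "1/2 - a \<le> real n" using real_arch_simple by blast
  have bound: "norm (Gamma s * z powr (- s)) \<le> (C * exp (M * \<bar>ln (norm z)\<bar>)) * (1 + \<bar>Im s\<bar>) ^ 1 * exp (- e * \<bar>Im s\<bar>)"
    if s: "a \<le> Re s" "Re s \<le> b" "\<bar>Im s\<bar> \<ge> 1" for s
  proof -
    have "norm (Gamma s * z powr (- s)) \<le> (C * (1 + \<bar>Im s\<bar>) * exp (- (pi / 2) * \<bar>Im s\<bar>)) *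
        (exp (\<bar>Re s\<bar> * \<bar>ln (norm z)\<bar>) * exp (\<bar>Im (Ln z)\<bar> * \<bar>Im s\<bar>))"
      unfolding norm_mult using s b n C(1)
      by (intro mult_mono C(2)[of n] norm_powr_uminus_le right_half_plane_nonzero) auto
    also have "\<dots> \<le> (C * (1 + \<bar>Im s\<bar>) * exp (- (pi / 2) * \<bar>Im s\<bar>)) *
        (exp (M * \<bar>ln (norm z)\<bar>) * exp (\<bar>Im (Ln z)\<bar> * \<bar>Im s\<bar>))"
      using s C(1) by (intro mult_left_mono mult_right_mono) (auto simp: M_def intro!: mult_right_mono)
    also have "\<dots> = C * exp (M * \<bar>ln (norm z)\<bar>) * (1 + \<bar>Im s\<bar>) *
        (exp (- (pi / 2) * \<bar>Im s\<bar>) * exp (\<bar>Im (Ln z)\<bar> * \<bar>Im s\<bar>))"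
      by (simp only: mult_ac)
    also have "exp (- (pi / 2) * \<bar>Im s\<bar>) * exp (\<bar>Im (Ln z)\<bar> * \<bar>Im s\<bar>) = exp (- e * \<bar>Im s\<bar>)"
      unfolding exp_add[symmetric] by (simp add: e_def algebra_simps)
    finally show ?thesis by simp
  qed
  have hol': "(\<lambda>s. Gamma s * z powr (- s)) holomorphic_on {s. a' < Re s \<and> Re s < b'} - {of_real p}"
    using right_half_plane_nonzero by (intro holomorphic_intros hol)
  show "integrable lborel (\<lambda>t. Gamma (Complex c t) * z powr (- Complex c t))" if "c = a \<or> c = b"
    by (rule integrable_vertical_line[OF order e hol' bound that])
  show "mellin_exp b - mellin_exp a =
      2 * of_real pi * residue (\<lambda>s. Gamma s * z powr (- s)) (of_real p)"
    unfolding mellin_exp_def by (rule integral_vertical_line_shift[OF order e hol' bound])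
qed

text \<open>Between the two lines lies the single pole \<open>- n\<close> of Gamma with residue
  \<open>(-1) ^ n / fact n\<close>, so each shift picks up one Taylor term of
  \<open>exp (- z)\<close>.\<close>

lemma mellin_exp_step: "mellin_exp (1/2 - real n) - mellin_exp (1/2 - real (Suc n)) = 2 * of_real pi * ((-z) ^ n / fact n)"
proof -
  define S where "S = {s. - real n - 1 < Re s \<and> Re s < 1 - real n}"
  have S: "open S" "- of_nat n \<in> S"
    unfolding S_def by (auto intro!: open_Collect_conj open_Collect_less continuous_intros)
  have hol: "Gamma holomorphic_on S - {of_real (- real n)}"
  proof (rule holomorphic_Gamma)
    have "s = - of_nat n" if "s \<in> S" "s \<in> \<int>\<^sub>\<le>\<^sub>0" for s
      using that by (auto simp: S_def elim!: nonpos_Ints_cases')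
    thus "(S - {of_real (- real n)}) \<inter> \<int>\<^sub>\<le>\<^sub>0 = {}" by auto
  qed
  have "mellin_exp (1/2 - real n) - mellin_exp (1/2 - real (Suc n)) =
     2 * of_real pi * residue (\<lambda>s. Gamma s * z powr (- s)) (of_real (- real n))"
    by (rule mellin_exp_shift[of "- real n - 1" _ _ _ "1 - real n"]) (use hol in \<open>auto simp: S_def\<close>)
  also have "residue (\<lambda>s. Gamma s * z powr (- s)) (of_real (- real n)) = (-z) ^ n / fact n"
  proof (rule residue_simple'[OF S(1)])
    show "(\<lambda>s. Gamma s * z powr (- s)) holomorphic_on S - {of_real (- real n)}"
      using right_half_plane_nonzero by (intro holomorphic_intros hol)
    have "(\<lambda>s. (Gamma s * (s + of_nat n)) * z powr (- s)) \<midarrow> - of_nat n \<rightarrow> ((-1) ^ n / fact n) * z powr (- (- of_nat n))"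
      using right_half_plane_nonzero z by (intro tendsto_mult Gamma_residues isContD continuous_intros) (auto simp: complex_nonpos_Reals_iff)
    also have "((-1) ^ n / fact n) * z powr (- (- of_nat n)) = (-z) ^ n / fact n"
      using right_half_plane_nonzero by (simp add: powr_nat power_minus[of z])
    finally show "(\<lambda>s. Gamma s * z powr (- s) * (s - of_real (- real n))) \<midarrow> of_real (- real n) \<rightarrow> (-z) ^ n / fact n"
      by (simp add: mult_ac)
  qed (use S in auto)
  finally show ?thesis .
qed

text \<open>The \<open>(n + 1)\<close>-st shift to the left divides by some \<open>s\<close> with
  \<open>norm s \<ge> n + 1/2 \<ge> (n + 1) / 2\<close>; these lower bounds multiply up to
  \<open>fact n / 2 ^ n\<close>.\<close>

lemma norm_Gamma_left_le:
  "norm (Gamma (Complex (1/2 - real n) t)) * (fact n / 2 ^ n) \<le> 3 * exp (- (pi / 2) * \<bar>t\<bar>)"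
proof (induction n)
  case 0
  show ?case using norm_Gamma_half_line[of t] by simp
next
  case (Suc n)
  define s where "s = Complex (1/2 - real (Suc n)) t"
  have "s \<notin> \<int>\<^sub>\<le>\<^sub>0"
  proof
    assume "s \<in> \<int>\<^sub>\<le>\<^sub>0"
    then obtain m where "s = - of_nat m" by (elim nonpos_Ints_cases')
    hence "Re s = - real m" by simp
    hence "2 * int m = 2 * int n + 1" by (simp add: s_def)
    thus False by presburger
  qed
  hence "Gamma (s + 1) = s * Gamma s" by (rule Gamma_plus1)
  moreover have "s + 1 = Complex (1/2 - real n) t" by (simp add: s_def complex_eq_iff)
  ultimately have G: "norm (Gamma (Complex (1/2 - real n) t)) = norm s * norm (Gamma s)"
    by (simp add: norm_mult)
  have "norm s \<ge> real (Suc n) / 2"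
    using abs_Re_le_cmod[of s] by (simp add: s_def)
  have "norm (Gamma s) * (fact (Suc n) / 2 ^ Suc n) = (real (Suc n) / 2) * norm (Gamma s) * (fact n / 2 ^ n)"
    by simp
  also have "\<dots> \<le> norm s * norm (Gamma s) * (fact n / 2 ^ n)"
    using \<open>norm s \<ge> _\<close> by (intro mult_right_mono) auto
  also have "\<dots> \<le> 3 * exp (- (pi / 2) * \<bar>t\<bar>)" using Suc.IH unfolding G .
  finally show ?case unfolding s_def .
qed

text \<open>The power of \<open>z\<close> grows only geometrically in \<open>n\<close>, while Gamma
  decays like \<open>2 ^ n / fact n\<close>. The \<open>t\<close>-integral converges because the
  argument of \<open>z\<close> stays below \<open>pi / 2\<close>.\<close>

lemma mellin_exp_left_tendsto_0: "(\<lambda>n. mellin_exp (1/2 - real n)) \<longlonglongrightarrow> 0"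
proof -
  define e where "e = pi / 2 - \<bar>Im (Ln z)\<bar>"
  have e: "e > 0" using abs_Im_Ln_less[OF z] by (simp add: e_def)
  define L where "L = \<bar>ln (norm z)\<bar>"
  define K where "K = (\<integral>t. exp (- e * \<bar>t\<bar>) \<partial>lborel)"
  have bound: "norm (mellin_exp (1/2 - real n)) \<le> 3 * exp L * K * ((2 * exp L) ^ n / fact n)" for n
  proof -
    have "norm (mellin_exp (1/2 - real n)) \<le> (\<integral>t. (3 * exp L * ((2 * exp L) ^ n / fact n)) * exp (- e * \<bar>t\<bar>) \<partial>lborel)"
      unfolding mellin_exp_def
    proof (rule norm_integral_le)
      fix t :: real
      have "norm (Gamma (Complex (1/2 - real n) t)) \<le> 3 * exp (- (pi / 2) * \<bar>t\<bar>) * (2 ^ n / fact n)"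
        using norm_Gamma_left_le[of n t] by (simp add: field_simps)
      moreover have "norm (z powr (- Complex (1/2 - real n) t)) \<le> exp ((1 + real n) * L) * exp (\<bar>Im (Ln z)\<bar> * \<bar>t\<bar>)"
      proof -
        have "norm (z powr (- Complex (1/2 - real n) t)) \<le> exp (\<bar>1/2 - real n\<bar> * L) * exp (\<bar>Im (Ln z)\<bar> * \<bar>t\<bar>)"
          using norm_powr_uminus_le[OF right_half_plane_nonzero, of "Complex (1/2 - real n) t"] by (simp add: L_def)
        also have "\<dots> \<le> exp ((1 + real n) * L) * exp (\<bar>Im (Ln z)\<bar> * \<bar>t\<bar>)"
          by (intro mult_right_mono) (auto simp: L_def intro!: mult_right_mono)
        finally show ?thesis .
      qed
      ultimately have "norm (Gamma (Complex (1/2 - real n) t) * z powr (- Complex (1/2 - real n) t)) \<le>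
          (3 * exp (- (pi / 2) * \<bar>t\<bar>) * (2 ^ n / fact n)) * (exp ((1 + real n) * L) * exp (\<bar>Im (Ln z)\<bar> * \<bar>t\<bar>))"
        unfolding norm_mult by (intro mult_mono) auto
      also have "\<dots> = 3 * (2 ^ n / fact n) * exp ((1 + real n) * L) * (exp (- (pi / 2) * \<bar>t\<bar>) * exp (\<bar>Im (Ln z)\<bar> * \<bar>t\<bar>))"
        by (simp only: mult_ac)
      also have "exp (- (pi / 2) * \<bar>t\<bar>) * exp (\<bar>Im (Ln z)\<bar> * \<bar>t\<bar>) = exp (- e * \<bar>t\<bar>)"
        unfolding exp_add[symmetric] by (simp add: e_def algebra_simps)
      also have "exp ((1 + real n) * L) = exp L * exp L ^ n"
        by (simp add: distrib_right exp_add exp_of_nat_mult)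
      finally show "norm (Gamma (Complex (1/2 - real n) t) * z powr (- Complex (1/2 - real n) t)) \<le>
          (3 * exp L * ((2 * exp L) ^ n / fact n)) * exp (- e * \<bar>t\<bar>)"
        by (simp add: power_mult_distrib mult_ac)
    qed (intro integrable_mult_right integrable_exp_abs e)
    thus ?thesis by (simp add: K_def mult_ac)
  qed
  have "(\<lambda>n. (2 * exp L) ^ n / fact n) \<longlonglongrightarrow> 0"
    using summable_LIMSEQ_zero[OF summable_exp_generic[of "2 * exp L"]] by (simp add: field_simps)
  hence "(\<lambda>n. 3 * exp L * K * ((2 * exp L) ^ n / fact n)) \<longlonglongrightarrow> 0"
    by (rule tendsto_mult_right_zero)
  thus ?thesis by (rule Lim_null_comparison[rotated]) (use bound in auto)
qed

text \<open>Shifting from 1/2 infinitely far to the left turns the integral into the exponential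
  series.\<close>

theorem Cahen_Mellin:
  "(\<integral>t. Gamma (Complex (3/2) t) * z powr (- Complex (3/2) t) \<partial>lborel) = 2 * of_real pi * exp (- z)"
proof -
  have "(\<lambda>n. mellin_exp (1/2 - real n) - mellin_exp (1/2 - real (Suc n))) sums (mellin_exp (1/2 - real 0) - 0)"
    by (rule telescope_sums'[OF mellin_exp_left_tendsto_0])
  hence "(\<lambda>n. 2 * of_real pi * ((-z) ^ n / fact n)) sums mellin_exp (1/2)"
    unfolding mellin_exp_step by simp
  moreover have "(\<lambda>n. 2 * of_real pi * ((-z) ^ n / fact n)) sums (2 * of_real pi * exp (- z))"
    using exp_converges[of "-z"] by (intro sums_mult) (simp add: scaleR_conv_of_real field_simps)
  ultimately have "mellin_exp (1/2) = 2 * of_real pi * exp (- z)" by (rule sums_unique2)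
  \<comment> \<open>The shift lemma asks for a marked point between the lines; at 1 Gamma is
    regular, so the residue is 0.\<close>
  moreover have "mellin_exp (3/2) - mellin_exp (1/2) = 0"
  proof -
    have hol: "Gamma holomorphic_on {s. 0 < Re s \<and> Re s < 2}"
      by (intro holomorphic_Gamma) (auto elim!: nonpos_Ints_cases')
    have "open {s. 0 < Re s \<and> Re s < 2}"
      by (intro open_Collect_conj open_Collect_less continuous_intros)
    hence "residue (\<lambda>s. Gamma s * z powr (- s)) (of_real 1) = 0"
      by (rule residue_holo) (use right_half_plane_nonzero in \<open>auto intro!: holomorphic_intros hol\<close>)
    thus ?thesis
      using mellin_exp_shift[of 0 "1/2" 1 "3/2" 2] holomorphic_on_subset[OF hol] by auto
  qed
  ultimately show ?thesis by (simp add: mellin_exp_def)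
qed

end

section \<open>The divisor series\<close>

text \<open>The decay rate \<open>pi / 2\<close> is that of \<open>\<Gamma>\<close> and is just enough for \<open>inverse_mellin\<close> to
  converge on the right half-plane.\<close>

definition exp_decay :: "(real \<Rightarrow> complex) \<Rightarrow> bool" where
  "exp_decay g \<longleftrightarrow> g \<in> borel_measurable borel \<and>
     (\<exists>C k. \<forall>t. norm (g t) \<le> C * (1 + \<bar>t\<bar>) ^ k * exp (- (pi / 2) * \<bar>t\<bar>))"

definition inverse_mellin :: "(real \<Rightarrow> complex) \<Rightarrow> complex \<Rightarrow> complex" where
  "inverse_mellin g z = (\<integral>t. g t * z powr (- Complex (3/2) t) \<partial>lborel)"

lemma Complex_line_continuous: "continuous_on A (Complex c)"
  by (auto simp: Complex_eq intro!: continuous_intros)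

lemma continuous_on_holomorphic_line:
  assumes "f holomorphic_on S" "\<And>t. Complex c t \<in> S"
  shows "continuous_on UNIV (\<lambda>t. f (Complex c t))"
proof -
  have "continuous_on (range (Complex c)) f"
    by (rule continuous_on_subset[OF holomorphic_on_imp_continuous_on[OF assms(1)]]) (use assms(2) in auto)
  hence "continuous_on UNIV (f \<circ> Complex c)"
    by (rule continuous_on_compose[OF Complex_line_continuous])
  thus ?thesis by (simp add: o_def)
qed

lemma borel_measurable_powr_line:
  "z \<noteq> 0 \<Longrightarrow> (\<lambda>t. z powr (- Complex c t)) \<in> borel_measurable borel"
  by (intro borel_measurable_continuous_onI continuous_on_holomorphic_line[where f = "\<lambda>s. z powr (- s)" and S = UNIV])
     (auto intro!: holomorphic_intros)

lemma zeta_line_continuous: "c \<noteq> 1 \<Longrightarrow> continuous_on UNIV (\<lambda>t. zeta (Complex c t))"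
  by (rule continuous_on_holomorphic_line[OF zeta_holomorphic[of "UNIV - {1}"]])
     (auto simp: complex_eq_iff)

lemma exp_decay_Gamma: "exp_decay (\<lambda>t. Gamma (Complex (3/2) t))"
proof -
  obtain C where C: "\<And>s. 1/2 \<le> Re s \<Longrightarrow> Re s \<le> 3/2 \<Longrightarrow>
     norm (Gamma s) \<le> C * (1 + \<bar>Im s\<bar>) * exp (- (pi / 2) * \<bar>Im s\<bar>)"
    using norm_Gamma_strip_bound by blast
  have "norm (Gamma (Complex (3/2) t)) \<le> C * (1 + \<bar>t\<bar>) ^ 1 * exp (- (pi / 2) * \<bar>t\<bar>)" for t
    using C[of "Complex (3/2) t"] by simp
  moreover have "Gamma holomorphic_on {s. Re s > 0}"
    by (intro holomorphic_Gamma) (auto elim!: nonpos_Ints_cases')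
  hence "continuous_on UNIV (\<lambda>t. Gamma (Complex (3/2) t))"
    by (rule continuous_on_holomorphic_line) auto
  ultimately show ?thesis unfolding exp_decay_def
    using borel_measurable_continuous_onI by blast
qed

lemma exp_decay_times_zeta:
  assumes "exp_decay g"
  shows "exp_decay (\<lambda>t. g t * zeta (Complex (3/2) t))"
proof -
  from assms obtain C k where g: "g \<in> borel_measurable borel"
    "\<And>t. norm (g t) \<le> C * (1 + \<bar>t\<bar>) ^ k * exp (- (pi / 2) * \<bar>t\<bar>)"
    unfolding exp_decay_def by blast
  obtain D where D: "D > 0"
    "\<And>s. 1/2 \<le> Re s \<Longrightarrow> Re s \<le> 3/2 \<Longrightarrow> norm (s - 1) \<ge> 1/2 \<Longrightarrow> norm (zeta s) \<le> D * (1 + \<bar>Im s\<bar>) ^ 2"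
    using zeta_polynomial_bound by blast
  have "norm (zeta (Complex (3/2) t)) \<le> D * (1 + \<bar>t\<bar>) ^ 2" for t
    using D(2)[of "Complex (3/2) t"] abs_Re_le_cmod[of "Complex (3/2) t - 1"] by simp
  moreover have "0 \<le> C * (1 + \<bar>t\<bar>) ^ k * exp (- (pi / 2) * \<bar>t\<bar>)" for t
    by (rule order.trans[OF norm_ge_zero g(2)])
  ultimately have "norm (g t * zeta (Complex (3/2) t)) \<le>
      (C * (1 + \<bar>t\<bar>) ^ k * exp (- (pi / 2) * \<bar>t\<bar>)) * (D * (1 + \<bar>t\<bar>) ^ 2)" for t
    unfolding norm_mult by (intro mult_mono g(2)) auto
  also have "(C * (1 + \<bar>t\<bar>) ^ k * exp (- (pi / 2) * \<bar>t\<bar>)) * (D * (1 + \<bar>t\<bar>) ^ 2) =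
      (C * D) * (1 + \<bar>t\<bar>) ^ (k + 2) * exp (- (pi / 2) * \<bar>t\<bar>)" for t
    by (simp add: power_add power2_eq_square)
  finally have "\<forall>t. norm (g t * zeta (Complex (3/2) t)) \<le> (C * D) * (1 + \<bar>t\<bar>) ^ (k + 2) * exp (- (pi / 2) * \<bar>t\<bar>)"
    by blast
  moreover have "(\<lambda>t. g t * zeta (Complex (3/2) t)) \<in> borel_measurable borel"
    by (intro borel_measurable_times g borel_measurable_continuous_onI zeta_line_continuous) simp
  ultimately show ?thesis unfolding exp_decay_def by blast
qed

lemma integrable_inverse_mellin:
  assumes g: "exp_decay g" and z: "Re z > 0"
  shows "integrable lborel (\<lambda>t. g t * z powr (- Complex (3/2) t))"
proof -
  from g obtain C k where gm: "g \<in> borel_measurable borel"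
    and bound: "\<And>t. norm (g t) \<le> C * (1 + \<bar>t\<bar>) ^ k * exp (- (pi / 2) * \<bar>t\<bar>)"
    unfolding exp_decay_def by blast
  have z0: "z \<noteq> 0" using z by auto
  define e where "e = pi / 2 - \<bar>Im (Ln z)\<bar>"
  have e: "e > 0" using abs_Im_Ln_less[OF z] by (simp add: e_def)
  define L where "L = exp (3/2 * \<bar>ln (norm z)\<bar>)"
  have "norm (g t * z powr (- Complex (3/2) t)) \<le> C * L * ((1 + \<bar>t\<bar>) ^ k * exp (- e * \<bar>t\<bar>))" for t
  proof -
    have "norm (g t * z powr (- Complex (3/2) t)) \<le>
        (C * (1 + \<bar>t\<bar>) ^ k * exp (- (pi / 2) * \<bar>t\<bar>)) * (L * exp (\<bar>Im (Ln z)\<bar> * \<bar>t\<bar>))"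
      unfolding norm_mult L_def
      using norm_powr_uminus_le[OF z0, of "Complex (3/2) t"] order.trans[OF norm_ge_zero bound[of t]]
      by (intro mult_mono bound) auto
    also have "\<dots> = C * L * ((1 + \<bar>t\<bar>) ^ k * (exp (- (pi / 2) * \<bar>t\<bar>) * exp (\<bar>Im (Ln z)\<bar> * \<bar>t\<bar>)))"
      by (simp only: mult_ac)
    also have "exp (- (pi / 2) * \<bar>t\<bar>) * exp (\<bar>Im (Ln z)\<bar> * \<bar>t\<bar>) = exp (- e * \<bar>t\<bar>)"
      unfolding exp_add[symmetric] by (simp add: e_def algebra_simps)
    finally show ?thesis .
  qed
  hence *: "norm (g t * z powr (- Complex (3/2) t)) \<le> norm (C * L * ((1 + \<bar>t\<bar>) ^ k * exp (- e * \<bar>t\<bar>)))" for t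
    by (metis abs_ge_self dual_order.trans real_norm_def)
  show ?thesis
  proof (rule Bochner_Integration.integrable_bound)
    show "integrable lborel (\<lambda>t. C * L * ((1 + \<bar>t\<bar>) ^ k * exp (- e * \<bar>t\<bar>)))"
      by (intro integrable_mult_right integrable_power_exp_abs e)
    show "(\<lambda>t. g t * z powr (- Complex (3/2) t)) \<in> borel_measurable lborel"
      using gm borel_measurable_powr_line[OF z0] by simp
  qed (use * in auto)
qed

text \<open>On \<open>Re s = 3/2\<close> the Dirichlet series of zeta converges absolutely and may
  be integrated term by term. The factor \<open>Suc n\<close> moves into the argument without a
  branch problem because it is a positive real.\<close>

lemma inverse_mellin_times_zeta_sums:
  assumes g: "exp_decay g" and z: "Re z > 0"
  shows "(\<lambda>n. inverse_mellin g (of_nat (Suc n) * z)) sums inverse_mellin (\<lambda>t. g t * zeta (Complex (3/2) t)) z"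
proof -
  define F where "F = (\<lambda>t. g t * z powr (- Complex (3/2) t))"
  have F: "integrable lborel F" unfolding F_def by (rule integrable_inverse_mellin[OF g z])
  define a where "a = (\<lambda>n t. F t * of_nat (Suc n) powr (- Complex (3/2) t))"
  have a_eq: "a n t = g t * (of_nat (Suc n) * z) powr (- Complex (3/2) t)" for n t
    by (simp add: a_def F_def powr_times_real_left del: of_nat_Suc)
  have norm_a: "norm (a n t) = norm (F t) * real (Suc n) powr (-3/2)" for n t
    unfolding a_def norm_mult by (subst norm_powr_real_powr) auto
  have a_int: "integrable lborel (a n)" for n
    using integrable_inverse_mellin[OF g, of "of_nat (Suc n) * z"] z unfolding a_eq [abs_def] by simp
  have sum: "summable (\<lambda>n. real (Suc n) powr (-3/2))"
    using summable_real_powr_iff[of "-3/2"] by (subst summable_Suc_iff) auto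
  have "(\<lambda>n. integral\<^sup>L lborel (a n)) sums (\<integral>t. (\<Sum>n. a n t) \<partial>lborel)"
  proof (rule sums_integral)
    show "AE t in lborel. summable (\<lambda>n. norm (a n t))"
      unfolding norm_a by (intro AE_I2 summable_mult sum)
    show "summable (\<lambda>n. \<integral>t. norm (a n t) \<partial>lborel)"
      unfolding norm_a using summable_mult[OF sum] by simp
  qed (rule a_int)
  also have "(\<lambda>t. \<Sum>n. a n t) = (\<lambda>t. (g t * zeta (Complex (3/2) t)) * z powr (- Complex (3/2) t))"
  proof
    fix t
    have "(\<lambda>n. F t * (1 / of_nat (Suc n) powr (Complex (3/2) t))) sums (F t * zeta (Complex (3/2) t))"
      by (intro sums_mult zeta_sums) simp
    hence "(\<lambda>n. a n t) sums (F t * zeta (Complex (3/2) t))"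
      unfolding a_def by (simp only: powr_minus inverse_eq_divide)
    thus "(\<Sum>n. a n t) = (g t * zeta (Complex (3/2) t)) * z powr (- Complex (3/2) t)"
      by (simp add: sums_iff F_def mult_ac)
  qed
  finally show ?thesis unfolding inverse_mellin_def a_eq [abs_def] .
qed

text \<open>\<open>exp (-z)\<close> is \<open>2 \<pi> \<i>\<close>-periodic, and multiplying the Mellin transform by \<open>\<zeta>\<close>
  replaces \<open>\<Phi> z\<close> by \<open>\<Phi> z + \<Phi> (2 z) + \<Phi> (3 z) + \<dots>\<close>, which preserves periodicity.\<close>

lemma inverse_mellin_times_zeta_periodic:
  assumes g: "exp_decay g"
    and per: "\<And>z. Re z > 0 \<Longrightarrow> inverse_mellin g (z + 2 * pi * \<i>) = inverse_mellin g z"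
    and z: "Re z > 0"
  shows "inverse_mellin (\<lambda>t. g t * zeta (Complex (3/2) t)) (z + 2 * pi * \<i>) =
         inverse_mellin (\<lambda>t. g t * zeta (Complex (3/2) t)) z"
proof -
  have per': "inverse_mellin g (w + of_nat m * (2 * pi * \<i>)) = inverse_mellin g w" if "Re w > 0" for w m
  proof (induction m)
    case (Suc m)
    have "inverse_mellin g (w + of_nat m * (2 * pi * \<i>) + 2 * pi * \<i>) = inverse_mellin g (w + of_nat m * (2 * pi * \<i>))"
      using that by (intro per) auto
    thus ?case using Suc by (simp add: algebra_simps)
  qed auto
  have "inverse_mellin g (of_nat (Suc n) * (z + 2 * pi * \<i>)) = inverse_mellin g (of_nat (Suc n) * z)" for n
  proof -
    have "Re (of_nat (Suc n) * z) > 0" using z by (simp add: add_pos_nonneg)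
    from per'[OF this, of "Suc n"] show ?thesis unfolding distrib_left[of _ z] .
  qed
  hence "(\<lambda>n. inverse_mellin g (of_nat (Suc n) * z)) sums
      inverse_mellin (\<lambda>t. g t * zeta (Complex (3/2) t)) (z + 2 * pi * \<i>)"
    using inverse_mellin_times_zeta_sums[OF g, of "z + 2 * pi * \<i>"] z by simp
  thus ?thesis using inverse_mellin_times_zeta_sums[OF g z] by (rule sums_unique2)
qed

text \<open>Equal to 2 pi times the sum of d(n) exp(-n z). The Mellin form serves both purposes:
  periodicity is inherited through the two zeta factors, and the line of integration can be
  moved.\<close>

definition divisor_series :: "complex \<Rightarrow> complex" where
  "divisor_series = inverse_mellin (\<lambda>t. Gamma (Complex (3/2) t) * zeta (Complex (3/2) t) * zeta (Complex (3/2) t))"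

lemma divisor_series_periodic:
  assumes "Re z > 0"
  shows "divisor_series (z + 2 * pi * \<i>) = divisor_series z"
proof -
  have "inverse_mellin (\<lambda>t. Gamma (Complex (3/2) t)) (z + 2 * pi * \<i>) = inverse_mellin (\<lambda>t. Gamma (Complex (3/2) t)) z"
    if z: "Re z > 0" for z
  proof -
    have "exp (- (z + 2 * pi * \<i>)) = exp (- z)"
      using exp_plus_2pin[of "-z" "-1"] by (simp add: algebra_simps)
    thus ?thesis
      unfolding inverse_mellin_def using Cahen_Mellin[of z] Cahen_Mellin[of "z + 2 * pi * \<i>"] z by simp
  qed
  note per = inverse_mellin_times_zeta_periodic[OF exp_decay_Gamma this]
  show ?thesis
    unfolding divisor_series_def
    by (rule inverse_mellin_times_zeta_periodic[OF exp_decay_times_zeta[OF exp_decay_Gamma] per assms])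
qed

section \<open>Passage to the critical line\<close>

text \<open>Holomorphic version of \<open>(s - 1) * zeta s\<close>, with value 1 at the former
  pole.\<close>

definition zeta_regular :: "complex \<Rightarrow> complex" where
  "zeta_regular s = 1 + (s - 1) / 2 + (s - 1) * s * (s + 1) * trapezoid_error_sum s"

lemma zeta_regular_holomorphic: "A \<subseteq> {s. Re s > -1} \<Longrightarrow> zeta_regular holomorphic_on A"
  unfolding zeta_regular_def [abs_def]
  by (intro holomorphic_intros holomorphic_on_subset[OF trapezoid_error_sum_holomorphic]) auto

lemma zeta_eq_zeta_regular: "Re s > -1 \<Longrightarrow> s \<noteq> 1 \<Longrightarrow> zeta s = zeta_regular s / (s - 1)"
  by (simp add: zeta_eq_zeta_right zeta_right_def zeta_regular_def divide_simps) (simp add: algebra_simps)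

definition crit_kernel :: "complex \<Rightarrow> real \<Rightarrow> complex" where
  "crit_kernel z t = (2 * of_real pi) powr (Complex (1/2) t) * z powr (- Complex (1/2) t)
     / (2 * cos (of_real pi * Complex (1/2) t / 2))"

definition crit_integral :: "complex \<Rightarrow> complex" where
  "crit_integral z = (\<integral>t. of_real ((norm (zeta (Complex (1/2) t)))\<^sup>2) * crit_kernel z t \<partial>lborel)"

text \<open>At real part \<open>pi / 4\<close> the oscillating term of the squared modulus drops
  out, leaving half of a hyperbolic cosine.\<close>

lemma norm_cos_crit_ge: "norm (cos (of_real pi * Complex (1/2) t / 2)) \<ge> exp (pi / 2 * \<bar>t\<bar>) / 2"
proof (rule power2_le_imp_le)
  define y where "y = pi / 2 * t"
  have c: "of_real pi * Complex (1/2) t / 2 = Complex (pi / 4) y"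
    by (simp add: y_def complex_eq_iff)
  have "(norm (cos (of_real pi * Complex (1/2) t / 2)))\<^sup>2 = (exp y + exp (- y))\<^sup>2 / 4 - 1 / 2"
    unfolding c norm_cos_squared
    by (simp add: cos_45 power2_eq_square field_simps exp_minus)
  also have "\<dots> = (exp (2 * y) + exp (- (2 * y))) / 4"
    by (simp add: power2_eq_square algebra_simps flip: exp_add)
  also have "\<dots> \<ge> exp (2 * \<bar>y\<bar>) / 4"
    by (cases "y \<ge> 0") auto
  also have "exp (2 * \<bar>y\<bar>) / 4 = (exp (pi / 2 * \<bar>t\<bar>) / 2)\<^sup>2"
    by (simp add: y_def power2_eq_square abs_mult flip: exp_add)
  finally show "(exp (pi / 2 * \<bar>t\<bar>) / 2)\<^sup>2 \<le> (norm (cos (of_real pi * Complex (1/2) t / 2)))\<^sup>2" .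
qed simp

lemma cos_crit_nonzero: "cos (of_real pi * Complex (1/2) t / 2) \<noteq> 0"
  using norm_cos_crit_ge[of t] by (intro notI) (simp add: not_le)

text \<open>On the critical line \<open>zeta (1 - s)\<close> is the conjugate of
  \<open>zeta s\<close>. The functional equation thus trades \<open>Gamma s * zeta s\<close> for
  this conjugate times elementary factors, and the remaining factor \<open>zeta s\<close> completes
  the squared modulus.\<close>

lemma Gamma_zeta_square_crit:
  assumes s: "s = Complex (1/2) t"
  shows "Gamma s * zeta s * zeta s * z powr (- s) = of_real ((norm (zeta s))\<^sup>2) * crit_kernel z t"
proof -
  define C where "C = cos (of_real pi * s / 2)"
  have C: "C \<noteq> 0" using cos_crit_nonzero[of t] by (simp add: C_def s)
  have "1 - s = cnj s" by (simp add: s complex_eq_iff)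
  hence "cnj (zeta s) = 2 * (2 * of_real pi) powr (- s) * C * Gamma s * zeta s"
    using zeta_reflection[of s] by (simp add: zeta_cnj s C_def)
  hence "Gamma s * zeta s = cnj (zeta s) * (2 * of_real pi) powr s / (2 * C)"
    using C by (simp add: powr_minus field_simps)
  hence "Gamma s * zeta s * zeta s * z powr (- s) = (zeta s * cnj (zeta s)) * ((2 * of_real pi) powr s * z powr (- s) / (2 * C))"
    by simp
  also have "zeta s * cnj (zeta s) = of_real ((norm (zeta s))\<^sup>2)"
    using complex_norm_square[of "zeta s"] by simp
  also have "(2 * of_real pi) powr s * z powr (- s) / (2 * C) = crit_kernel z t"
    unfolding crit_kernel_def s C_def ..
  finally show ?thesis .
qed

theorem divisor_series_eq_crit_integral:
  obtains c where "\<And>z. Re z > 0 \<Longrightarrow> divisor_series z = crit_integral z + 2 * pi * (c - Ln z) / z"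
proof -
  obtain C where C: "C > 0"
    "\<And>s. 1/2 \<le> Re s \<Longrightarrow> Re s \<le> 3/2 \<Longrightarrow> norm (Gamma s) \<le> C * (1 + \<bar>Im s\<bar>) * exp (- (pi / 2) * \<bar>Im s\<bar>)"
    using norm_Gamma_strip_bound by blast
  obtain D where D: "D > 0"
    "\<And>s. 1/2 \<le> Re s \<Longrightarrow> Re s \<le> 3/2 \<Longrightarrow> norm (s - 1) \<ge> 1/2 \<Longrightarrow> norm (zeta s) \<le> D * (1 + \<bar>Im s\<bar>) ^ 2"
    using zeta_polynomial_bound by blast
  define S where "S = {s. 0 < Re s \<and> Re s < 2}"
  have S: "open S" "1 \<in> S"
    unfolding S_def by (auto intro!: open_Collect_conj open_Collect_less continuous_intros)
  have Gamma_hol: "Gamma holomorphic_on A" if "A \<subseteq> S" for A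
    using that by (intro holomorphic_Gamma) (auto simp: S_def elim!: nonpos_Ints_cases')
  \<comment> \<open>The numerator of the integrand, without the power of \<open>z\<close>, over
    \<open>(s - 1)\<^sup>2\<close>. As \<open>G 1 = 1\<close>, the residue at the double pole is
    \<open>(deriv G 1 - Ln z) / z\<close>, and \<open>deriv G 1\<close> is the constant
    sought.\<close>
  define G where "G = (\<lambda>s. Gamma s * zeta_regular s * zeta_regular s)"
  have G_hol: "G holomorphic_on S"
    unfolding G_def by (intro holomorphic_intros Gamma_hol zeta_regular_holomorphic) (auto simp: S_def)
  have G1: "G 1 = 1" by (simp add: G_def zeta_regular_def)
  have "divisor_series z = crit_integral z + 2 * pi * (deriv G 1 - Ln z) / z" if z: "Re z > 0" for z
  proof -
    have z0: "z \<noteq> 0" using z by auto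
    define f where "f = (\<lambda>s. Gamma s * zeta s * zeta s * z powr (- s))"
    define e where "e = pi / 2 - \<bar>Im (Ln z)\<bar>"
    have e: "e > 0" using abs_Im_Ln_less[OF z] by (simp add: e_def)
    define L where "L = exp (3/2 * \<bar>ln (norm z)\<bar>)"
    have "(\<integral>t. f (Complex (3/2) t) \<partial>lborel) - (\<integral>t. f (Complex (1/2) t) \<partial>lborel) =
        2 * of_real pi * residue f (of_real 1)"
    proof (rule integral_vertical_line_shift[OF _ _ _ _ e])
      show "f holomorphic_on {s. 0 < Re s \<and> Re s < 2} - {of_real 1}"
        unfolding f_def using z0
        by (intro holomorphic_intros Gamma_hol zeta_holomorphic) (auto simp: S_def)
      fix s :: complex assume s: "1/2 \<le> Re s" "Re s \<le> 3/2" "\<bar>Im s\<bar> \<ge> 1"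
      \<comment> \<open>Away from height 1 the pole is far enough for the polynomial bound on
        zeta.\<close>
      have "norm (s - 1) \<ge> 1/2" using abs_Im_le_cmod[of "s - 1"] s by simp
      have "norm (f s) \<le> (C * (1 + \<bar>Im s\<bar>) * exp (- (pi / 2) * \<bar>Im s\<bar>)) * (D * (1 + \<bar>Im s\<bar>) ^ 2) * (D * (1 + \<bar>Im s\<bar>) ^ 2) *
          (exp (\<bar>Re s\<bar> * \<bar>ln (norm z)\<bar>) * exp (\<bar>Im (Ln z)\<bar> * \<bar>Im s\<bar>))"
        unfolding f_def norm_mult using s C(1) D(1) \<open>norm (s - 1) \<ge> 1/2\<close>
        by (intro mult_mono C(2) D(2) norm_powr_uminus_le z0 mult_nonneg_nonneg) auto
      also have "\<dots> \<le> (C * (1 + \<bar>Im s\<bar>) * exp (- (pi / 2) * \<bar>Im s\<bar>)) * (D * (1 + \<bar>Im s\<bar>) ^ 2) * (D * (1 + \<bar>Im s\<bar>) ^ 2) *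
          (L * exp (\<bar>Im (Ln z)\<bar> * \<bar>Im s\<bar>))"
      proof -
        have "\<bar>Re s\<bar> * \<bar>ln (norm z)\<bar> \<le> 3/2 * \<bar>ln (norm z)\<bar>" using s by (intro mult_right_mono) auto
        hence "exp (\<bar>Re s\<bar> * \<bar>ln (norm z)\<bar>) \<le> L" by (simp add: L_def)
        thus ?thesis using C(1) D(1) by (intro mult_left_mono mult_right_mono mult_nonneg_nonneg) auto
      qed
      also have "\<dots> = (C * D * D * L) * ((1 + \<bar>Im s\<bar>) * (1 + \<bar>Im s\<bar>) ^ 2 * (1 + \<bar>Im s\<bar>) ^ 2) *
          (exp (- (pi / 2) * \<bar>Im s\<bar>) * exp (\<bar>Im (Ln z)\<bar> * \<bar>Im s\<bar>))"
        by (simp only: mult_ac)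
      also have "(1 + \<bar>Im s\<bar>) * (1 + \<bar>Im s\<bar>) ^ 2 * (1 + \<bar>Im s\<bar>) ^ 2 = (1 + \<bar>Im s\<bar>) ^ 5"
        by (simp add: eval_nat_numeral)
      also have "exp (- (pi / 2) * \<bar>Im s\<bar>) * exp (\<bar>Im (Ln z)\<bar> * \<bar>Im s\<bar>) = exp (- e * \<bar>Im s\<bar>)"
        unfolding exp_add[symmetric] by (simp add: e_def algebra_simps)
      finally show "norm (f s) \<le> (C * D * D * L) * (1 + \<bar>Im s\<bar>) ^ 5 * exp (- e * \<bar>Im s\<bar>)" .
    qed auto
    moreover have "(\<integral>t. f (Complex (3/2) t) \<partial>lborel) = divisor_series z"
      by (simp add: divisor_series_def inverse_mellin_def f_def)
    moreover have "(\<integral>t. f (Complex (1/2) t) \<partial>lborel) = crit_integral z"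
      unfolding crit_integral_def f_def Gamma_zeta_square_crit[OF refl] ..
    moreover have "residue f 1 = (deriv G 1 - Ln z) / z"
    proof -
      have "eventually (\<lambda>s. s \<in> S - {1}) (at 1)" using S by (rule eventually_at_in_open)
      hence "eventually (\<lambda>s. f s = G s * z powr (- s) / (s - 1) ^ Suc 1) (at 1)"
        by eventually_elim (auto simp: f_def G_def zeta_eq_zeta_regular S_def power2_eq_square)
      hence "residue f 1 = residue (\<lambda>s. G s * z powr (- s) / (s - 1) ^ Suc 1) 1"
        by (intro residue_cong) auto
      also have "\<dots> = (deriv ^^ 1) (\<lambda>s. G s * z powr (- s)) 1 / fact 1"
        using S z0 by (intro residue_holomorphic_over_power[of S] holomorphic_intros G_hol)
      also have "\<dots> = deriv (\<lambda>s. G s * z powr (- s)) 1" by simp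
      also have "\<dots> = (deriv G 1 - Ln z) / z"
      proof (rule DERIV_imp_deriv)
        have "(G has_field_derivative deriv G 1) (at 1)"
          by (rule holomorphic_derivI[OF G_hol S])
        moreover have "((\<lambda>s. z powr (- s)) has_field_derivative (z powr (- 1) * (- 1) * Ln z)) (at 1)"
          using DERIV_chain2[OF has_field_derivative_powr_right[OF z0, of "- 1"] DERIV_minus[OF DERIV_ident]]
          by (simp add: mult_ac)
        ultimately have "((\<lambda>s. G s * z powr (- s)) has_field_derivative
            deriv G 1 * z powr (- 1) + (z powr (- 1) * (- 1) * Ln z) * G 1) (at 1)"
          by (rule DERIV_mult)
        thus "((\<lambda>s. G s * z powr (- s)) has_field_derivative (deriv G 1 - Ln z) / z) (at 1)"
          using z0 by (simp add: G1 powr_minus field_simps)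
      qed
      finally show ?thesis .
    qed
    ultimately show ?thesis by (simp add: algebra_simps)
  qed
  thus ?thesis using that by blast
qed

section \<open>The Laplace transform of the squared zeta function\<close>

definition zeta_sq :: "real \<Rightarrow> real" where
  "zeta_sq t = (norm (zeta (Complex (1/2) t)))\<^sup>2"

lemma zeta_sq_nonneg: "zeta_sq t \<ge> 0"
  by (simp add: zeta_sq_def)

lemma zeta_sq_continuous: "continuous_on A zeta_sq"
proof -
  have "continuous_on UNIV zeta_sq"
    unfolding zeta_sq_def [abs_def] by (intro continuous_intros zeta_line_continuous) simp
  thus ?thesis by (rule continuous_on_subset) auto
qed

lemma zeta_sq_measurable [measurable]: "zeta_sq \<in> borel_measurable borel"
  by (intro borel_measurable_continuous_onI zeta_sq_continuous)

lemma zeta_sq_bound: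
  obtains C where "C > 0" "\<And>t. zeta_sq t \<le> C * (1 + \<bar>t\<bar>) ^ 4"
proof -
  obtain D where D: "D > 0"
    "\<And>s. 1/2 \<le> Re s \<Longrightarrow> Re s \<le> 3/2 \<Longrightarrow> norm (s - 1) \<ge> 1/2 \<Longrightarrow> norm (zeta s) \<le> D * (1 + \<bar>Im s\<bar>) ^ 2"
    using zeta_polynomial_bound by blast
  have "zeta_sq t \<le> D\<^sup>2 * (1 + \<bar>t\<bar>) ^ 4" for t
  proof -
    have "norm (zeta (Complex (1/2) t)) \<le> D * (1 + \<bar>t\<bar>) ^ 2"
      using D(2)[of "Complex (1/2) t"] abs_Re_le_cmod[of "Complex (1/2) t - 1"] by simp
    hence "zeta_sq t \<le> (D * (1 + \<bar>t\<bar>) ^ 2)\<^sup>2"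
      unfolding zeta_sq_def by (intro power_mono) auto
    thus ?thesis by (simp add: power_mult_distrib flip: power_mult)
  qed
  thus ?thesis using that[of "D\<^sup>2"] D(1) by simp
qed

lemma norm_crit_kernel_le:
  assumes "z \<noteq> 0"
  shows "norm (crit_kernel z t) \<le> sqrt (2 * pi) * norm z powr (-1/2) * exp (- (pi / 2 - \<bar>Im (Ln z)\<bar>) * \<bar>t\<bar>)"
proof -
  have 1: "norm ((2 * of_real pi) powr (Complex (1/2) t)) = sqrt (2 * pi)"
    by (subst norm_powr_real_powr) (auto simp: powr_half_sqrt)
  have "norm (z powr (- Complex (1/2) t)) = exp (- (1/2) * ln (norm z) + Im (Ln z) * t)"
    using assms by (simp add: powr_def mult.commute)
  also have "\<dots> = norm z powr (-1/2) * exp (Im (Ln z) * t)"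
    unfolding exp_add using assms by (simp add: powr_def)
  also have "\<dots> \<le> norm z powr (-1/2) * exp (\<bar>Im (Ln z)\<bar> * \<bar>t\<bar>)"
    using abs_ge_self[of "Im (Ln z) * t"] by (intro mult_left_mono) (auto simp: abs_mult)
  finally have 2: "norm (z powr (- Complex (1/2) t)) \<le> norm z powr (-1/2) * exp (\<bar>Im (Ln z)\<bar> * \<bar>t\<bar>)" .
  have 3: "norm (2 * cos (of_real pi * Complex (1/2) t / 2)) \<ge> exp (pi / 2 * \<bar>t\<bar>)"
    using norm_cos_crit_ge[of t] unfolding norm_mult by simp
  have "norm (crit_kernel z t) \<le> sqrt (2 * pi) * (norm z powr (-1/2) * exp (\<bar>Im (Ln z)\<bar> * \<bar>t\<bar>)) / exp (pi / 2 * \<bar>t\<bar>)"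
    unfolding crit_kernel_def norm_divide norm_mult[of "_ powr _"] 1
    using 2 3 by (intro frac_le mult_left_mono) auto
  also have "\<dots> = sqrt (2 * pi) * norm z powr (-1/2) * (exp (\<bar>Im (Ln z)\<bar> * \<bar>t\<bar>) * exp (- (pi / 2 * \<bar>t\<bar>)))"
    by (simp only: exp_minus divide_inverse mult_ac)
  also have "exp (\<bar>Im (Ln z)\<bar> * \<bar>t\<bar>) * exp (- (pi / 2 * \<bar>t\<bar>)) = exp (- (pi / 2 - \<bar>Im (Ln z)\<bar>) * \<bar>t\<bar>)"
    unfolding exp_add[symmetric] by (simp add: algebra_simps)
  finally show ?thesis .
qed

text \<open>The quotient is the cosine of the argument, that is, the sine of its distance to
  \<open>pi / 2\<close>. This converts the decay rate of the kernel into
  \<open>Re z / norm z\<close>.\<close>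

lemma Re_over_norm_le:
  assumes "Re z > 0"
  shows "Re z / norm z \<le> pi / 2 - \<bar>Im (Ln z)\<bar>"
proof -
  have z: "z \<noteq> 0" using assms by auto
  have "z = exp (Ln z)" using z by simp
  also have "exp (Ln z) = of_real (norm z) * cis (Im (Ln z))"
    using z by (simp add: exp_eq_polar)
  finally have "Re z = Re (of_real (norm z) * cis (Im (Ln z)))" by (rule arg_cong)
  also have "\<dots> = norm z * cos (Im (Ln z))" by simp
  finally have "Re z = norm z * cos (Im (Ln z))" .
  hence "Re z / norm z = cos \<bar>Im (Ln z)\<bar>" using z by simp
  also have "\<dots> = sin (pi / 2 - \<bar>Im (Ln z)\<bar>)" by (simp add: sin_diff)
  also have "\<dots> \<le> pi / 2 - \<bar>Im (Ln z)\<bar>"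
    using abs_Im_Ln_less[OF assms] by (intro sin_x_le_x) auto
  finally show ?thesis .
qed

text \<open>The exponent 5 is the degree 4 of the bound for \<open>zeta_sq\<close> plus 1 for the
  integration, each unit costing one factor \<open>norm z / Re z\<close>; the power -1/2 is the size
  of the kernel on the critical line.\<close>

lemma crit_integral_bound:
  obtains K where "K > 0"
    "\<And>z. Re z > 0 \<Longrightarrow> norm (crit_integral z) \<le> K * norm z powr (-1/2) * (norm z / Re z) ^ 5"
proof -
  obtain C where C: "C > 0" "\<And>t. zeta_sq t \<le> C * (1 + \<bar>t\<bar>) ^ 4" using zeta_sq_bound by blast
  define M :: real where "M = 4 * fact 4 * 2 ^ 4 * exp 1"
  have M: "M > 0" by (simp add: M_def)
  have "norm (crit_integral z) \<le> (C * sqrt (2 * pi) * M) * norm z powr (-1/2) * (norm z / Re z) ^ 5"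
    if z: "Re z > 0" for z
  proof -
    define e where "e = pi / 2 - \<bar>Im (Ln z)\<bar>"
    have e: "0 < e" "e \<le> 2" using abs_Im_Ln_less[OF z] pi_less_4 by (auto simp: e_def)
    have z0: "z \<noteq> 0" using z by auto
    define B where "B = C * (sqrt (2 * pi) * norm z powr (-1/2))"
    have B: "B \<ge> 0" unfolding B_def using C(1) by simp
    have "norm (crit_integral z) \<le> (\<integral>t. B * ((1 + \<bar>t\<bar>) ^ 4 * exp (- e * \<bar>t\<bar>)) \<partial>lborel)"
      unfolding crit_integral_def
    proof (rule norm_integral_le)
      fix t
      have "norm (of_real ((norm (zeta (Complex (1/2) t)))\<^sup>2) * crit_kernel z t) = zeta_sq t * norm (crit_kernel z t)"
        using zeta_sq_nonneg[of t] unfolding zeta_sq_def[symmetric] by (simp add: norm_mult)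
      also have "\<dots> \<le> (C * (1 + \<bar>t\<bar>) ^ 4) * (sqrt (2 * pi) * norm z powr (-1/2) * exp (- e * \<bar>t\<bar>))"
        unfolding e_def using C(1) by (intro mult_mono C(2) norm_crit_kernel_le z0) auto
      finally show "norm (of_real ((norm (zeta (Complex (1/2) t)))\<^sup>2) * crit_kernel z t) \<le>
          B * ((1 + \<bar>t\<bar>) ^ 4 * exp (- e * \<bar>t\<bar>))"
        by (simp add: B_def mult_ac)
    qed (intro integrable_mult_right integrable_power_exp_abs e)
    also have "\<dots> = B * (\<integral>t. (1 + \<bar>t\<bar>) ^ 4 * exp (- e * \<bar>t\<bar>) \<partial>lborel)"
      by (rule integral_mult_right_zero)
    also have "\<dots> \<le> B * (M / e ^ 5)"
      using integral_power_exp_abs_le[OF e, of 4] B by (intro mult_left_mono) (simp_all add: M_def)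
    also have "M / e ^ 5 \<le> M / (Re z / norm z) ^ 5"
      using z z0 M Re_over_norm_le[OF z] by (intro divide_left_mono power_mono mult_pos_pos) (auto simp: e_def[symmetric] e)
    hence "B * (M / e ^ 5) \<le> B * (M / (Re z / norm z) ^ 5)" by (rule mult_left_mono[OF _ B])
    also have "M / (Re z / norm z) ^ 5 = M * (norm z / Re z) ^ 5" by (simp add: power_divide)
    finally show ?thesis by (simp add: B_def mult_ac)
  qed
  moreover have "C * sqrt (2 * pi) * M > 0" using C(1) M by simp
  ultimately show ?thesis using that by blast
qed

definition laplace_zeta_sq :: "complex \<Rightarrow> complex" where
  "laplace_zeta_sq w = (\<integral>t. of_real (indicator {0..} t * zeta_sq t) * exp (- w * of_real t) \<partial>lborel)"

lemma integrable_laplace_zeta_sq: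
  assumes "Re w > 0"
  shows "integrable lborel (\<lambda>t. of_real (indicator {0..} t * zeta_sq t) * exp (- w * of_real t) :: complex)"
proof -
  obtain C where C: "C > 0" "\<And>t. zeta_sq t \<le> C * (1 + \<bar>t\<bar>) ^ 4" using zeta_sq_bound by blast
  show ?thesis
  proof (rule Bochner_Integration.integrable_bound)
    show "integrable lborel (\<lambda>t. C * ((1 + \<bar>t\<bar>) ^ 4 * exp (- Re w * \<bar>t\<bar>)))"
      by (intro integrable_mult_right integrable_power_exp_abs assms)
    show "AE t in lborel. norm (of_real (indicator {0..} t * zeta_sq t) * exp (- w * of_real t) :: complex)
        \<le> norm (C * ((1 + \<bar>t\<bar>) ^ 4 * exp (- Re w * \<bar>t\<bar>)))"
    proof (rule AE_I2)
      fix t :: real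
      show "norm (of_real (indicator {0..} t * zeta_sq t) * exp (- w * of_real t) :: complex)
        \<le> norm (C * ((1 + \<bar>t\<bar>) ^ 4 * exp (- Re w * \<bar>t\<bar>)))"
      proof (cases "t \<ge> 0")
        case True
        hence "norm (of_real (indicator {0..} t * zeta_sq t) * exp (- w * of_real t) :: complex) =
            zeta_sq t * exp (- Re w * \<bar>t\<bar>)"
          using zeta_sq_nonneg[of t] by (simp add: norm_mult)
        also have "\<dots> \<le> C * (1 + \<bar>t\<bar>) ^ 4 * exp (- Re w * \<bar>t\<bar>)"
          by (intro mult_right_mono C(2)) auto
        finally show ?thesis using C(1) by (simp add: abs_mult mult.assoc)
      qed simp
    qed
    have "(\<lambda>t. exp (- w * complex_of_real t)) \<in> borel_measurable borel"
      by (intro borel_measurable_continuous_onI continuous_intros)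
    thus "(\<lambda>t. of_real (indicator {0..} t * zeta_sq t) * exp (- w * of_real t) :: complex) \<in> borel_measurable lborel"
      by measurable
  qed
qed

text \<open>On the rotated argument the kernel is \<open>exp (\<i> d / 2 - d t) / (1 + \<i> exp (- \<pi> t))\<close>, which is
  \<open>exp (\<i> d / 2 - d t)\<close> up to an error of size \<open>exp (- \<bar>t\<bar>)\<close> for \<open>t \<ge> 0\<close>, and is itself of that
  size for \<open>t < 0\<close>.\<close>

lemma Ln_rotated:
  assumes "\<bar>Re d\<bar> \<le> 1"
  shows "Ln (2 * pi * \<i> * exp (- \<i> * d)) = of_real (ln (2 * pi)) + \<i> * (of_real (pi / 2) - d)"
proof (rule Ln_unique)
  have "exp (of_real (ln (2 * pi)) + \<i> * (of_real (pi / 2) - d)) =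
      exp (of_real (ln (2 * pi))) * (exp (\<i> * of_real (pi / 2)) * exp (- \<i> * d))"
    unfolding exp_add[symmetric] by (simp add: algebra_simps)
  also have "exp (of_real (ln (2 * pi))) = complex_of_real (2 * pi)"
    by (subst exp_of_real) simp
  also have "exp (\<i> * of_real (pi / 2)) = \<i>"
    by (simp add: exp_eq_polar complex_eq_iff)
  finally show "exp (of_real (ln (2 * pi)) + \<i> * (of_real (pi / 2) - d)) = 2 * pi * \<i> * exp (- \<i> * d)"
    by simp
qed (use assms pi_gt3 in auto)

lemma crit_kernel_rotated:
  assumes "\<bar>Re d\<bar> \<le> 1"
  shows "crit_kernel (2 * pi * \<i> * exp (- \<i> * d)) t =
     exp (\<i> * d / 2 - d * of_real t) / (1 + \<i> * of_real (exp (- pi * t)))"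
proof -
  define s where "s = Complex (1/2) t"
  define z where "z = 2 * pi * \<i> * exp (- \<i> * d)"
  have z0: "z \<noteq> 0" by (simp add: z_def)
  have "(2 * of_real pi) powr s = exp (s * of_real (ln (2 * pi)))"
    using Ln_of_real[of "2 * pi"] by (simp add: powr_def)
  moreover have "z powr (- s) = exp (- s * (of_real (ln (2 * pi)) + \<i> * (of_real (pi / 2) - d)))"
    using z0 Ln_rotated[OF assms] unfolding z_def[symmetric] powr_def by simp
  ultimately have num: "(2 * of_real pi) powr s * z powr (- s) = exp (- (\<i> * of_real pi * s / 2)) * exp (\<i> * d * s)"
    unfolding exp_add[symmetric] by (simp add: algebra_simps flip: exp_add)
  have den: "2 * cos (of_real pi * s / 2) = exp (- (\<i> * of_real pi * s / 2)) * (1 + exp (\<i> * of_real pi * s))"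
    unfolding cos_exp_eq distrib_left exp_add[symmetric] by (simp add: algebra_simps)
  have "\<i> * of_real pi * s = \<i> * of_real (pi / 2) + of_real (- pi * t)"
    by (simp add: s_def complex_eq_iff)
  hence "exp (\<i> * of_real pi * s) = exp (\<i> * of_real (pi / 2)) * of_real (exp (- pi * t))"
    by (simp only: exp_add exp_of_real)
  also have "exp (\<i> * of_real (pi / 2)) = \<i>"
    by (simp add: exp_eq_polar complex_eq_iff)
  finally have e: "exp (\<i> * of_real pi * s) = \<i> * of_real (exp (- pi * t))" .
  have "\<i> * d * s = \<i> * d / 2 - d * of_real t"
    by (simp add: s_def complex_eq_iff algebra_simps)
  thus ?thesis
    unfolding crit_kernel_def s_def[symmetric] z_def[symmetric] num den e by simp
qed

lemma crit_integral_rotated: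
  obtains C where "\<And>d. 0 < Re d \<Longrightarrow> Re d \<le> 1 \<Longrightarrow> \<bar>Im d\<bar> \<le> 1 \<Longrightarrow>
    norm (crit_integral (2 * pi * \<i> * exp (- \<i> * d)) - exp (\<i> * d / 2) * laplace_zeta_sq d) \<le> C"
proof -
  obtain C where C: "C > 0" "\<And>t. zeta_sq t \<le> C * (1 + \<bar>t\<bar>) ^ 4" using zeta_sq_bound by blast
  have "norm (crit_integral (2 * pi * \<i> * exp (- \<i> * d)) - exp (\<i> * d / 2) * laplace_zeta_sq d) \<le>
      (\<integral>t. 2 * C * ((1 + \<bar>t\<bar>) ^ 4 * exp (- 1 * \<bar>t\<bar>)) \<partial>lborel)"
    if d: "0 < Re d" "Re d \<le> 1" "\<bar>Im d\<bar> \<le> 1" for d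
  proof -
    define z where "z = 2 * pi * \<i> * exp (- \<i> * d)"
    define L where "L = (\<lambda>t. exp (\<i> * d / 2) * (of_real (indicator {0..} t * zeta_sq t) * exp (- d * of_real t)))"
    define F where "F = (\<lambda>t. of_real (zeta_sq t) * crit_kernel z t)"
    have L_int: "integrable lborel L"
      unfolding L_def by (intro integrable_mult_right integrable_laplace_zeta_sq d)
    have diff: "norm (F t - L t) \<le> 2 * C * ((1 + \<bar>t\<bar>) ^ 4 * exp (- 1 * \<bar>t\<bar>))" for t
    proof -
      define E where "E = exp (\<i> * d / 2 - d * of_real t)"
      define x where "x = exp (- pi * t)"
      have x: "x > 0" by (simp add: x_def)
      have "exp (- Im d / 2) \<le> exp (1/2)" using d by simp
      also have "exp (1/2 :: real) \<le> 2" using exp_bound_half[of "1/2 :: real"] by simp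
      finally have "exp (- Im d / 2) \<le> 2" .
      hence E: "norm E \<le> 2 * exp (- Re d * t)"
      proof -
        have "norm E = exp (- Im d / 2) * exp (- Re d * t)"
          unfolding E_def norm_exp_eq_Re exp_add[symmetric] by simp
        thus ?thesis using \<open>exp (- Im d / 2) \<le> 2\<close> by simp
      qed
      have den: "norm (1 + \<i> * of_real x) \<ge> 1" "norm (1 + \<i> * of_real x) \<ge> x"
        using abs_Re_le_cmod[of "1 + \<i> * of_real x"] abs_Im_le_cmod[of "1 + \<i> * of_real x"] x by auto
      hence den0: "1 + \<i> * of_real x \<noteq> 0" by auto
      have k: "norm (crit_kernel z t - indicator {0..} t * E) \<le> 2 * exp (- \<bar>t\<bar>)"
      proof (cases "t \<ge> 0")
        case True
        have "crit_kernel z t - indicator {0..} t * E = - (E * (\<i> * of_real x) / (1 + \<i> * of_real x))"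
          using d True den0 unfolding z_def E_def x_def by (subst crit_kernel_rotated) (auto simp: divide_simps algebra_simps)
        also have "norm \<dots> = norm E * x / norm (1 + \<i> * of_real x)"
          using x by (simp add: norm_mult norm_divide)
        also have "\<dots> \<le> (2 * exp (- Re d * t)) * x / 1"
          using E den x by (intro frac_le mult_right_mono mult_nonneg_nonneg) auto
        also have "\<dots> = 2 * exp (- (Re d + pi) * t)"
          by (simp add: x_def algebra_simps flip: exp_add)
        also have "\<dots> \<le> 2 * exp (- 1 * t)"
          using d pi_gt3 True by (intro mult_left_mono exp_le_cancel_iff[THEN iffD2] mult_right_mono) auto
        finally show ?thesis using True by simp
      next
        case False
        have "crit_kernel z t - indicator {0..} t * E = E / (1 + \<i> * of_real x)"
          using d False unfolding z_def E_def x_def by (subst crit_kernel_rotated) auto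
        also have "norm \<dots> \<le> 2 * exp (- Re d * t) / x"
          unfolding norm_divide using E den x by (intro frac_le) auto
        also have "\<dots> = 2 * exp ((pi - Re d) * t)"
          unfolding x_def times_divide_eq_right[symmetric] exp_diff[symmetric] by (simp add: algebra_simps)
        also have "\<dots> \<le> 2 * exp (1 * t)"
          using d pi_gt3 False by (intro mult_left_mono exp_le_cancel_iff[THEN iffD2] mult_right_mono_neg) auto
        finally show ?thesis using False by simp
      qed
      have "exp (\<i> * d / 2) * exp (- d * of_real t) = E"
        unfolding E_def exp_add[symmetric] by simp
      hence "F t - L t = of_real (zeta_sq t) * (crit_kernel z t - indicator {0..} t * E)"
        by (simp add: F_def L_def algebra_simps indicator_def)
      also have "norm \<dots> \<le> (C * (1 + \<bar>t\<bar>) ^ 4) * (2 * exp (- \<bar>t\<bar>))"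
        unfolding norm_mult using k C zeta_sq_nonneg[of t] by (intro mult_mono) auto
      finally show ?thesis by (simp add: mult_ac)
    qed
    have int: "integrable lborel (\<lambda>t. 2 * C * ((1 + \<bar>t\<bar>) ^ 4 * exp (- 1 * \<bar>t\<bar>)))"
      by (intro integrable_mult_right integrable_power_exp_abs) simp
    have meas: "crit_kernel z \<in> borel_measurable borel"
    proof -
      have "crit_kernel z = (\<lambda>t. exp (\<i> * d / 2 - d * of_real t) / (1 + \<i> * of_real (exp (- pi * t))))"
        unfolding z_def using d by (intro ext crit_kernel_rotated) auto
      thus ?thesis by simp
    qed
    have F_int: "integrable lborel (\<lambda>t. F t - L t)"
    proof (rule Bochner_Integration.integrable_bound[OF int])
      show "(\<lambda>t. F t - L t) \<in> borel_measurable lborel"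
        using meas L_int unfolding F_def by simp
      show "AE t in lborel. norm (F t - L t) \<le> norm (2 * C * ((1 + \<bar>t\<bar>) ^ 4 * exp (- 1 * \<bar>t\<bar>)))"
        by (intro AE_I2 order.trans[OF diff]) auto
    qed
    have "crit_integral z - exp (\<i> * d / 2) * laplace_zeta_sq d = (\<integral>t. F t \<partial>lborel) - (\<integral>t. L t \<partial>lborel)"
      by (simp add: crit_integral_def F_def L_def laplace_zeta_sq_def zeta_sq_def)
    also have "\<dots> = (\<integral>t. F t - L t \<partial>lborel)"
      using Bochner_Integration.integrable_add[OF F_int L_int] L_int by simp
    also have "norm \<dots> \<le> (\<integral>t. 2 * C * ((1 + \<bar>t\<bar>) ^ 4 * exp (- 1 * \<bar>t\<bar>)) \<partial>lborel)"
      by (rule norm_integral_le[OF int diff])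
    finally show ?thesis unfolding z_def .
  qed
  thus ?thesis using that by blast
qed

section \<open>The Laplace transform near the origin\<close>

lemma sin_ge_half:
  fixes a :: real
  assumes "0 \<le> a" "a \<le> 1"
  shows "a / 2 \<le> sin a"
proof -
  have "sin 0 - 0 / 2 \<le> sin a - a / 2"
  proof (rule DERIV_nonneg_imp_nondecreasing[OF assms(1)])
    fix x :: real assume x: "0 \<le> x" "x \<le> a"
    have "cos (pi / 3) \<le> cos x"
      using x assms pi_gt3 by (intro cos_monotone_0_pi_le) auto
    hence "cos x - 1 / 2 \<ge> 0" by (simp add: cos_60)
    moreover have "((\<lambda>x. sin x - x / 2) has_real_derivative (cos x - 1 / 2)) (at x)"
      by (auto intro!: derivative_eq_intros)
    ultimately show "\<exists>y. ((\<lambda>x. sin x - x / 2) has_real_derivative y) (at x) \<and> 0 \<le> y" by blast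
  qed
  thus ?thesis by simp
qed

lemma abs_ln_le_powr:
  fixes x :: real
  assumes "0 < x" "x \<le> 1"
  shows "\<bar>ln x\<bar> \<le> 2 * x powr (-1/2)"
proof -
  have "ln (x powr (-1/2)) \<le> x powr (-1/2) - 1"
    using assms by (intro ln_le_minus_one) auto
  hence "- ln x / 2 \<le> x powr (-1/2)" using assms by (simp add: ln_powr)
  thus ?thesis using assms by simp
qed

text \<open>Both estimates of \<open>crit_integral\<close> are linked by the periodicity of the divisor series,
  which sends \<open>2 \<pi> \<i> exp (- \<i> d)\<close> to a point close to \<open>2 \<pi> d\<close>.\<close>

theorem laplace_zeta_sq_asymp:
  obtains C :: real and c :: complex where "C > 0"
    "\<And>d. Re d > 0 \<Longrightarrow> norm d \<le> 1/8 \<Longrightarrow>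
       norm (laplace_zeta_sq d - (c - Ln d) / d) \<le> C * norm d powr (-1/2) * (norm d / Re d) ^ 5"
proof -
  obtain K where K: "K > 0"
    "\<And>z. Re z > 0 \<Longrightarrow> norm (crit_integral z) \<le> K * norm z powr (-1/2) * (norm z / Re z) ^ 5"
    using crit_integral_bound by blast
  obtain C1 where C1: "\<And>d. 0 < Re d \<Longrightarrow> Re d \<le> 1 \<Longrightarrow> \<bar>Im d\<bar> \<le> 1 \<Longrightarrow>
    norm (crit_integral (2 * pi * \<i> * exp (- \<i> * d)) - exp (\<i> * d / 2) * laplace_zeta_sq d) \<le> C1"
    using crit_integral_rotated by blast
  obtain c where c: "\<And>z. Re z > 0 \<Longrightarrow> divisor_series z = crit_integral z + 2 * pi * (c - Ln z) / z"
    using divisor_series_eq_crit_integral by blast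
  \<comment> \<open>The shift comes from \<open>Ln w = ln (2 * pi) + Ln d + Ln q\<close>
    below.\<close>
  define c' where "c' = c - of_real (ln (2 * pi))"
  define C2 where "C2 = 2 * pi * (norm c + (ln (2 * pi) + 3))"
  have C1_nonneg: "C1 \<ge> 0" by (rule order.trans[OF norm_ge_zero C1[of "1/2"]]) auto
  have ln2pi: "ln (2 * pi) \<ge> 0" using pi_gt3 by (intro ln_ge_zero) auto
  have C2_nonneg: "C2 \<ge> 0" unfolding C2_def using ln2pi by (intro mult_nonneg_nonneg add_nonneg_nonneg) auto
  define C where "C = 2 * (C1 + K * 10 ^ 5 + C2) + (4 * (norm c' + 6) + 8)"
  have C_pos: "C > 0" unfolding C_def using C1_nonneg C2_nonneg K(1)
    by (intro add_nonneg_pos mult_nonneg_nonneg add_nonneg_nonneg) (auto intro!: add_nonneg_pos)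
  have "norm (laplace_zeta_sq d - (c' - Ln d) / d) \<le> C * norm d powr (-1/2) * (norm d / Re d) ^ 5"
    if d: "Re d > 0" "norm d \<le> 1/8" for d
  proof -
    have d0: "d \<noteq> 0" using d by auto
    have Red: "Re d \<le> 1/8" "\<bar>Im d\<bar> \<le> 1/8" using abs_Re_le_cmod[of d] abs_Im_le_cmod[of d] d by auto
    define z where "z = 2 * pi * \<i> * exp (- \<i> * d)"
    define w where "w = z - 2 * pi * \<i>"
    \<comment> \<open>The translate \<open>w\<close> of \<open>z\<close> by one period is
      \<open>2 * pi * d\<close> up to this factor. \<open>q - 1\<close> is a second-order Taylor
      remainder of the exponential divided by \<open>d\<close>, hence O(d).\<close>
    define q where "q = w / (2 * pi * d)"
    have w_eq: "w = 2 * pi * d * q" using d0 by (simp add: q_def)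
    have q_eq: "q - 1 = \<i> * (exp (- \<i> * d) - 1 - (- \<i> * d)) / d"
      using d0 by (simp add: q_def w_def z_def field_simps)
    have "norm (exp (- \<i> * d) - (\<Sum>k\<le>1. (- \<i> * d) ^ k / fact k)) \<le>
        exp \<bar>Re (- \<i> * d)\<bar> * norm (- \<i> * d) ^ Suc 1 / fact 1"
      by (rule Taylor_exp)
    also have "\<dots> \<le> 2 * norm d ^ 2"
    proof -
      have "exp \<bar>Im d\<bar> \<le> exp (1/2)" using Red by simp
      also have "\<dots> \<le> 2" using exp_bound_half[of "1/2 :: real"] by simp
      finally show ?thesis by (simp add: norm_mult power2_eq_square mult_right_mono)
    qed
    finally have "norm (exp (- \<i> * d) - 1 - (- \<i> * d)) \<le> 2 * norm d ^ 2"
      by (simp add: atMost_Suc algebra_simps)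
    hence q1: "norm (q - 1) \<le> 2 * norm d"
      unfolding q_eq norm_divide norm_mult using d0 by (simp add: field_simps power2_eq_square)
    have q_norm: "norm q \<ge> 3/4" "norm q \<le> 5/4"
      using norm_triangle_ineq2[of 1 "1 - q"] norm_triangle_ineq[of "q - 1" 1] q1 d by (auto simp: norm_minus_commute)
    have q0: "q \<noteq> 0" using q_norm by auto
    have Lnq: "norm (Ln q) \<le> 4 * norm d"
      using norm_Ln_le[of "q - 1"] q1 d by simp
    have w_norm: "norm w \<ge> norm d" "norm w \<le> 10 * norm d"
    proof -
      have nw: "norm w = 2 * pi * norm q * norm d" by (simp add: w_eq norm_mult)
      have "1 \<le> 2 * pi * norm q" using q_norm pi_gt3 mult_mono[of 6 "2 * pi" "3/4" "norm q"] by simp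
      thus "norm w \<ge> norm d" unfolding nw using mult_right_mono[of 1 _ "norm d"] by simp
      have "2 * pi * norm q \<le> 8 * (5/4)" using q_norm pi_less_4 by (intro mult_mono) auto
      thus "norm w \<le> 10 * norm d" unfolding nw using mult_right_mono[of _ 10 "norm d"] by simp
    qed
    \<comment> \<open>\<open>z\<close> and \<open>w\<close> have the same real part, so this single
      estimate puts both into the right half-plane and also bounds the loss
      \<open>norm w / Re w\<close>.\<close>
    have Rez: "Re z \<ge> Re d"
    proof -
      have "Re z = 2 * pi * (exp (Im d) * sin (Re d))"
        by (simp add: z_def Re_exp Im_exp)
      moreover have "exp (Im d) \<ge> 1/2" using exp_ge_add_one_self[of "Im d"] Red by linarith
      hence *: "1/2 * (Re d / 2) \<le> exp (Im d) * sin (Re d)"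
        using sin_ge_half[of "Re d"] d Red by (intro mult_mono) auto
      have "(2 * 3) * (1/2 * (Re d / 2)) \<le> 2 * pi * (exp (Im d) * sin (Re d))"
        by (rule mult_mono[OF _ *]) (use pi_gt3 d in auto)
      ultimately show ?thesis using d by simp
    qed
    hence Rew: "Re w \<ge> Re d" by (simp add: w_def)
    define P where "P = norm d powr (-1/2) * (norm d / Re d) ^ 5"
    have ratio: "norm d / Re d \<ge> 1" using d complex_Re_le_cmod[of d] by simp
    have dpow: "norm d powr (-1/2) \<ge> 1"
    proof -
      have "norm d powr (-1/2) \<ge> 1 powr (-1/2)"
        using d d0 by (intro powr_mono2') auto
      thus ?thesis by simp
    qed
    have P_ge: "P \<ge> norm d powr (-1/2)"
      using mult_left_mono[OF one_le_power[OF ratio, of 5], of "norm d powr (-1/2)"] by (simp add: P_def)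
    hence P1: "P \<ge> 1" using dpow by linarith
    have crit_w: "norm (crit_integral w) \<le> K * 10 ^ 5 * P"
    proof -
      have "norm (crit_integral w) \<le> K * norm w powr (-1/2) * (norm w / Re w) ^ 5"
        using K(2)[of w] Rew d by simp
      also have "\<dots> \<le> K * norm d powr (-1/2) * (10 * (norm d / Re d)) ^ 5"
      proof (intro mult_mono power_mono)
        show "norm w powr (-1/2) \<le> norm d powr (-1/2)" using w_norm d0 by (intro powr_mono2') auto
        have "norm w / Re w \<le> (10 * norm d) / Re d"
          using w_norm Rew d by (intro frac_le) auto
        thus "norm w / Re w \<le> 10 * (norm d / Re d)" by simp
      qed (use K(1) Rew d in auto)
      also have "\<dots> = K * 10 ^ 5 * P" unfolding P_def power_mult_distrib by (simp only: mult_ac)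
      finally show ?thesis .
    qed
    \<comment> \<open>At \<open>z\<close> the polar term is harmless, since \<open>z\<close> stays
      away from 0.\<close>
    have z_part: "norm (2 * pi * (c - Ln z) / z) \<le> C2"
    proof -
      have "exp (- Im d) \<le> exp (1/2)" using Red by simp
      also have "\<dots> \<le> 2" using exp_bound_half[of "1/2 :: real"] by simp
      finally have "exp (- Im d) \<le> 2" .
      hence "exp (Im d) \<ge> 1/2" using exp_ge_add_one_self[of "Im d"] Red by linarith
      hence "norm z \<ge> 1" using pi_gt3 mult_mono[of 6 "2 * pi" "1/2" "exp (Im d)"]
        by (simp add: z_def norm_mult)
      have "norm (Ln z) \<le> ln (2 * pi) + (pi / 2 + norm d)"
        using Ln_rotated[of d] Red d ln2pi unfolding z_def
        by (auto intro!: norm_triangle_le norm_triangle_le_diff add_mono simp: norm_mult)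
      also have "\<dots> \<le> ln (2 * pi) + 3" using d pi_less_4 by simp
      finally have "norm (c - Ln z) \<le> norm c + (ln (2 * pi) + 3)"
        by (intro norm_triangle_le_diff add_mono) auto
      hence "norm (2 * pi * (c - Ln z)) \<le> C2"
        unfolding C2_def norm_mult by (intro mult_mono) auto
      thus ?thesis using \<open>norm z \<ge> 1\<close> C2_nonneg
        using frac_le[of C2 "norm (2 * pi * (c - Ln z))" 1 "norm z"] by (simp add: norm_divide)
    qed
    have "divisor_series z = divisor_series w"
      using divisor_series_periodic[of w] Rew d by (simp add: w_def)
    hence eq: "crit_integral z = crit_integral w + 2 * pi * (c - Ln w) / w - 2 * pi * (c - Ln z) / z"
      using c[of z] c[of w] Rew Rez d unfolding eq_diff_eq by simp
    define E where "E = exp (- \<i> * d / 2)"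
    have E: "norm E \<le> 2" "norm (E - 1) \<le> norm d"
    proof -
      have n: "norm (- \<i> * d / 2) = norm d / 2" by (simp add: norm_mult norm_divide)
      show "norm E \<le> 2" unfolding E_def using d n by (intro exp_bound_half) simp
      have "norm (E - 1) \<le> 3/2 * norm (- \<i> * d / 2)"
        unfolding E_def using d n by (intro norm_exp_bounds) simp
      also have "\<dots> \<le> norm d" unfolding n by simp
      finally show "norm (E - 1) \<le> norm d" .
    qed
    define X where "X = c' - Ln d"
    \<comment> \<open>The logarithms add up without a jump because the arguments of \<open>d\<close>
      and \<open>q\<close> are below \<open>pi / 2\<close> and 1/2.\<close>
    have Lnw: "Ln w = of_real (ln (2 * pi)) + (Ln d + Ln q)"
    proof -
      have "\<bar>Im (Ln q)\<bar> \<le> 1/2" using abs_Im_le_cmod[of "Ln q"] Lnq d by linarith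
      hence "Ln (d * q) = Ln d + Ln q"
        using d0 q0 abs_Im_Ln_less[OF d(1)] pi_gt3 by (intro Ln_times_simple) auto
      moreover have "Ln w = of_real (ln (2 * pi)) + Ln (d * q)"
      proof -
        have "w = of_real (2 * pi) * (d * q)" by (simp add: w_eq)
        moreover have "Ln (of_real (2 * pi) * (d * q)) = Ln (of_real (2 * pi)) + Ln (d * q)"
          using Ln_times_of_real[of "2 * pi" "d * q"] d0 q0 by simp
        moreover have "Ln (complex_of_real (2 * pi)) = of_real (ln (2 * pi))"
          by (rule Ln_of_real) simp
        ultimately show ?thesis by (simp only:)
      qed
      ultimately show ?thesis by simp
    qed
    have X_norm: "norm X \<le> (norm c' + 6) * norm d powr (-1/2)"
    proof -
      have "norm (Ln d) \<le> \<bar>Re (Ln d)\<bar> + \<bar>Im (Ln d)\<bar>" by (rule cmod_le)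
      also have "\<dots> \<le> 2 * norm d powr (-1/2) + 4"
        using abs_ln_le_powr[of "norm d"] abs_Im_Ln_less[OF d(1)] d d0 pi_less_4 by simp
      also have "\<dots> \<le> 6 * norm d powr (-1/2)" using dpow by simp
      finally have "norm X \<le> norm c' * 1 + 6 * norm d powr (-1/2)"
        unfolding X_def by (intro norm_triangle_le_diff) simp
      also have "\<dots> \<le> norm c' * norm d powr (-1/2) + 6 * norm d powr (-1/2)"
        using dpow by (intro add_mono mult_left_mono) auto
      finally show ?thesis by (simp add: algebra_simps)
    qed
    have main: "norm (E * (2 * pi * (c - Ln w) / w) - X / d) \<le> (4 * (norm c' + 6) + 8) * norm d powr (-1/2)"
    proof -
      \<comment> \<open>\<open>A\<close> collects the phase \<open>E\<close> and the correction
        \<open>q\<close>, both within O(d) of 1. The polar term at \<open>w\<close> thus changes by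
        O(d) relative to \<open>X / d\<close>, which is O(\<open>norm X\<close>) after
        division.\<close>
      define A where "A = E / q"
      have "A - 1 = ((E - 1) - (q - 1)) / q" using q0 by (simp add: A_def field_simps)
      hence "norm (A - 1) = norm ((E - 1) - (q - 1)) / norm q" by (simp only: norm_divide)
      also have "\<dots> \<le> (norm d + 2 * norm d) / (3/4)"
        using norm_triangle_ineq4[of "E - 1" "q - 1"] E(2) q1 q_norm by (intro frac_le) auto
      finally have "norm (A - 1) \<le> (norm d + 2 * norm d) / (3/4)" .
      hence A1: "norm (A - 1) \<le> 4 * norm d" by simp
      have A: "norm A \<le> 2" using norm_triangle_ineq[of "A - 1" 1] A1 d by simp
      have "E * (2 * pi * (c - Ln w) / w) - X / d = ((A - 1) * X - A * Ln q) / d"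
      proof -
        have "c - Ln w = X - Ln q" by (simp add: Lnw X_def c'_def)
        thus ?thesis using d0 q0 by (simp only:) (simp add: w_eq A_def field_simps)
      qed
      also have "norm \<dots> \<le> ((4 * norm d) * norm X + 2 * (4 * norm d)) / norm d"
      proof -
        have "norm ((A - 1) * X) \<le> (4 * norm d) * norm X" "norm (A * Ln q) \<le> 2 * (4 * norm d)"
          unfolding norm_mult using A A1 Lnq by (intro mult_mono; simp)+
        thus ?thesis
          unfolding norm_divide by (intro divide_right_mono norm_triangle_le_diff add_mono) auto
      qed
      also have "\<dots> = 4 * norm X + 8" using d0 by (simp add: field_simps)
      also have "\<dots> \<le> 4 * ((norm c' + 6) * norm d powr (-1/2)) + 8 * norm d powr (-1/2)"
        using X_norm dpow by simp
      finally show ?thesis by (simp add: algebra_simps)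
    qed
    define R where "R = crit_integral z - exp (\<i> * d / 2) * laplace_zeta_sq d"
    have R: "norm R \<le> C1" unfolding R_def z_def using d Red by (intro C1) auto
    have "E * exp (\<i> * d / 2) = 1"
      unfolding E_def exp_add[symmetric] by simp
    hence "laplace_zeta_sq d = E * (crit_integral z - R)"
      unfolding R_def by (simp add: algebra_simps flip: mult.assoc)
    hence "laplace_zeta_sq d - X / d =
        E * (crit_integral w - 2 * pi * (c - Ln z) / z - R) + (E * (2 * pi * (c - Ln w) / w) - X / d)"
      unfolding eq by (simp add: algebra_simps)
    also have "norm \<dots> \<le> 2 * (K * 10 ^ 5 * P + C2 + C1) + (4 * (norm c' + 6) + 8) * norm d powr (-1/2)"
    proof (intro norm_triangle_le add_mono main)
      have "norm (crit_integral w - 2 * pi * (c - Ln z) / z - R) \<le> K * 10 ^ 5 * P + C2 + C1"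
        by (intro norm_triangle_le_diff add_mono crit_w z_part R)
      thus "norm (E * (crit_integral w - 2 * pi * (c - Ln z) / z - R)) \<le> 2 * (K * 10 ^ 5 * P + C2 + C1)"
        unfolding norm_mult[of E] using E(1) by (intro mult_mono) auto
    qed
    also have "\<dots> \<le> 2 * (K * 10 ^ 5 * P + C2 * P + C1 * P) + (4 * (norm c' + 6) + 8) * P"
      using K(1) P1 P_ge C1_nonneg C2_nonneg mult_left_mono[OF P1 C1_nonneg] mult_left_mono[OF P1 C2_nonneg]
      by (intro add_mono mult_left_mono) auto
    also have "\<dots> = C * P" by (simp add: C_def algebra_simps)
    finally show ?thesis unfolding X_def P_def by (simp add: mult.assoc)
  qed
  thus ?thesis using that C_pos by blast
qed

section \<open>The mean square of the zeta function\<close>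

lemma power_series_coeff_bound:
  fixes a :: "nat \<Rightarrow> complex"
  assumes sums: "\<And>x. norm x < 1 \<Longrightarrow> (\<lambda>n. a n * x ^ n) sums f x"
    and r: "0 < r" "r < 1" and bound: "\<And>x. norm x = r \<Longrightarrow> norm (f x) \<le> B"
  shows "norm (a n) \<le> B / r ^ n"
proof -
  have hol: "f holomorphic_on ball 0 1"
    using sums by (intro power_series_holomorphic[where a = a]) auto
  have "f has_fps_expansion Abs_fps a"
  proof (rule has_fps_expansionI)
    have "eventually (\<lambda>x. x \<in> ball (0::complex) 1) (nhds 0)"
      by (rule eventually_nhds_in_open) auto
    thus "eventually (\<lambda>x. (\<lambda>n. fps_nth (Abs_fps a) n * x ^ n) sums f x) (nhds 0)"
      by eventually_elim (use sums in auto)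
  qed
  hence "a n = (deriv ^^ n) f 0 / fact n"
    using fps_nth_fps_expansion[of f "Abs_fps a" n] by simp
  moreover have "norm ((deriv ^^ n) f 0) \<le> fact n * B / r ^ n"
  proof (rule Cauchy_inequality)
    show "f holomorphic_on ball 0 r" "continuous_on (cball 0 r) f"
      using r by (auto intro!: holomorphic_on_subset[OF hol] holomorphic_on_imp_continuous_on)
  qed (use r bound in auto)
  hence "norm ((deriv ^^ n) f 0) / fact n \<le> (fact n * B / r ^ n) / fact n"
    by (intro divide_right_mono) auto
  ultimately show ?thesis by (simp add: norm_divide)
qed

text \<open>Cauchy product of the geometric series with the series of
  \<open>- Ln (1 - x)\<close>.\<close>

lemma harm_sums:
  fixes x :: complex
  assumes x: "norm x < 1"
  shows "(\<lambda>n. harm n * x ^ n) sums (- Ln (1 - x) / (1 - x))"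
proof -
  define b where "b = (\<lambda>n. if n = 0 then 0 else x ^ n / of_nat n)"
  \<comment> \<open>Division by 0 gives 0, so the quotient already has the vanishing constant term
    of the logarithm.\<close>
  have b_eq: "b = (\<lambda>n. x ^ n / of_nat n)" by (auto simp: b_def)
  have "(\<lambda>n. - (- ((- (- x)) ^ n) / of_nat n)) sums (- ln (1 + (- x)))"
    by (intro sums_minus Ln_series') (use x in simp)
  hence bs: "b sums (- Ln (1 - x))" by (simp add: b_eq)
  have as: "(\<lambda>n. x ^ n) sums (1 / (1 - x))" by (rule geometric_sums[OF x])
  have sa: "summable (\<lambda>n. norm (x ^ n))" using x by (simp add: norm_power summable_geometric)
  have sb: "summable (\<lambda>n. norm (b n))"
  proof (rule summable_comparison_test[OF _ sa])
    have "norm (norm (b n)) \<le> norm (x ^ n)" for n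
    proof (cases "n = 0")
      case False
      hence "norm (x ^ n) / real n \<le> norm (x ^ n) / 1" by (intro divide_left_mono) auto
      thus ?thesis by (simp add: b_eq norm_divide)
    qed (simp add: b_def)
    thus "\<exists>N. \<forall>n\<ge>N. norm (norm (b n)) \<le> norm (x ^ n)" by blast
  qed
  have "(\<lambda>k. \<Sum>i\<le>k. b i * x ^ (k - i)) sums ((\<Sum>k. b k) * (\<Sum>k. x ^ k))"
    by (rule Cauchy_product_sums[OF sb sa])
  moreover have "(\<Sum>i\<le>k. b i * x ^ (k - i)) = harm k * x ^ k" for k
  proof -
    have "(\<Sum>i\<le>k. b i * x ^ (k - i)) = (\<Sum>i\<in>{1..k}. b i * x ^ (k - i))"
      by (rule sum.mono_neutral_right) (auto simp: b_def not_le)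
    also have "\<dots> = (\<Sum>i\<in>{1..k}. inverse (of_nat i) * x ^ k)"
      by (intro sum.cong) (auto simp: b_def divide_inverse simp flip: power_add)
    finally show ?thesis by (simp add: harm_def sum_distrib_right)
  qed
  ultimately show ?thesis using as bs by (simp add: sums_iff)
qed

text \<open>The discrete analogue of integrating the logarithm; it is the source of the -1 in
  \<open>\<kappa> + euler_mascheroni - 1\<close>.\<close>

lemma sum_harm: "(\<Sum>j\<le>k. harm j) = (real k + 1) * (harm (Suc k) - 1 :: real)"
proof (induction k)
  case 0
  show ?case by (simp add: harm_expand)
next
  case (Suc k)
  have "harm (Suc (Suc k)) = harm (Suc k) + 1 / (real k + 2)"
    by (subst harm_Suc) (simp add: inverse_eq_divide add_ac)
  thus ?case using Suc by (simp add: field_simps)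
qed

lemma harm_minus_ln_bound:
  assumes "k \<ge> 1"
  shows "\<bar>harm (Suc k) - ln (real (Suc k)) - euler_mascheroni\<bar> \<le> 1 / real (Suc k)"
proof -
  define u where "u = harm k - ln (real (Suc k))"
  have "euler_mascheroni \<in> {u + inverse (real (2 * (k + 1)))..u + inverse (real (2 * k))}"
    unfolding u_def using euler_mascheroni_bounds[OF assms] by simp
  hence 1: "euler_mascheroni - u \<ge> 0" "euler_mascheroni - u \<le> inverse (real (2 * k))"
    by (auto intro: order.trans[rotated])
  have 2: "inverse (real (2 * k)) \<le> 1 / real (Suc k)"
    using assms by (simp add: inverse_eq_divide field_simps)
  have "harm (Suc k) - ln (real (Suc k)) - euler_mascheroni = 1 / real (Suc k) - (euler_mascheroni - u)"
    by (simp add: u_def harm_Suc inverse_eq_divide)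
  thus ?thesis using 1 2 by linarith
qed

section \<open>Poisson moments of the squared zeta function\<close>

lemma integrable_zeta_sq_exp:
  fixes r :: real
  assumes "r > 0"
  shows "integrable lborel (\<lambda>t. indicator {0..} t * zeta_sq t * exp (- r * t))"
proof -
  have "integrable lborel (\<lambda>t. Re (of_real (indicator {0..} t * zeta_sq t) * exp (- of_real r * of_real t)))"
    using integrable_laplace_zeta_sq[of "of_real r"] assms by (intro integrable_Re) simp
  thus ?thesis by (simp add: exp_of_real flip: of_real_mult of_real_minus)
qed

text \<open>\<open>poisson_moment d j\<close> is the \<open>j\<close>-th Taylor coefficient of
  \<open>x \<mapsto> laplace_zeta_sq (d (1 - x))\<close>, and the sum of the first \<open>k + 1\<close> of them integrates
  \<open>zeta_sq\<close> against the smoothed indicator \<open>P (Poisson (d t) \<le> k)\<close> of \<open>[0, k / d]\<close>.\<close>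

definition poisson_weight :: "real \<Rightarrow> nat \<Rightarrow> real \<Rightarrow> real" where
  "poisson_weight d j t = exp (- d * t) * (d * t) ^ j / fact j"

definition poisson_moment :: "real \<Rightarrow> nat \<Rightarrow> real" where
  "poisson_moment d j = (\<integral>t. indicator {0..} t * zeta_sq t * poisson_weight d j t \<partial>lborel)"

lemma poisson_weight_measurable [measurable]: "poisson_weight d j \<in> borel_measurable borel"
  unfolding poisson_weight_def by measurable

lemma poisson_weight_nonneg: "d > 0 \<Longrightarrow> t \<ge> 0 \<Longrightarrow> poisson_weight d j t \<ge> 0"
  by (simp add: poisson_weight_def)

text \<open>The right side is the full Poisson generating function at \<open>r\<close>. The estimate
  serves three purposes: integrability of single weights, domination of the power series, and both
  exponential tail bounds.\<close>

lemma sum_poisson_weight_power_le: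
  assumes "d > 0" "t \<ge> 0" "r \<ge> 0" "finite J"
  shows "(\<Sum>j\<in>J. poisson_weight d j t * r ^ j) \<le> exp (- (d * (1 - r)) * t)"
proof -
  have sums: "(\<lambda>j. (d * t * r) ^ j /\<^sub>R fact j) sums exp (d * t * r)" by (rule exp_converges)
  have "(\<Sum>j\<in>J. poisson_weight d j t * r ^ j) = exp (- d * t) * (\<Sum>j\<in>J. (d * t * r) ^ j /\<^sub>R fact j)"
    unfolding sum_distrib_left
    by (intro sum.cong) (auto simp: poisson_weight_def power_mult_distrib field_simps)
  also have "\<dots> \<le> exp (- d * t) * exp (d * t * r)"
    using sum_le_suminf[OF sums_summable[OF sums] assms(4)] assms sums_unique[OF sums]
    by (intro mult_left_mono) (auto intro!: mult_nonneg_nonneg)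
  also have "\<dots> = exp (- (d * (1 - r)) * t)"
    unfolding exp_add[symmetric] by (simp add: algebra_simps)
  finally show ?thesis .
qed

lemma integrable_poisson_weight:
  assumes d: "d > 0"
  shows "integrable lborel (\<lambda>t. indicator {0..} t * zeta_sq t * poisson_weight d j t)"
proof (rule Bochner_Integration.integrable_bound)
  show "integrable lborel (\<lambda>t. 2 ^ j * (indicator {0..} t * zeta_sq t * exp (- (d / 2) * t)))"
    using d by (intro integrable_mult_right integrable_zeta_sq_exp) auto
  show "AE t in lborel. norm (indicator {0..} t * zeta_sq t * poisson_weight d j t) \<le>
      norm (2 ^ j * (indicator {0..} t * zeta_sq t * exp (- (d / 2) * t)))"
  proof (rule AE_I2)
    fix t :: real
    show "norm (indicator {0..} t * zeta_sq t * poisson_weight d j t) \<le>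
      norm (2 ^ j * (indicator {0..} t * zeta_sq t * exp (- (d / 2) * t)))"
    proof (cases "t \<ge> 0")
      case True
      have "poisson_weight d j t * (1/2) ^ j \<le> exp (- (d / 2) * t)"
        using sum_poisson_weight_power_le[OF d True, of "1/2" "{j}"] by simp
      hence "poisson_weight d j t \<le> 2 ^ j * exp (- (d / 2) * t)"
        by (simp add: power_divide field_simps)
      hence "zeta_sq t * poisson_weight d j t \<le> zeta_sq t * (2 ^ j * exp (- (d / 2) * t))"
        by (intro mult_left_mono zeta_sq_nonneg)
      thus ?thesis using True zeta_sq_nonneg[of t] poisson_weight_nonneg[OF d True, of j]
        by (simp add: abs_mult mult_ac)
    qed simp
  qed
qed measurable

text \<open>Expanding \<open>exp (d * x * t)\<close> produces the weights; the sums of the absolute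
  values are dominated by the integrable function
  \<open>h t * exp (- (d * (1 - norm x)) * t)\<close>.\<close>

lemma laplace_zeta_sq_power_series:
  assumes d: "d > 0" and x: "norm x < 1"
  shows "(\<lambda>j. of_real (poisson_moment d j) * x ^ j) sums laplace_zeta_sq (of_real d * (1 - x))"
proof -
  define h where "h = (\<lambda>t. indicator {0..} t * zeta_sq t)"
  define f where "f = (\<lambda>j t. of_real (h t * poisson_weight d j t) * x ^ j :: complex)"
  have int: "integrable lborel (\<lambda>t. h t * poisson_weight d j t)" for j
    unfolding h_def by (rule integrable_poisson_weight[OF d])
  have h: "h t \<ge> 0" "t < 0 \<Longrightarrow> h t = 0" for t by (auto simp: h_def zeta_sq_nonneg)
  have norm_f: "norm (f j t) = h t * (poisson_weight d j t * norm x ^ j)" for j t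
    using h(1)[of t] h(2)[of t] poisson_weight_nonneg[OF d, of t j]
    by (cases "t \<ge> 0") (auto simp: f_def norm_mult norm_power)
  have sum_le: "(\<Sum>j<n. norm (f j t)) \<le> h t * exp (- (d * (1 - norm x)) * t)" for n t
  proof (cases "t \<ge> 0")
    case True
    thus ?thesis unfolding norm_f sum_distrib_left[symmetric]
      by (intro mult_left_mono sum_poisson_weight_power_le d h) auto
  qed (simp add: norm_f h)
  have f_int: "integrable lborel (f j)" for j
    unfolding f_def by (intro integrable_mult_left integrable_of_real int)
  have "(\<lambda>j. integral\<^sup>L lborel (f j)) sums (\<integral>t. (\<Sum>j. f j t) \<partial>lborel)"
  proof (rule sums_integral[OF f_int])
    show "AE t in lborel. summable (\<lambda>j. norm (f j t))"
    proof (rule AE_I2)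
      fix t
      have "(\<Sum>j\<le>n. norm (f j t)) \<le> h t * exp (- (d * (1 - norm x)) * t)" for n
        using sum_le[where n = "Suc n" and t = t] by (simp only: lessThan_Suc_atMost)
      thus "summable (\<lambda>j. norm (f j t))" by (intro bounded_imp_summable) auto
    qed
    show "summable (\<lambda>j. \<integral>t. norm (f j t) \<partial>lborel)"
    proof (rule bounded_imp_summable)
      fix n
      have "(\<Sum>j\<le>n. \<integral>t. norm (f j t) \<partial>lborel) = (\<integral>t. (\<Sum>j\<le>n. norm (f j t)) \<partial>lborel)"
        using f_int by (subst Bochner_Integration.integral_sum) auto
      also have "\<dots> \<le> (\<integral>t. h t * exp (- (d * (1 - norm x)) * t) \<partial>lborel)"
        using f_int d x integrable_zeta_sq_exp[of "d * (1 - norm x)"] sum_le[where n = "Suc n"]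
        by (intro integral_mono Bochner_Integration.integrable_sum integrable_norm) (auto simp: h_def lessThan_Suc_atMost)
      finally show "(\<Sum>j\<le>n. \<integral>t. norm (f j t) \<partial>lborel) \<le> \<dots>" .
    qed simp
  qed
  moreover have "integral\<^sup>L lborel (f j) = of_real (poisson_moment d j) * x ^ j" for j
    unfolding f_def poisson_moment_def h_def
    by (subst Bochner_Integration.integral_mult_left_zero) (simp only: integral_complex_of_real)
  moreover have "(\<Sum>j. f j t) = of_real (h t) * exp (- (of_real d * (1 - x)) * of_real t)" for t
  proof -
    have "(\<lambda>j. of_real (h t * exp (- d * t)) * ((of_real (d * t) * x) ^ j /\<^sub>R fact j)) sums
        (of_real (h t * exp (- d * t)) * exp (of_real (d * t) * x))"
      by (intro sums_mult exp_converges)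
    also have "(\<lambda>j. of_real (h t * exp (- d * t)) * ((of_real (d * t) * x) ^ j /\<^sub>R fact j)) = (\<lambda>j. f j t)"
      by (auto simp: f_def poisson_weight_def power_mult_distrib scaleR_conv_of_real field_simps)
    also have "of_real (h t * exp (- d * t)) * exp (of_real (d * t) * x) =
        of_real (h t) * (exp (of_real (- d * t)) * exp (of_real (d * t) * x))"
      by (simp add: exp_of_real[symmetric])
    also have "exp (of_real (- d * t)) * exp (of_real (d * t) * x) = exp (- (of_real d * (1 - x)) * of_real t)"
      unfolding exp_add[symmetric] by (simp add: algebra_simps)
    finally show ?thesis by (rule sums_unique[symmetric])
  qed
  ultimately show ?thesis by (simp add: laplace_zeta_sq_def h_def)
qed

lemma one_plus_inverse_power_le: "(1 + 1 / real (Suc k)) ^ Suc k \<le> 3"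
proof -
  have "(1 + 1 / real (Suc k)) ^ Suc k \<le> exp (1 / real (Suc k)) ^ Suc k"
    by (intro power_mono) (auto intro: exp_ge_add_one_self)
  also have "\<dots> = exp 1" unfolding exp_of_nat_mult[symmetric] by simp
  also have "exp (1 :: real) \<le> 3" by (rule exp_le)
  finally show ?thesis .
qed

text \<open>The circle of radius \<open>1 - 1 / (k + 2)\<close> is as close to the singularity at \<open>1\<close> as the
  \<open>k\<close>-th Taylor polynomial allows without an exponential loss in Cauchy's inequality.\<close>

theorem sum_poisson_moment_asymp:
  obtains C \<kappa> where "C > 0"
    "\<And>k x. k \<ge> 1 \<Longrightarrow> x > 0 \<Longrightarrow> real (Suc k) / x \<le> 1/16 \<Longrightarrow>
       \<bar>(\<Sum>j\<le>k. poisson_moment (real (Suc k) / x) j) - x * (ln x + \<kappa> + euler_mascheroni - 1)\<bar>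
         \<le> C * (x / real (Suc k) + sqrt x * real (k + 2) ^ 6)"
    "\<And>d. d > 0 \<Longrightarrow> d \<le> 1/8 \<Longrightarrow>
       \<bar>(\<integral>t. indicator {0..} t * zeta_sq t * exp (- d * t) \<partial>lborel) - (\<kappa> - ln d) / d\<bar> \<le> C * d powr (-1/2)"
proof -
  obtain C c where C: "C > 0"
    "\<And>d. Re d > 0 \<Longrightarrow> norm d \<le> 1/8 \<Longrightarrow>
       norm (laplace_zeta_sq d - (c - Ln d) / d) \<le> C * norm d powr (-1/2) * (norm d / Re d) ^ 5"
    using laplace_zeta_sq_asymp by blast
  define D where "D = 192 * C + 1"
  have D: "D > 0" "D \<ge> 1" "D \<ge> C" "D \<ge> 192 * C" using C(1) by (auto simp: D_def)
  have part1: "\<bar>(\<Sum>j\<le>k. poisson_moment (real (Suc k) / x) j) - x * (ln x + Re c + euler_mascheroni - 1)\<bar>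
         \<le> D * (x / real (Suc k) + sqrt x * real (k + 2) ^ 6)"
    if k: "k \<ge> 1" and x: "x > 0" and small: "real (Suc k) / x \<le> 1/16" for k x
  proof -
    define d where "d = real (Suc k) / x"
    have d: "d > 0" "d \<le> 1/16" using x small by (auto simp: d_def)
    define r where "r = 1 - 1 / real (k + 2)"
    have r: "0 < r" "r < 1" by (auto simp: r_def field_simps)
    \<comment> \<open>Taylor coefficients in \<open>z\<close> of the main term
      \<open>(c - Ln (d * (1 - z))) / (d * (1 - z))\<close>, the logarithm contributing the harmonic
      numbers; \<open>a\<close> is left with those of the error \<open>E\<close>.\<close>
    define m where "m = (\<lambda>j. (c - of_real (ln d) + of_real (harm j)) / of_real d)"
    define a where "a = (\<lambda>j. of_real (poisson_moment d j) - m j)"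
    define E where "E = (\<lambda>z. laplace_zeta_sq (of_real d * (1 - z)) - (c - Ln (of_real d * (1 - z))) / (of_real d * (1 - z)))"
    define B where "B = C * (2 * sqrt x) * (2 * real (k + 2)) ^ 5"
    have sums: "(\<lambda>j. a j * z ^ j) sums E z" if z: "norm z < 1" for z
    proof -
      have z1: "1 - z \<noteq> 0" using z by auto
      have "(\<lambda>j. (c - of_real (ln d)) / of_real d * z ^ j + harm j * z ^ j / of_real d) sums
          ((c - of_real (ln d)) / of_real d * (1 / (1 - z)) + (- Ln (1 - z) / (1 - z)) / of_real d)"
        by (intro sums_add sums_mult sums_divide geometric_sums harm_sums z)
      also have "(\<lambda>j. (c - of_real (ln d)) / of_real d * z ^ j + harm j * z ^ j / of_real d) = (\<lambda>j. m j * z ^ j)"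
        by (auto simp: m_def of_real_harm add_divide_distrib diff_divide_distrib algebra_simps)
      also have "(c - of_real (ln d)) / of_real d * (1 / (1 - z)) + (- Ln (1 - z) / (1 - z)) / of_real d =
          (c - Ln (of_real d * (1 - z))) / (of_real d * (1 - z))"
      proof -
        have "Ln (of_real d * (1 - z)) = Ln (of_real d) + Ln (1 - z)"
          using Ln_times_of_real[OF d(1) z1] by simp
        also have "Ln (complex_of_real d) = of_real (ln d)" using d by (simp add: Ln_of_real)
        finally have Ln: "Ln (of_real d * (1 - z)) = of_real (ln d) + Ln (1 - z)" .
        have "(c - l) / D * (1 / Y) + (- q / Y) / D = (c - (l + q)) / (D * Y)" for l q D Y :: complex
          by (simp add: diff_divide_distrib add_divide_distrib mult.commute)
        thus ?thesis unfolding Ln .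
      qed
      finally show ?thesis
        unfolding a_def E_def left_diff_distrib
        by (intro sums_diff laplace_zeta_sq_power_series d z)
    qed
    have bound: "norm (E z) \<le> B" if z: "norm z = r" for z
    proof -
      define w where "w = of_real d * (1 - z)"
      \<comment> \<open>On the circle, \<open>w\<close> keeps at least this distance from the
        imaginary axis, so \<open>norm w / Re w\<close> is at most
        \<open>2 * (k + 2)\<close>.\<close>
      have Rew: "Re w \<ge> d / real (k + 2)"
      proof -
        have "Re (1 - z) \<ge> 1 / real (k + 2)" using complex_Re_le_cmod[of z] z by (simp add: r_def)
        hence "d * Re (1 - z) \<ge> d * (1 / real (k + 2))" using d by (intro mult_left_mono) auto
        thus ?thesis by (simp add: w_def)
      qed
      have pos: "d / real (k + 2) > 0" using d by simp
      have w_le: "norm w \<le> 2 * d"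
        using norm_triangle_ineq4[of 1 z] z r d by (simp add: w_def norm_mult)
      have w_ge: "norm w \<ge> d / real (k + 2)" using Rew complex_Re_le_cmod[of w] by linarith
      have "norm (E z) \<le> C * norm w powr (-1/2) * (norm w / Re w) ^ 5"
        unfolding E_def w_def[symmetric] using C(2)[of w] Rew pos w_le d by simp
      also have "\<dots> \<le> C * (2 * sqrt x) * (2 * real (k + 2)) ^ 5"
      proof (intro mult_mono power_mono mult_left_mono)
        have "norm w powr (-1/2) \<le> (d / real (k + 2)) powr (-1/2)"
          using w_ge pos by (intro powr_mono2') auto
        also have "\<dots> = sqrt (real (k + 2) / d)"
          using d by (simp add: powr_minus powr_half_sqrt real_sqrt_divide)
        also have "real (k + 2) / d = x * (real (k + 2) / real (Suc k))"
          using x by (simp add: d_def)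
        also have "\<dots> \<le> x * 4" using x by (intro mult_left_mono) (auto simp: field_simps)
        hence "sqrt (x * (real (k + 2) / real (Suc k))) \<le> sqrt (x * 4)" by (rule real_sqrt_le_mono)
        also have "\<dots> = 2 * sqrt x" by (simp add: real_sqrt_mult)
        finally show "norm w powr (-1/2) \<le> 2 * sqrt x" .
        have "norm w / Re w \<le> 2 * d / (d / real (k + 2))"
          using w_le Rew pos d by (intro frac_le) auto
        thus "norm w / Re w \<le> 2 * real (k + 2)" using d by simp
      qed (use C(1) Rew pos x in auto)
      finally show ?thesis by (simp add: B_def)
    qed
    have B: "B \<ge> 0" unfolding B_def using C(1) x by simp
    have coeff: "norm (a j) \<le> B * 3" if j: "j \<le> k" for j
    proof -
      have "norm (a j) \<le> B / r ^ j" by (rule power_series_coeff_bound[OF sums r bound])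
      also have "\<dots> = B * (1 / r) ^ j" by (simp add: power_divide)
      also have "1 / r = 1 + 1 / real (Suc k)" by (simp add: r_def field_simps)
      also have "(1 + 1 / real (Suc k)) ^ j \<le> (1 + 1 / real (Suc k)) ^ Suc k"
        using j by (intro power_increasing) auto
      also have "\<dots> \<le> 3" by (rule one_plus_inverse_power_le)
      finally show ?thesis using B by (simp add: mult_left_mono)
    qed
    \<comment> \<open>Summing \<open>k + 1\<close> coefficients by absolute value raises the fifth
      power of \<open>k + 2\<close> to the sixth; the constant is
      \<open>3 * 2 * 2 ^ 5 = 192\<close>.\<close>
    have "norm (\<Sum>j\<le>k. a j) \<le> (\<Sum>j\<le>k. B * 3)"
      by (intro sum_norm_le) (use coeff in auto)
    also have "\<dots> = B * 3 * real (Suc k)" by simp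
    also have "\<dots> \<le> B * 3 * real (k + 2)" using B by (intro mult_left_mono) auto
    also have "\<dots> = 192 * C * (sqrt x * real (k + 2) ^ 6)"
    proof -
      have N: "(2 * N) ^ 5 * N = 32 * N ^ 6" for N :: real by (simp add: eval_nat_numeral)
      have "B * 3 * real (k + 2) = 6 * C * sqrt x * ((2 * real (k + 2)) ^ 5 * real (k + 2))"
        unfolding B_def by simp
      thus ?thesis unfolding N by simp
    qed
    also have "\<dots> \<le> D * (sqrt x * real (k + 2) ^ 6)"
      using D x by (intro mult_right_mono) auto
    finally have sum_a: "norm (\<Sum>j\<le>k. a j) \<le> D * (sqrt x * real (k + 2) ^ 6)" .
    have "Re (\<Sum>j\<le>k. m j) = (real (Suc k) * (Re c - ln d) + (\<Sum>j\<le>k. harm j)) / d"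
      by (simp add: m_def sum.distrib add_divide_distrib sum_divide_distrib)
    also have "\<dots> = x * (Re c - ln d + (harm (Suc k) - 1))"
      unfolding sum_harm using x d by (simp add: d_def field_simps)
    \<comment> \<open>With \<open>d = (k + 1) / x\<close> the logarithm of \<open>k + 1\<close>
      cancels the growth of the harmonic number, leaving Euler's constant up to
      \<open>1 / (k + 1)\<close>.\<close>
    also have "ln d = ln (real (Suc k)) - ln x" using x by (simp add: d_def ln_div)
    finally have "Re (\<Sum>j\<le>k. m j) - x * (ln x + Re c + euler_mascheroni - 1) =
        x * (harm (Suc k) - ln (real (Suc k)) - euler_mascheroni)"
      by (simp add: algebra_simps)
    hence sum_m: "\<bar>Re (\<Sum>j\<le>k. m j) - x * (ln x + Re c + euler_mascheroni - 1)\<bar> \<le> x * (1 / real (Suc k))"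
      using harm_minus_ln_bound[OF k] x by (simp add: abs_mult mult_left_mono del: of_nat_Suc times_divide_eq_right)
    have "(\<Sum>j\<le>k. poisson_moment d j) = Re (\<Sum>j\<le>k. a j) + Re (\<Sum>j\<le>k. m j)"
      by (simp add: a_def sum_subtractf)
    hence "\<bar>(\<Sum>j\<le>k. poisson_moment d j) - x * (ln x + Re c + euler_mascheroni - 1)\<bar> \<le>
        D * (sqrt x * real (k + 2) ^ 6) + x * (1 / real (Suc k))"
      using sum_m sum_a abs_Re_le_cmod[of "\<Sum>j\<le>k. a j"] by linarith
    also have "\<dots> \<le> D * (sqrt x * real (k + 2) ^ 6) + D * (x / real (Suc k))"
      using D x mult_right_mono[of 1 D "x / real (Suc k)"] by simp
    finally show ?thesis by (simp add: d_def algebra_simps)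
  qed
  have part2: "\<bar>(\<integral>t. indicator {0..} t * zeta_sq t * exp (- d * t) \<partial>lborel) - (Re c - ln d) / d\<bar> \<le> D * d powr (-1/2)"
    if d: "d > 0" "d \<le> 1/8" for d :: real
  proof -
    have "laplace_zeta_sq (of_real d) = (\<integral>t. of_real (indicator {0..} t * zeta_sq t * exp (- d * t)) \<partial>lborel)"
      by (simp add: laplace_zeta_sq_def exp_of_real[symmetric])
    also have "\<dots> = of_real (\<integral>t. indicator {0..} t * zeta_sq t * exp (- d * t) \<partial>lborel)"
      by (rule integral_complex_of_real)
    finally have "(\<integral>t. indicator {0..} t * zeta_sq t * exp (- d * t) \<partial>lborel) - (Re c - ln d) / d =
        Re (laplace_zeta_sq (of_real d) - (c - Ln (of_real d)) / of_real d)"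
      using d by (simp add: Ln_of_real)
    also have "\<bar>\<dots>\<bar> \<le> C * norm (complex_of_real d) powr (-1/2) * (norm (complex_of_real d) / Re (of_real d)) ^ 5"
      using C(2)[of "of_real d"] d by (intro order.trans[OF abs_Re_le_cmod]) auto
    also have "\<dots> = C * d powr (-1/2)" using d by simp
    also have "\<dots> \<le> D * d powr (-1/2)" using D by (intro mult_right_mono) auto
    finally show ?thesis .
  qed
  show ?thesis by (rule that[OF D(1) part1 part2])
qed

section \<open>Tail bounds and the comparison with the mean square\<close>

text \<open>The quadratic gain over the tangent is what makes the upper tail exponent proportional
  to \<open>k * h\<^sup>2\<close>.\<close>

lemma ln_one_plus_le:
  fixes h :: real
  assumes h: "0 \<le> h" "h \<le> 1"
  shows "ln (1 + h) \<le> h - h\<^sup>2 / 4"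
proof -
  have "0 - 0\<^sup>2 / 4 - ln (1 + 0) \<le> h - h\<^sup>2 / 4 - ln (1 + h)"
  proof (rule DERIV_nonneg_imp_nondecreasing[OF h(1)])
    fix x :: real assume x: "0 \<le> x" "x \<le> h"
    have "((\<lambda>x. x - x\<^sup>2 / 4 - ln (1 + x)) has_real_derivative (1 - x / 2 - 1 / (1 + x))) (at x)"
      using x by (auto intro!: derivative_eq_intros)
    moreover have "1 - x / 2 - 1 / (1 + x) = x * (1 - x) / (2 * (1 + x))"
      using x by (simp add: field_simps power2_eq_square)
    moreover have "\<dots> \<ge> 0" using x h by simp
    ultimately show "\<exists>y. ((\<lambda>x. x - x\<^sup>2 / 4 - ln (1 + x)) has_real_derivative y) (at x) \<and> 0 \<le> y"
      by metis
  qed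
  thus ?thesis by simp
qed

text \<open>The corresponding gain for the lower tail, where the tilted mean contributes
  \<open>h / (1 + h)\<close>.\<close>

lemma ln_one_plus_ge:
  fixes h :: real
  assumes h: "0 \<le> h" "h \<le> 1"
  shows "h / (1 + h) + h\<^sup>2 / 8 \<le> ln (1 + h)"
proof -
  have "ln (1 + 0) - 0 / (1 + 0) - 0\<^sup>2 / 8 \<le> ln (1 + h) - h / (1 + h) - h\<^sup>2 / 8"
  proof (rule DERIV_nonneg_imp_nondecreasing[OF h(1)])
    fix x :: real assume x: "0 \<le> x" "x \<le> h"
    have "((\<lambda>x. ln (1 + x) - x / (1 + x) - x\<^sup>2 / 8) has_real_derivative
        (1 / (1 + x) - 1 / (1 + x)\<^sup>2 - x / 4)) (at x)"
      using x by (auto intro!: derivative_eq_intros simp: power2_eq_square)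
    moreover have "1 / (1 + x) - 1 / (1 + x)\<^sup>2 - x / 4 = x * (1 / (1 + x)\<^sup>2 - 1 / 4)"
    proof -
      have "1 / (1 + x) - 1 / (1 + x)\<^sup>2 = x / (1 + x)\<^sup>2"
        using x by (simp add: divide_simps power2_eq_square)
      thus ?thesis by (simp add: right_diff_distrib)
    qed
    moreover have "(1 + x)\<^sup>2 \<le> 2\<^sup>2" using x h by (intro power_mono) auto
    hence "1 / (1 + x)\<^sup>2 \<ge> 1 / 4" using x by (intro divide_left_mono) auto
    hence "x * (1 / (1 + x)\<^sup>2 - 1 / 4) \<ge> 0" using x by simp
    ultimately show "\<exists>y. ((\<lambda>x. ln (1 + x) - x / (1 + x) - x\<^sup>2 / 8) has_real_derivative y) (at x) \<and> 0 \<le> y"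
      by metis
  qed
  thus ?thesis by simp
qed

definition zeta_moment :: "real \<Rightarrow> real" where
  "zeta_moment T = integral {0..T} zeta_sq"

lemma zeta_sq_integrable_on: "zeta_sq integrable_on {a..b}"
  by (intro integrable_continuous_real zeta_sq_continuous)

lemma zeta_moment_nonneg: "zeta_moment T \<ge> 0"
  unfolding zeta_moment_def by (intro integral_nonneg zeta_sq_integrable_on zeta_sq_nonneg)

lemma zeta_moment_mono: "S \<le> T \<Longrightarrow> zeta_moment S \<le> zeta_moment T"
  unfolding zeta_moment_def
  by (intro integral_subset_le zeta_sq_integrable_on) (auto simp: zeta_sq_nonneg)

lemma zeta_moment_add:
  assumes "0 \<le> S" "S \<le> T"
  shows "zeta_moment S + integral {S..T} zeta_sq = zeta_moment T"
  unfolding zeta_moment_def using assms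
  by (intro Henstock_Kurzweil_Integration.integral_combine zeta_sq_integrable_on)

lemma zeta_moment_eq_lborel:
  "integrable lborel (\<lambda>t. indicator {0..T} t * zeta_sq t)"
  "zeta_moment T = (\<integral>t. indicator {0..T} t * zeta_sq t \<partial>lborel)"
proof -
  have *: "set_integrable lborel {0..T} zeta_sq"
    by (intro borel_integrable_atLeastAtMost' zeta_sq_continuous)
  thus "integrable lborel (\<lambda>t. indicator {0..T} t * zeta_sq t)"
    by (simp add: set_integrable_def)
  show "zeta_moment T = (\<integral>t. indicator {0..T} t * zeta_sq t \<partial>lborel)"
    using set_borel_integral_eq_integral(2)[OF *]
    by (simp add: zeta_moment_def set_lebesgue_integral_def)
qed

definition poisson_cdf :: "real \<Rightarrow> nat \<Rightarrow> real \<Rightarrow> real" where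
  "poisson_cdf d k t = (\<Sum>j\<le>k. poisson_weight d j t)"

lemma sum_poisson_moment:
  assumes "d > 0"
  shows "integrable lborel (\<lambda>t. indicator {0..} t * zeta_sq t * poisson_cdf d k t)"
    and "(\<Sum>j\<le>k. poisson_moment d j) = (\<integral>t. indicator {0..} t * zeta_sq t * poisson_cdf d k t \<partial>lborel)"
  unfolding poisson_moment_def poisson_cdf_def sum_distrib_left
  by (intro Bochner_Integration.integrable_sum integrable_poisson_weight assms,
      rule Bochner_Integration.integral_sum[symmetric], intro integrable_poisson_weight assms)

lemma poisson_cdf_bounds:
  assumes "d > 0" "t \<ge> 0"
  shows "poisson_cdf d k t \<ge> 0" "poisson_cdf d k t \<le> 1"
  using sum_poisson_weight_power_le[OF assms, of 1 "{..k}"] poisson_weight_nonneg[OF assms]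
  by (auto simp: poisson_cdf_def intro!: sum_nonneg)

text \<open>Chernoff bound: for \<open>r \<le> 1\<close> every index \<open>j \<le> k\<close> has
  \<open>r ^ k \<le> r ^ j\<close>.\<close>

lemma poisson_cdf_upper_tail:
  assumes d: "d > 0" and t: "t \<ge> 0" and r: "0 < r" "r \<le> 1"
  shows "poisson_cdf d k t * r ^ k \<le> exp (- (d * (1 - r)) * t)"
proof -
  have "poisson_cdf d k t * r ^ k = (\<Sum>j\<le>k. poisson_weight d j t * r ^ k)"
    by (simp add: poisson_cdf_def sum_distrib_right)
  also have "\<dots> \<le> (\<Sum>j\<le>k. poisson_weight d j t * r ^ j)"
    using r poisson_weight_nonneg[OF d t] by (intro sum_mono mult_left_mono power_decreasing) auto
  also have "\<dots> \<le> exp (- (d * (1 - r)) * t)"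
    using r by (intro sum_poisson_weight_power_le d t) auto
  finally show ?thesis .
qed

text \<open>Chernoff bound with \<open>r \<ge> 1\<close> on the complementary indices
  \<open>j \<ge> k + 1\<close>.\<close>

lemma poisson_cdf_lower_tail:
  assumes d: "d > 0" and t: "t \<ge> 0" and r: "r \<ge> 1"
  shows "(1 - poisson_cdf d k t) * r ^ Suc k \<le> exp (- (d * (1 - r)) * t)"
proof -
  have "(\<lambda>j. exp (- d * t) * ((d * t) ^ j /\<^sub>R fact j)) sums (exp (- d * t) * exp (d * t))"
    by (intro sums_mult exp_converges)
  hence "(\<lambda>j. poisson_weight d j t) sums 1"
    by (simp add: poisson_weight_def field_simps flip: exp_add)
  hence "(\<lambda>j. poisson_weight d (j + Suc k) t) sums (1 - poisson_cdf d k t)"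
    unfolding poisson_cdf_def lessThan_Suc_atMost[symmetric] by (rule sums_split_initial_segment)
  hence sums: "(\<lambda>j. poisson_weight d (j + Suc k) t * r ^ Suc k) sums ((1 - poisson_cdf d k t) * r ^ Suc k)"
    by (rule sums_mult2)
  have "(\<Sum>j<n. poisson_weight d (j + Suc k) t * r ^ Suc k) \<le> exp (- (d * (1 - r)) * t)" for n
  proof -
    have "(\<Sum>j<n. poisson_weight d (j + Suc k) t * r ^ Suc k) \<le> (\<Sum>j<n. poisson_weight d (j + Suc k) t * r ^ (j + Suc k))"
      using r poisson_weight_nonneg[OF d t] by (intro sum_mono mult_left_mono power_increasing) auto
    also have "\<dots> = (\<Sum>j\<in>(\<lambda>j. j + Suc k) ` {..<n}. poisson_weight d j t * r ^ j)"
      by (subst sum.reindex) (auto simp: o_def inj_on_def)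
    also have "\<dots> \<le> exp (- (d * (1 - r)) * t)"
      using r by (intro sum_poisson_weight_power_le d t) auto
    finally show ?thesis .
  qed
  thus ?thesis using suminf_le_const[OF sums_summable[OF sums]] sums_unique[OF sums] by simp
qed

context
  fixes T h :: real and k :: nat
  assumes T: "T > 0" and h: "0 < h" "h < 1"
begin

text \<open>For \<open>t \<le> T\<close> the Poisson mean \<open>d * t\<close> is at most
  \<open>(k + 1) / (1 + h)\<close>, so the distribution function is nearly 1 on
  \<open>[0, T]\<close>; the tilt is \<open>r = 1 + h\<close>.\<close>

lemma zeta_moment_le:
  "zeta_moment T * (1 - exp (- (real (Suc k) * h\<^sup>2 / 8))) \<le>
     (\<Sum>j\<le>k. poisson_moment (real (Suc k) / (T * (1 + h))) j)"
proof -
  define d where "d = real (Suc k) / (T * (1 + h))"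
  have d: "d > 0" using T h by (simp add: d_def)
  define q where "q = 1 - exp (- (real (Suc k) * h\<^sup>2 / 8))"
  have "indicator {0..T} t * zeta_sq t * q \<le> indicator {0..} t * zeta_sq t * poisson_cdf d k t" for t
  proof (cases "t \<in> {0..T}")
    case True
    have "q \<le> poisson_cdf d k t"
    proof -
      have "1 - poisson_cdf d k t = (1 - poisson_cdf d k t) * (1 + h) ^ Suc k * exp (- (real (Suc k) * ln (1 + h)))"
      proof -
        have "(1 + h) ^ Suc k = exp (real (Suc k) * ln (1 + h))"
          using h unfolding exp_of_nat_mult by simp
        thus ?thesis by (simp add: mult.assoc flip: exp_add)
      qed
      also have "\<dots> \<le> exp (- (d * (1 - (1 + h))) * t) * exp (- (real (Suc k) * ln (1 + h)))"
        using h True by (intro mult_right_mono poisson_cdf_lower_tail d) auto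
      also have "\<dots> = exp (d * h * t - real (Suc k) * ln (1 + h))"
        by (simp flip: exp_add)
      also have "\<dots> \<le> exp (- (real (Suc k) * h\<^sup>2 / 8))"
      proof -
        have "d * h * t \<le> d * h * T" using d h True by (intro mult_left_mono) auto
        also have "\<dots> = real (Suc k) * (h / (1 + h))" using T h by (simp add: d_def)
        also have "\<dots> \<le> real (Suc k) * (ln (1 + h) - h\<^sup>2 / 8)"
          using ln_one_plus_ge[of h] h by (intro mult_left_mono) auto
        finally show ?thesis by (simp add: algebra_simps)
      qed
      finally show ?thesis by (simp add: q_def)
    qed
    thus ?thesis using True zeta_sq_nonneg[of t] by (auto simp: mult_left_mono)
  next
    case False
    thus ?thesis using zeta_sq_nonneg[of t] poisson_cdf_bounds(1)[OF d, of t k]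
      by (auto simp: indicator_def)
  qed
  hence "(\<integral>t. indicator {0..T} t * zeta_sq t * q \<partial>lborel) \<le>
      (\<integral>t. indicator {0..} t * zeta_sq t * poisson_cdf d k t \<partial>lborel)"
    by (intro integral_mono integrable_mult_left zeta_moment_eq_lborel sum_poisson_moment d)
  thus ?thesis
    unfolding d_def[symmetric] q_def[symmetric] sum_poisson_moment(2)[OF d] zeta_moment_eq_lborel(2)
    by simp
qed

text \<open>At \<open>t = T\<close> the mean is \<open>(k + 1) / (1 - h)\<close>, so the
  distribution function is tiny beyond \<open>T\<close>. To integrate it against
  \<open>zeta_sq\<close>, a rate \<open>1 / T\<close> of the Chernoff decay is set aside;
  \<open>kh\<close> guarantees that so much is there. Starting this reserve at \<open>T\<close>
  costs \<open>exp 1\<close>, hence the 3.\<close>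

lemma zeta_moment_ge:
  assumes kh: "real (Suc k) * h \<ge> 1"
  shows "(\<Sum>j\<le>k. poisson_moment (real (Suc k) / (T * (1 - h))) j) \<le> zeta_moment T +
     3 * exp (- (real (Suc k) * h\<^sup>2 / 4)) * (\<integral>t. indicator {0..} t * zeta_sq t * exp (- (1 / T) * t) \<partial>lborel)"
proof -
  define d where "d = real (Suc k) / (T * (1 - h))"
  have d: "d > 0" using T h by (simp add: d_def)
  define B where "B = 3 * exp (- (real (Suc k) * h\<^sup>2 / 4))"
  define r where "r = 1 / (1 + h)"
  have r: "0 < r" "r \<le> 1" using h by (auto simp: r_def)
  have dr: "d * (1 - r) * T \<ge> real (Suc k) * h"
  proof -
    have "d * (1 - r) * T = real (Suc k) * (h / ((1 - h) * (1 + h)))"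
    proof -
      have "1 - r = h / (1 + h)" using h by (simp add: r_def field_simps)
      thus ?thesis using T by (simp add: d_def)
    qed
    also have "h / ((1 - h) * (1 + h)) \<ge> h / 1"
      using h by (intro divide_left_mono mult_pos_pos) (auto simp: algebra_simps power2_eq_square)
    hence "real (Suc k) * (h / ((1 - h) * (1 + h))) \<ge> real (Suc k) * h" by (intro mult_left_mono) auto
    finally show ?thesis .
  qed
  have "indicator {0..} t * zeta_sq t * poisson_cdf d k t \<le>
     indicator {0..T} t * zeta_sq t + B * (indicator {0..} t * zeta_sq t * exp (- (1 / T) * t))" for t
  proof (cases "t \<in> {0..T}")
    case True
    hence "zeta_sq t * poisson_cdf d k t \<le> zeta_sq t * 1"
      using poisson_cdf_bounds[OF d, of t k] zeta_sq_nonneg[of t] by (intro mult_left_mono) auto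
    moreover have "0 \<le> B * (zeta_sq t * exp (- (1 / T) * t))"
      using zeta_sq_nonneg[of t] by (simp add: B_def)
    ultimately show ?thesis using True by simp
  next
    case False
    show ?thesis
    proof (cases "t < 0")
      case neg: False
      with False have t: "t > T" by auto
      have "poisson_cdf d k t = (poisson_cdf d k t * r ^ k) * (1 + h) ^ k"
        using h by (simp add: r_def power_divide)
      also have "\<dots> \<le> exp (- (d * (1 - r)) * t) * (1 + h) ^ Suc k"
        using h r t T by (intro mult_mono poisson_cdf_upper_tail power_increasing d) auto
      also have "(1 + h) ^ Suc k = exp (real (Suc k) * ln (1 + h))"
        using h unfolding exp_of_nat_mult by simp
      also have "exp (- (d * (1 - r)) * t) * exp (real (Suc k) * ln (1 + h)) =
          exp (- (d * (1 - r) * t) + real (Suc k) * ln (1 + h))"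
        by (simp flip: exp_add)
      also have "\<dots> \<le> exp (1 - real (Suc k) * h\<^sup>2 / 4 + - (1 / T) * t)"
      proof -
        have "d * (1 - r) - 1 / T \<ge> 0"
          using dr kh T by (simp add: field_simps)
        hence "(d * (1 - r) - 1 / T) * T \<le> (d * (1 - r) - 1 / T) * t"
          using t by (intro mult_left_mono) auto
        hence 1: "real (Suc k) * h - 1 \<le> d * (1 - r) * t - 1 / T * t"
          using dr T by (simp add: left_diff_distrib)
        have 2: "real (Suc k) * ln (1 + h) \<le> real (Suc k) * (h - h\<^sup>2 / 4)"
          using ln_one_plus_le[of h] h by (intro mult_left_mono) auto
        have 3: "real (Suc k) * (h - h\<^sup>2 / 4) = real (Suc k) * h - real (Suc k) * h\<^sup>2 / 4"
          by (simp add: right_diff_distrib)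
        have "- (d * (1 - r) * t) + real (Suc k) * ln (1 + h) \<le> 1 - real (Suc k) * h\<^sup>2 / 4 + - (1 / T) * t"
          using 1 2 unfolding 3 by linarith
        thus ?thesis by simp
      qed
      also have "\<dots> = exp 1 * (exp (- (real (Suc k) * h\<^sup>2 / 4)) * exp (- (1 / T) * t))"
        unfolding exp_add[symmetric] by simp
      also have "\<dots> \<le> 3 * (exp (- (real (Suc k) * h\<^sup>2 / 4)) * exp (- (1 / T) * t))"
        using exp_le by (intro mult_right_mono) auto
      finally have "zeta_sq t * poisson_cdf d k t \<le> zeta_sq t * (B * exp (- (1 / T) * t))"
        unfolding B_def mult.assoc[of 3] by (intro mult_left_mono zeta_sq_nonneg)
      thus ?thesis using t T by (simp add: mult_ac)
    qed auto
  qed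
  hence "(\<integral>t. indicator {0..} t * zeta_sq t * poisson_cdf d k t \<partial>lborel) \<le>
      (\<integral>t. indicator {0..T} t * zeta_sq t + B * (indicator {0..} t * zeta_sq t * exp (- (1 / T) * t)) \<partial>lborel)"
    using T by (intro integral_mono Bochner_Integration.integrable_add integrable_mult_right zeta_moment_eq_lborel
        sum_poisson_moment d integrable_zeta_sq_exp) auto
  also have "\<dots> = zeta_moment T + B * (\<integral>t. indicator {0..} t * zeta_sq t * exp (- (1 / T) * t) \<partial>lborel)"
    using T integrable_zeta_sq_exp[of "1 / T"] zeta_moment_eq_lborel[of T]
    by (subst Bochner_Integration.integral_add) (auto intro!: integrable_mult_right)
  finally show ?thesis
    unfolding d_def[symmetric] B_def[symmetric] sum_poisson_moment(2)[OF d] .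
qed

end

section \<open>The mean square with error O(T / ln T)\<close>

definition zeta_laplace :: "real \<Rightarrow> real" where
  "zeta_laplace V = (\<integral>t. indicator {0..} t * zeta_sq t * exp (- (1 / V) * t) \<partial>lborel)"

text \<open>Parameters: \<open>h = 1 / ln T ^ 2\<close> and \<open>k\<close> about
  \<open>ln T ^ 6\<close>. Moving the endpoint to \<open>T * (1 + h)\<close> or
  \<open>T * (1 - h)\<close> changes the main term by about \<open>T * h * ln T = T / ln T\<close>;
  the tails are below \<open>1 / T ^ 2\<close> because \<open>k * h\<^sup>2\<close> is about
  \<open>ln T ^ 2\<close>; the Cauchy error is \<open>sqrt T\<close> times a power of
  \<open>ln T\<close>.\<close>

theorem zeta_moment_asymp:
  obtains \<kappa> where
    "(\<lambda>T. zeta_moment T - T * (ln T + \<kappa> + euler_mascheroni - 1)) \<in> O(\<lambda>T. T / ln T)"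
    "(\<lambda>V. zeta_laplace V - V * (ln V + \<kappa>)) \<in> O(sqrt)"
proof -
  obtain C \<kappa> where C: "C > 0"
    and moment: "\<And>k x. k \<ge> 1 \<Longrightarrow> x > 0 \<Longrightarrow> real (Suc k) / x \<le> 1/16 \<Longrightarrow>
       \<bar>(\<Sum>j\<le>k. poisson_moment (real (Suc k) / x) j) - x * (ln x + \<kappa> + euler_mascheroni - 1)\<bar>
         \<le> C * (x / real (Suc k) + sqrt x * real (k + 2) ^ 6)"
    and laplace: "\<And>d. d > 0 \<Longrightarrow> d \<le> 1/8 \<Longrightarrow>
       \<bar>(\<integral>t. indicator {0..} t * zeta_sq t * exp (- d * t) \<partial>lborel) - (\<kappa> - ln d) / d\<bar> \<le> C * d powr (-1/2)"
    using sum_poisson_moment_asymp by blast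
  have lap: "eventually (\<lambda>V. \<bar>zeta_laplace V - V * (ln V + \<kappa>)\<bar> \<le> C * sqrt V) at_top"
    using eventually_ge_at_top[of 8]
  proof eventually_elim
    case (elim V)
    have e1: "(1 / V) powr (-1/2) = sqrt V"
      using elim by (simp add: powr_divide powr_minus powr_half_sqrt)
    have e2: "(\<kappa> - ln (1 / V)) / (1 / V) = V * (ln V + \<kappa>)"
      using elim by (simp add: ln_div algebra_simps)
    have "\<bar>(\<integral>t. indicator {0..} t * zeta_sq t * exp (- (1 / V) * t) \<partial>lborel) - (\<kappa> - ln (1 / V)) / (1 / V)\<bar>
        \<le> C * (1 / V) powr (-1/2)"
      using elim by (intro laplace) auto
    thus ?case unfolding e1 e2 zeta_laplace_def .
  qed
  hence lapO: "(\<lambda>V. zeta_laplace V - V * (ln V + \<kappa>)) \<in> O(sqrt)"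
  proof (intro bigoI[of _ C], elim eventually_mono)
    fix V assume "\<bar>zeta_laplace V - V * (ln V + \<kappa>)\<bar> \<le> C * sqrt V"
    also have "\<dots> \<le> C * \<bar>sqrt V\<bar>" using C by (intro mult_left_mono) auto
    finally show "norm (zeta_laplace V - V * (ln V + \<kappa>)) \<le> C * norm (sqrt V)" by simp
  qed
  define m where "m = \<kappa> + euler_mascheroni - 1"
  define F where "F = (\<lambda>x. x * (ln x + m))"
  define R where "R = (\<lambda>T::real. C * (2 * T / ln T ^ 6 + sqrt (2 * T) * (ln T ^ 6 + 4) ^ 6))"
  \<comment> \<open>Dividing by \<open>1 - 1 / T ^ 2\<close> undoes the deficit of the distribution
    function in \<open>zeta_moment_le\<close>.\<close>
  define U where "U = (\<lambda>T. (F (T * (1 + 1 / ln T ^ 2)) + R T) / (1 - 1 / T ^ 2))"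
  define L where "L = (\<lambda>T. F (T * (1 - 1 / ln T ^ 2)) - R T - 3 * (1 / T ^ 2) * (T * (ln T + \<kappa>) + C * sqrt T))"
  have bounds: "eventually (\<lambda>T. L T \<le> zeta_moment T \<and> zeta_moment T \<le> U T) at_top"
  proof -
    have "eventually (\<lambda>T::real. ln T ^ 2 > 1) at_top" "eventually (\<lambda>T::real. ln T \<ge> 20) at_top"
      "eventually (\<lambda>T::real. ln T ^ 6 + 2 \<le> T / 2 / 16) at_top"
      "eventually (\<lambda>T::real. 1 - 1 / ln T ^ 2 \<ge> 1 / 2) at_top"
      by real_asymp+
    thus ?thesis using lap eventually_gt_at_top[of 1]
    proof eventually_elim
      case (elim T)
      define h where "h = 1 / ln T ^ 2"
      have h: "0 < h" "h < 1" using elim(1) by (auto simp: h_def divide_less_eq)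
      have T: "T > 0" using elim by simp
      define k where "k = nat \<lceil>ln T ^ 6\<rceil>"
      have l1: "ln T ^ 6 \<ge> 1" using elim by (intro one_le_power) auto
      have k_ge: "real k \<ge> ln T ^ 6" using l1 by (simp add: k_def real_nat_ceiling_ge)
      have k_le: "real k \<le> ln T ^ 6 + 1" using l1 by (simp add: k_def)
      have k1: "k \<ge> 1" using k_ge l1 by linarith
      have p: "ln T ^ 6 = ln T ^ 2 * ln T ^ 4" "ln T ^ 4 = ln T ^ 2 * ln T ^ 2"
        by (simp_all flip: power_add)
      have hl: "h * ln T ^ 2 = 1" using elim(2) by (simp add: h_def)
      have "ln T ^ 6 * h = (h * ln T ^ 2) * ln T ^ 4" "ln T ^ 6 * h\<^sup>2 = (h * ln T ^ 2) * (h * ln T ^ 2) * ln T ^ 2"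
        unfolding p power2_eq_square[of h] by (simp_all only: mult_ac)
      hence "ln T ^ 6 * h = ln T ^ 4" "ln T ^ 6 * h\<^sup>2 = ln T ^ 2"
        unfolding hl by simp_all
      moreover have "real (Suc k) * h \<ge> ln T ^ 6 * h" "real (Suc k) * h\<^sup>2 \<ge> ln T ^ 6 * h\<^sup>2"
        using k_ge h by (intro mult_right_mono; simp)+
      moreover have "ln T ^ 4 \<ge> 1" using elim by (intro one_le_power) auto
      moreover have "ln T ^ 2 \<ge> 20 * ln T" using elim by (simp add: power2_eq_square mult_right_mono)
      ultimately have kh: "real (Suc k) * h \<ge> 1" "real (Suc k) * h\<^sup>2 \<ge> 20 * ln T" by linarith+
      have "exp (- (2 * ln T)) = 1 / T ^ 2"
        using T exp_double[of "ln T"] by (simp add: exp_minus inverse_eq_divide)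
      moreover have "- (real (Suc k) * h\<^sup>2 / 8) \<le> - (2 * ln T)" "- (real (Suc k) * h\<^sup>2 / 4) \<le> - (2 * ln T)"
        using kh(2) elim(2) by linarith+
      ultimately have e: "exp (- (real (Suc k) * h\<^sup>2 / 8)) \<le> 1 / T ^ 2" "exp (- (real (Suc k) * h\<^sup>2 / 4)) \<le> 1 / T ^ 2"
        by (metis exp_le_cancel_iff)+
      \<comment> \<open>This range of \<open>x\<close> contains both shifted endpoints, so one
        remainder \<open>R T\<close> serves the upper and the lower bound.\<close>
      have E: "\<bar>(\<Sum>j\<le>k. poisson_moment (real (Suc k) / x) j) - F x\<bar> \<le> R T"
        if x: "x \<ge> T / 2" "x \<le> 2 * T" for x
      proof -
        have x0: "x > 0" using x T by simp
        have "real (Suc k) / x \<le> (T / 2 / 16) / (T / 2)"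
          using k_le elim(3) x T by (intro frac_le) auto
        hence small: "real (Suc k) / x \<le> 1 / 16" using T by simp
        have "\<bar>(\<Sum>j\<le>k. poisson_moment (real (Suc k) / x) j) - F x\<bar> \<le> C * (x / real (Suc k) + sqrt x * real (k + 2) ^ 6)"
          using moment[OF k1 x0 small] by (simp add: F_def m_def algebra_simps)
        also have "\<dots> \<le> C * (2 * T / ln T ^ 6 + sqrt (2 * T) * (ln T ^ 6 + 4) ^ 6)"
        proof (intro mult_left_mono add_mono mult_mono power_mono)
          show "x / real (Suc k) \<le> 2 * T / ln T ^ 6"
            using x k_ge l1 T by (intro frac_le) auto
        qed (use x k_le C T in auto)
        finally show ?thesis by (simp add: R_def)
      qed
      have "zeta_moment T * (1 - 1 / T ^ 2) \<le> zeta_moment T * (1 - exp (- (real (Suc k) * h\<^sup>2 / 8)))"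
        using e(1) by (intro mult_left_mono zeta_moment_nonneg) auto
      also have "\<dots> \<le> (\<Sum>j\<le>k. poisson_moment (real (Suc k) / (T * (1 + h))) j)"
        by (rule zeta_moment_le[OF T h])
      also have "\<dots> \<le> F (T * (1 + h)) + R T"
        using E[of "T * (1 + h)"] T h by (simp add: algebra_simps abs_le_iff)
      finally have "zeta_moment T \<le> U T"
        using elim by (simp add: U_def h_def pos_le_divide_eq power_gt1 del: power_one_over)
      moreover have "L T \<le> zeta_moment T"
      proof -
        have hh: "1 - h \<ge> 1 / 2" using elim(4) by (simp add: h_def)
        have "T * (1 - h) \<ge> T * (1 / 2)" using hh T by (intro mult_left_mono) auto
        moreover have "T * (1 - h) \<le> T * 1" using h T by (intro mult_left_mono) auto
        ultimately have "F (T * (1 - h)) - R T \<le> (\<Sum>j\<le>k. poisson_moment (real (Suc k) / (T * (1 - h))) j)"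
          using E[of "T * (1 - h)"] T by (simp add: abs_le_iff)
        also have "\<dots> \<le> zeta_moment T + 3 * exp (- (real (Suc k) * h\<^sup>2 / 4)) * zeta_laplace T"
          unfolding zeta_laplace_def by (rule zeta_moment_ge[OF T h kh(1)])
        also have "3 * exp (- (real (Suc k) * h\<^sup>2 / 4)) * zeta_laplace T \<le> 3 * (1 / T ^ 2) * (T * (ln T + \<kappa>) + C * sqrt T)"
        proof (intro mult_mono e(2) mult_left_mono)
          show "zeta_laplace T \<le> T * (ln T + \<kappa>) + C * sqrt T" using elim(5) by (simp add: abs_le_iff)
          show "zeta_laplace T \<ge> 0"
            unfolding zeta_laplace_def by (intro Bochner_Integration.integral_nonneg mult_nonneg_nonneg zeta_sq_nonneg) auto
        qed auto
        finally show ?thesis by (simp add: L_def h_def)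
      qed
      ultimately show ?case by blast
    qed
  qed
  have "(\<lambda>T. U T - F T) \<in> O(\<lambda>T. T / ln T)" "(\<lambda>T. L T - F T) \<in> O(\<lambda>T. T / ln T)"
    unfolding U_def L_def F_def R_def by real_asymp+
  then obtain c1 c2 where c: "c1 > 0" "c2 > 0"
    "eventually (\<lambda>T. norm (U T - F T) \<le> c1 * norm (T / ln T)) at_top"
    "eventually (\<lambda>T. norm (L T - F T) \<le> c2 * norm (T / ln T)) at_top"
    by (elim landau_o.bigE)
  have "(\<lambda>T. zeta_moment T - F T) \<in> O(\<lambda>T. T / ln T)"
  proof (rule bigoI[of _ "c1 + c2"])
    show "eventually (\<lambda>T. norm (zeta_moment T - F T) \<le> (c1 + c2) * norm (T / ln T)) at_top"
      using c(3,4) bounds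
    proof eventually_elim
      case (elim T)
      have "0 \<le> c1 * norm (T / ln T)" "0 \<le> c2 * norm (T / ln T)" using c(1,2) by auto
      thus ?case using elim unfolding distrib_right real_norm_def by linarith
    qed
  qed
  thus ?thesis
    using that[of \<kappa>] lapO by (simp add: F_def m_def add_diff_eq add.assoc)
qed

section \<open>Jacob's ladders\<close>

text \<open>The squared phase is \<open>exp (- \<i> * t * ln pi)\<close> times the quotient of Gamma
  at \<open>1/4 + \<i> * t / 2\<close> by its conjugate. Reflection and Legendre duplication
  identify it with the factor of the functional equation, which carries \<open>zeta s\<close> to its
  conjugate.\<close>

lemma hardy_Z_square: "(hardy_Z t)\<^sup>2 = of_real (zeta_sq t)"
proof -
  define s where "s = Complex (1/2) t"
  define z where "z = Complex (1/4) (t / 2)"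
  define G where "G = Gamma z"
  have zs: "2 * z = s" "1 - s = cnj s" "(1 - s) / 2 = cnj z"
    by (auto simp: z_def s_def complex_eq_iff)
  have not_int: "z \<notin> \<int>\<^sub>\<le>\<^sub>0" "z + 1/2 \<notin> \<int>\<^sub>\<le>\<^sub>0"
    by (auto elim!: nonpos_Ints_cases' simp: z_def complex_eq_iff)
  have G: "G \<noteq> 0" using not_int(1) by (simp add: G_def Gamma_eq_zero_iff)
  have G2: "Gamma (z + 1/2) \<noteq> 0" using not_int(2) by (simp add: Gamma_eq_zero_iff)
  have phase: "exp (\<i> * of_real (vartheta t)) ^ 2 = exp (- \<i> * of_real (t * ln pi)) * (G / cnj G)"
  proof -
    define L where "L = ln_Gamma z"
    have "G = exp L" using not_int(1) by (simp add: G_def L_def Gamma_complex_altdef)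
    hence "G / cnj G = exp (L - cnj L)" by (simp add: exp_diff exp_cnj)
    also have "L - cnj L = \<i> * of_real (2 * Im L)" by (simp add: complex_eq_iff)
    finally have "exp (- \<i> * of_real (t * ln pi)) * (G / cnj G) = exp (2 * (\<i> * of_real (vartheta t)))"
      by (simp add: vartheta_def L_def z_def exp_add[symmetric] algebra_simps)
    thus ?thesis by (simp only: exp_double)
  qed
  have "exp (- \<i> * of_real (t * ln pi)) * (G / cnj G) = 2 * (2 * of_real pi) powr (- s) * cos (of_real pi * s / 2) * Gamma s"
  proof -
    have "Gamma (cnj z) * Gamma (1 - cnj z) = of_real pi / sin (of_real pi * cnj z)"
      by (rule Gamma_reflection_complex)
    also have "1 - cnj z = z + 1/2" by (simp add: z_def complex_eq_iff)
    also have "of_real pi * cnj z = of_real (pi / 2) - of_real pi * s / 2"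
      by (simp add: z_def s_def complex_eq_iff)
    also have "sin (of_real (pi / 2) - of_real pi * s / 2) = cos (of_real pi * s / 2)"
      by (simp add: sin_diff sin_of_real cos_of_real)
    finally have refl: "cnj G * Gamma (z + 1/2) * cos (of_real pi * s / 2) = of_real pi"
      using cos_crit_nonzero[of t] by (simp add: G_def cnj_Gamma s_def)
    have dup: "G * Gamma (z + 1/2) = exp ((1 - s) * of_real (ln 2)) * of_real (sqrt pi) * Gamma s"
      using Gamma_legendre_duplication[OF not_int] unfolding zs(1) by (simp add: G_def)
    have p: "(2 * of_real pi) powr (- s) = exp (- s * of_real (ln 2)) * exp (- s * of_real (ln pi))"
    proof -
      have "Ln (complex_of_real (2 * pi)) = of_real (ln 2) + of_real (ln pi)"
        by (subst Ln_of_real) (auto simp: ln_mult)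
      thus ?thesis by (simp add: powr_def distrib_left flip: exp_add)
    qed
    have "2 * exp (- s * of_real (ln 2)) = exp ((1 - s) * of_real (ln 2))"
    proof -
      have "exp ((1 - s) * of_real (ln 2)) = exp (of_real (ln 2)) * exp (- s * of_real (ln 2))"
        unfolding exp_add[symmetric] by (simp add: algebra_simps)
      also have "exp (of_real (ln 2)) = (2 :: complex)" by (subst exp_of_real) simp
      finally show ?thesis by simp
    qed
    hence "2 * (2 * of_real pi) powr (- s) * cos (of_real pi * s / 2) * Gamma s * (cnj G * Gamma (z + 1/2)) * of_real (sqrt pi) =
       exp (- s * of_real (ln pi)) * (exp ((1 - s) * of_real (ln 2)) * of_real (sqrt pi) * Gamma s) *
       (cnj G * Gamma (z + 1/2) * cos (of_real pi * s / 2))"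
      unfolding p by (simp add: mult_ac)
    also have "\<dots> = exp (- s * of_real (ln pi)) * (of_real (sqrt pi) * of_real (sqrt pi)) * (G * Gamma (z + 1/2))"
      unfolding refl dup[symmetric] by (simp flip: of_real_mult)
    finally have "2 * (2 * of_real pi) powr (- s) * cos (of_real pi * s / 2) * Gamma s * cnj G =
        exp (- s * of_real (ln pi)) * of_real (sqrt pi) * G"
      using G2 by (simp add: mult.assoc)
    also have "of_real (sqrt pi) = exp (of_real (ln pi / 2) :: complex)"
      by (subst exp_of_real) (simp add: ln_sqrt[symmetric])
    also have "exp (- s * of_real (ln pi)) * exp (of_real (ln pi / 2)) = exp (- \<i> * of_real (t * ln pi))"
      unfolding exp_add[symmetric] by (intro arg_cong[of _ _ exp]) (simp add: s_def complex_eq_iff)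
    finally show ?thesis using G by (simp add: field_simps)
  qed
  hence "(hardy_Z t)\<^sup>2 = zeta s * (2 * (2 * of_real pi) powr (- s) * cos (of_real pi * s / 2) * Gamma s * zeta s)"
    unfolding hardy_Z_def power_mult_distrib phase s_def[symmetric] by (simp add: power2_eq_square)
  also have "2 * (2 * of_real pi) powr (- s) * cos (of_real pi * s / 2) * Gamma s * zeta s = cnj (zeta s)"
    using zeta_reflection[of s] by (simp add: zs(2) zeta_cnj) (simp add: s_def)
  also have "zeta s * cnj (zeta s) = of_real (zeta_sq t)"
    using complex_norm_square[of "zeta s"] by (simp add: zeta_sq_def s_def)
  finally show ?thesis .
qed

text \<open>Otherwise zeta would vanish identically by the identity theorem, against the value 1 of
  \<open>zeta_regular\<close> at the pole.\<close>

lemma zeta_sq_pos_between: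
  assumes "0 \<le> a" "a < b"
  obtains t where "a < t" "t < b" "zeta_sq t > 0"
proof -
  have "\<not> (\<forall>t\<in>{a<..<b}. zeta_sq t = 0)"
  proof
    assume zero: "\<forall>t\<in>{a<..<b}. zeta_sq t = 0"
    define m where "m = (a + b) / 2"
    have lim: "Complex (1/2) m islimpt Complex (1/2) ` {a<..<b}"
    proof (rule islimpt_isCont_image)
      show "m islimpt {a<..<b}" using assms by (intro interior_limit_point) (auto simp: m_def interior_open)
      have "continuous_on UNIV (Complex (1/2))" by (rule Complex_line_continuous)
      thus "isCont (Complex (1/2)) m" by (simp add: continuous_on_eq_continuous_at)
      show "eventually (\<lambda>y. Complex (1/2) y \<noteq> Complex (1/2) m) (at m)"
        by (simp add: eventually_at_filter)
    qed
    have "zeta s = 0" if "s \<noteq> 1" for s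
    proof (rule analytic_continuation[of zeta "UNIV - {1}" "Complex (1/2) ` {a<..<b}" "Complex (1/2) m"])
      show "connected (UNIV - {1 :: complex})"
        using connected_punctured_universe[of "1 :: complex"] by (simp add: Compl_eq_Diff_UNIV)
      show "zeta z = 0" if "z \<in> Complex (1/2) ` {a<..<b}" for z
        using that zero by (auto simp: zeta_sq_def)
    qed (use that lim in \<open>auto intro!: zeta_holomorphic simp: complex_eq_iff\<close>)
    hence "zeta_regular s = 0" if "Re s > -1" "s \<noteq> 1" for s
      using zeta_eq_zeta_regular[OF that] that by auto
    moreover have "isCont zeta_regular 1"
    proof -
      have "zeta_regular holomorphic_on {s. Re s > -1}" by (rule zeta_regular_holomorphic) simp
      hence "continuous_on {s. Re s > -1} zeta_regular" by (rule holomorphic_on_imp_continuous_on)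
      thus ?thesis by (subst (asm) continuous_on_eq_continuous_at[OF open_halfspace_Re_gt]) auto
    qed
    moreover have "eventually (\<lambda>s. s \<in> {s. Re s > -1} - {1}) (at (1 :: complex))"
      by (rule eventually_at_in_open[OF open_halfspace_Re_gt]) simp
    ultimately have "(zeta_regular \<longlongrightarrow> 0) (at 1)"
      by (intro tendsto_eventually) (auto elim!: eventually_mono)
    moreover have "(zeta_regular \<longlongrightarrow> 1) (at 1)"
      using \<open>isCont zeta_regular 1\<close> unfolding isCont_def by (simp add: zeta_regular_def)
    ultimately show False using tendsto_unique[of "at (1::complex)"] by force
  qed
  thus ?thesis using that zeta_sq_nonneg by (metis greaterThanLessThan_iff order_le_less)
qed

text \<open>Left side of the ladder equation, with \<open>y\<close> the value of
  \<open>\<phi>\<close>; a ladder value \<open>V\<close> therefore appears as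
  \<open>y = 2 * V\<close>.\<close>

definition truncated_laplace :: "real \<Rightarrow> real \<Rightarrow> real" where
  "truncated_laplace m y = integral {0..m} (\<lambda>t. zeta_sq t * exp (- (2 / y) * t))"

lemma truncated_laplace_integrand:
  "(\<lambda>t. zeta_sq t * exp (- (2 / y) * t)) integrable_on {a..b}"
  by (intro integrable_continuous_real continuous_intros zeta_sq_continuous)

lemma truncated_laplace_hardy:
  "integral {0..m} (\<lambda>t. (hardy_Z t)\<^sup>2 * exp (of_real (- (2 / y) * t))) = of_real (truncated_laplace m y)"
proof -
  have "((\<lambda>t. complex_of_real (zeta_sq t * exp (- (2 / y) * t))) has_integral of_real (truncated_laplace m y)) {0..m}"
    unfolding truncated_laplace_def
    by (intro has_integral_of_real integrable_integral truncated_laplace_integrand)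
  hence "((\<lambda>t. (hardy_Z t)\<^sup>2 * exp (of_real (- (2 / y) * t))) has_integral of_real (truncated_laplace m y)) {0..m}"
    by (simp only: hardy_Z_square exp_of_real of_real_mult[symmetric])
  thus ?thesis by (rule integral_unique)
qed

lemma zeta_moment_hardy: "integral {0..T} (\<lambda>t. (hardy_Z t)\<^sup>2) = of_real (zeta_moment T)"
  unfolding hardy_Z_square zeta_moment_def
  by (rule integral_unique[OF has_integral_of_real[OF integrable_integral[OF zeta_sq_integrable_on]]])

text \<open>Enlarging \<open>y\<close> increases the exponential at every \<open>t > 0\<close>, and
  \<open>zeta_sq\<close> is positive somewhere in the range. Strictness makes the ladder equation
  determine the value of \<open>\<phi>\<close>.\<close>

lemma truncated_laplace_strict_mono:
  assumes m: "0 < m" "m \<le> m'" and y: "0 < y" "y < y'"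
  shows "truncated_laplace m y < truncated_laplace m' y'"
proof -
  define f where "f = (\<lambda>t. zeta_sq t * exp (- (2 / y') * t) - zeta_sq t * exp (- (2 / y) * t))"
  have exp_less: "exp (- (2 / y) * t) < exp (- (2 / y') * t)" if "t > 0" for t
    using y that by (simp add: divide_strict_left_mono mult_strict_right_mono)
  have f_nonneg: "f t \<ge> 0" if "t \<in> {0..m}" for t
    using that exp_less[of t] zeta_sq_nonneg[of t] unfolding f_def right_diff_distrib[symmetric]
    by (cases "t = 0") auto
  have f_cont: "continuous_on {0..m} f"
    unfolding f_def by (intro continuous_intros zeta_sq_continuous)
  have "integral {0..m} f \<noteq> 0"
  proof
    assume "integral {0..m} f = 0"
    hence "\<forall>t\<in>{0..m}. f t = 0"
      using integral_eq_0_iff[OF f_cont] f_nonneg m by auto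
    moreover obtain t where "0 < t" "t < m" "zeta_sq t > 0"
      using zeta_sq_pos_between[of 0 m] m by auto
    ultimately show False
      using exp_less[of t] by (auto simp: f_def right_diff_distrib[symmetric] dest: bspec[of _ _ t])
  qed
  moreover have "integral {0..m} f \<ge> 0"
    using f_nonneg by (intro integral_nonneg integrable_continuous_real f_cont)
  moreover have "integral {0..m} f = truncated_laplace m y' - truncated_laplace m y"
    unfolding f_def truncated_laplace_def by (intro integral_diff truncated_laplace_integrand)
  moreover have "truncated_laplace m y' \<le> truncated_laplace m' y'"
    unfolding truncated_laplace_def using m
    by (intro integral_subset_le truncated_laplace_integrand) (auto simp: zeta_sq_nonneg)
  ultimately show ?thesis by linarith
qed

text \<open>Beyond \<open>m\<close>, half of the exponent \<open>t / V\<close> is bounded by its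
  value at \<open>m\<close>, while the other half keeps the integral convergent and produces
  \<open>zeta_laplace (2 * V)\<close>.\<close>

lemma truncated_laplace_tail:
  assumes V: "V > 0" and m: "m \<ge> 0"
  shows "\<bar>zeta_laplace V - truncated_laplace m (2 * V)\<bar> \<le> exp (- (m / (2 * V))) * zeta_laplace (2 * V)"
proof -
  define h where "h = (\<lambda>t. indicator {0..} t * zeta_sq t)"
  have h: "h t \<ge> 0" for t by (simp add: h_def zeta_sq_nonneg)
  have int: "integrable lborel (\<lambda>t. h t * exp (- (1 / W) * t))" if "W > 0" for W
    unfolding h_def using that by (intro integrable_zeta_sq_exp) simp
  have si: "set_integrable lborel {0..m} (\<lambda>t. zeta_sq t * exp (- (2 / (2 * V)) * t))"
    by (intro borel_integrable_atLeastAtMost' continuous_intros zeta_sq_continuous)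
  have trunc: "truncated_laplace m (2 * V) = (\<integral>t. indicator {0..m} t * (zeta_sq t * exp (- (1 / V) * t)) \<partial>lborel)"
    using set_borel_integral_eq_integral(2)[OF si]
    by (simp add: truncated_laplace_def set_lebesgue_integral_def)
  have ti: "integrable lborel (\<lambda>t. indicator {0..m} t * (zeta_sq t * exp (- (1 / V) * t)))"
    using si by (simp add: set_integrable_def)
  have zl: "zeta_laplace W = (\<integral>t. h t * exp (- (1 / W) * t) \<partial>lborel)" for W
    by (simp add: zeta_laplace_def h_def)
  have eq: "zeta_laplace V - truncated_laplace m (2 * V) =
     (\<integral>t. h t * exp (- (1 / V) * t) - indicator {0..m} t * (zeta_sq t * exp (- (1 / V) * t)) \<partial>lborel)"
    unfolding trunc zl using int[OF V] ti by simp
  have "norm (zeta_laplace V - truncated_laplace m (2 * V)) \<le>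
      (\<integral>t. exp (- (m / (2 * V))) * (h t * exp (- (1 / (2 * V)) * t)) \<partial>lborel)"
    unfolding eq
  proof (rule norm_integral_le)
    show "integrable lborel (\<lambda>t. exp (- (m / (2 * V))) * (h t * exp (- (1 / (2 * V)) * t)))"
      using V by (intro integrable_mult_right int) simp
    fix t :: real
    have nn: "0 \<le> exp (- (m / (2 * V))) * (h t * exp (- (1 / (2 * V)) * t))"
      using h by simp
    show "norm (h t * exp (- (1 / V) * t) - indicator {0..m} t * (zeta_sq t * exp (- (1 / V) * t))) \<le>
        exp (- (m / (2 * V))) * (h t * exp (- (1 / (2 * V)) * t))"
    proof (cases "t > m")
      case True
      have "- (1 / V) * t = - (t / (2 * V)) + - (1 / (2 * V)) * t"
        using V by (simp add: field_simps)
      hence "exp (- (1 / V) * t) = exp (- (t / (2 * V))) * exp (- (1 / (2 * V)) * t)"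
        by (simp only: exp_add)
      also have "\<dots> \<le> exp (- (m / (2 * V))) * exp (- (1 / (2 * V)) * t)"
        using True V by (intro mult_right_mono) (auto simp: divide_right_mono)
      finally have "h t * exp (- (1 / V) * t) \<le> h t * (exp (- (m / (2 * V))) * exp (- (1 / (2 * V)) * t))"
        using h by (intro mult_left_mono)
      thus ?thesis using True h[of t] by (simp add: mult_ac)
    next
      case False
      thus ?thesis using nn by (auto simp: h_def indicator_def)
    qed
  qed
  also have "\<dots> = exp (- (m / (2 * V))) * zeta_laplace (2 * V)"
    by (simp only: zl integral_mult_right_zero)
  finally show ?thesis by (simp only: real_norm_def)
qed

text \<open>Admissibility of \<open>\<mu>\<close> makes the truncation factor at most
  \<open>(2 * V) ^ (-7)\<close>, which beats the growth of \<open>zeta_laplace (2 * V)\<close> and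
  leaves an error below \<open>sqrt V\<close>.\<close>

lemma zeta_laplace_truncated_asymp:
  assumes \<kappa>: "(\<lambda>V. zeta_laplace V - V * (ln V + \<kappa>)) \<in> O(sqrt)"
  obtains C V0 where "C > 0" "V0 \<ge> 1"
    "\<And>V m. V \<ge> V0 \<Longrightarrow> m \<ge> 7 * (2 * V) * ln (2 * V) \<Longrightarrow>
       \<bar>truncated_laplace m (2 * V) - V * (ln V + \<kappa>)\<bar> \<le> C * sqrt V"
proof -
  obtain c where c: "c > 0" "eventually (\<lambda>V. norm (zeta_laplace V - V * (ln V + \<kappa>)) \<le> c * norm (sqrt V)) at_top"
    using \<kappa> by (elim landau_o.bigE)
  then obtain V1 where V1: "\<And>V. V \<ge> V1 \<Longrightarrow> norm (zeta_laplace V - V * (ln V + \<kappa>)) \<le> c * norm (sqrt V)"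
    unfolding eventually_at_top_linorder by blast
  have "eventually (\<lambda>V::real. 2 * V * (ln (2 * V) + \<kappa>) + c * sqrt (2 * V) \<le> (2 * V) ^ 7) at_top"
    by real_asymp
  then obtain V2 where V2: "\<And>V. V \<ge> V2 \<Longrightarrow> 2 * V * (ln (2 * V) + \<kappa>) + c * sqrt (2 * V) \<le> (2 * V) ^ 7"
    unfolding eventually_at_top_linorder by blast
  define V0 where "V0 = Max {V1, V2, 1}"
  have "\<bar>truncated_laplace m (2 * V) - V * (ln V + \<kappa>)\<bar> \<le> (c + 1) * sqrt V"
    if V: "V \<ge> V0" and m: "m \<ge> 7 * (2 * V) * ln (2 * V)" for V m
  proof -
    have V': "V \<ge> V1" "V \<ge> V2" "V \<ge> 1" "2 * V \<ge> V1" using V by (auto simp: V0_def)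
    have "7 * (2 * V) * ln (2 * V) \<ge> 0" using V' by (intro mult_nonneg_nonneg ln_ge_zero) auto
    hence m0: "m \<ge> 0" using m by linarith
    have "m / (2 * V) \<ge> 7 * ln (2 * V)" using m V' by (simp add: field_simps)
    hence "exp (- (m / (2 * V))) \<le> exp (- (7 * ln (2 * V)))" by simp
    also have "exp (- (7 * ln (2 * V))) = 1 / (2 * V) ^ 7"
    proof -
      have "exp (7 * ln (2 * V)) = exp (ln (2 * V)) ^ 7"
        using exp_of_nat_mult[of 7 "ln (2 * V)"] by simp
      thus ?thesis using V' by (simp add: exp_minus inverse_eq_divide)
    qed
    finally have e: "exp (- (m / (2 * V))) \<le> 1 / (2 * V) ^ 7" .
    have "zeta_laplace (2 * V) \<le> 2 * V * (ln (2 * V) + \<kappa>) + c * sqrt (2 * V)"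
      using V1[OF V'(4)] V' by (simp add: abs_le_iff)
    also have "\<dots> \<le> (2 * V) ^ 7" by (rule V2[OF V'(2)])
    finally have z: "zeta_laplace (2 * V) \<le> (2 * V) ^ 7" .
    have "\<bar>zeta_laplace V - truncated_laplace m (2 * V)\<bar> \<le> exp (- (m / (2 * V))) * zeta_laplace (2 * V)"
      using V' m0 by (intro truncated_laplace_tail) auto
    also have "\<dots> \<le> exp (- (m / (2 * V))) * (2 * V) ^ 7"
      using z by (intro mult_left_mono) auto
    also have "\<dots> \<le> 1 / (2 * V) ^ 7 * (2 * V) ^ 7"
      using e V' by (intro mult_right_mono) auto
    also have "\<dots> = 1" using V' by simp
    also have "1 \<le> sqrt V" using V' by simp
    finally have "\<bar>zeta_laplace V - truncated_laplace m (2 * V)\<bar> \<le> sqrt V" .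
    moreover have "\<bar>zeta_laplace V - V * (ln V + \<kappa>)\<bar> \<le> c * sqrt V"
      using V1[OF V'(1)] V' by simp
    ultimately show ?thesis unfolding distrib_right by linarith
  qed
  thus ?thesis using that[of "c + 1" V0] c(1) by (auto simp: V0_def)
qed

text \<open>If \<open>V\<close> is the value of a Jacob's ladder at \<open>U\<close>, then \<open>zeta_moment U\<close> exceeds
  \<open>zeta_moment V\<close> by \<open>(1 - \<gamma>) V\<close> up to lower order, so that \<open>U - V\<close> is of order \<open>V / ln V\<close>.\<close>

lemma ladder_interval:
  fixes \<kappa> :: real
  assumes moment: "(\<lambda>T. zeta_moment T - T * (ln T + \<kappa> + euler_mascheroni - 1)) \<in> O(\<lambda>T. T / ln T)"
    and C: "C > 0"
  obtains K g V0 where "K > 0" "g > 0" "V0 \<ge> 3"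
    "\<And>U V. V \<ge> V0 \<Longrightarrow> \<bar>zeta_moment U - V * (ln V + \<kappa>)\<bar> \<le> C * sqrt V \<Longrightarrow>
       V < U \<and> U \<le> 2 * V \<and> U - V \<ge> g * V / ln V \<and>
       \<bar>(zeta_moment U - zeta_moment V) - (U - V) * ln V\<bar> \<le> K * (U - V)"
    "\<And>V. V \<ge> V0 \<Longrightarrow> V * (ln V + \<kappa>) + C * sqrt V \<le> zeta_moment (2 * V)"
proof -
  define m where "m = \<kappa> + euler_mascheroni - 1"
  define F where "F = (\<lambda>T::real. T * (ln T + m))"
  \<comment> \<open>Here \<open>\<gamma>\<close> is 1 minus Euler's constant. Its positivity forces
    \<open>U\<close> to lie above \<open>V\<close>.\<close>
  define \<gamma> where "\<gamma> = (1 - euler_mascheroni :: real)"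
  have \<gamma>: "\<gamma> > 0" using euler_mascheroni_less_13_over_22 by (simp add: \<gamma>_def)
  obtain c where c: "c > 0"
    "eventually (\<lambda>T. norm (zeta_moment T - T * (ln T + \<kappa> + euler_mascheroni - 1)) \<le> c * norm (T / ln T)) at_top"
    using moment by (elim landau_o.bigE)
  then obtain T1 where T1: "\<And>T. T \<ge> T1 \<Longrightarrow>
      norm (zeta_moment T - T * (ln T + \<kappa> + euler_mascheroni - 1)) \<le> c * norm (T / ln T)"
    unfolding eventually_at_top_linorder by blast
  have "eventually (\<lambda>V::real. c * (V / ln V) + C * sqrt V \<le> \<gamma> / 2 * V) at_top"
    "eventually (\<lambda>V::real. 2 * V * (ln (2 * V) + m) - c * (2 * V / ln (2 * V)) > V * (ln V + \<kappa>) + C * sqrt V) at_top"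
    "eventually (\<lambda>V::real. 3 * c * (V / ln V) \<le> \<gamma> / 4 * V) at_top"
    "eventually (\<lambda>V::real. ln V \<ge> \<bar>m\<bar> + 2) at_top"
    using \<gamma> c(1) by real_asymp+
  hence "eventually (\<lambda>V::real. c * (V / ln V) + C * sqrt V \<le> \<gamma> / 2 * V \<and>
      2 * V * (ln (2 * V) + m) - c * (2 * V / ln (2 * V)) > V * (ln V + \<kappa>) + C * sqrt V \<and>
      3 * c * (V / ln V) \<le> \<gamma> / 4 * V \<and> ln V \<ge> \<bar>m\<bar> + 2) at_top"
    by (intro eventually_conj)
  then obtain V1 where V1: "\<And>V. V \<ge> V1 \<Longrightarrow> c * (V / ln V) + C * sqrt V \<le> \<gamma> / 2 * V"
    "\<And>V. V \<ge> V1 \<Longrightarrow> 2 * V * (ln (2 * V) + m) - c * (2 * V / ln (2 * V)) > V * (ln V + \<kappa>) + C * sqrt V"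
    "\<And>V. V \<ge> V1 \<Longrightarrow> 3 * c * (V / ln V) \<le> \<gamma> / 4 * V"
    "\<And>V. V \<ge> V1 \<Longrightarrow> ln V \<ge> \<bar>m\<bar> + 2"
    unfolding eventually_at_top_linorder by blast
  define V0 where "V0 = Max {V1, T1, 3}"
  \<comment> \<open>Of the surplus \<open>\<gamma> / 2 * V\<close>, the remainder terms may use up
    \<open>\<gamma> / 4 * V\<close>; what is left is at most \<open>2 * H * ln V\<close>, whence the
    8.\<close>
  define g where "g = \<gamma> / 8"
  have g: "g > 0" using \<gamma> by (simp add: g_def)
  define K where "K = \<bar>m\<bar> + 2 + 3 * c / g"
  have K: "K > 0" unfolding K_def using c(1) g by (intro add_nonneg_pos add_pos_pos) auto
  have a: "\<bar>zeta_moment T - F T\<bar> \<le> c * (T / ln T)" if "T \<ge> V0" for T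
  proof -
    have "T \<ge> T1" "T \<ge> 3" using that by (auto simp: V0_def)
    moreover from this have "T / ln T \<ge> 0" by simp
    ultimately show ?thesis using T1[of T] by (simp add: F_def m_def add_diff_eq add.assoc)
  qed
  \<comment> \<open>The leading term more than doubles from \<open>V\<close> to
    \<open>2 * V\<close>. This later supplies the upper end for the intermediate value
    theorem.\<close>
  have twice: "V * (ln V + \<kappa>) + C * sqrt V \<le> zeta_moment (2 * V)" if "V \<ge> V0" for V
  proof -
    have "V * (ln V + \<kappa>) + C * sqrt V < F (2 * V) - c * (2 * V / ln (2 * V))"
      unfolding F_def using that by (intro V1(2)) (auto simp: V0_def)
    also have "\<dots> \<le> zeta_moment (2 * V)"
      using a[of "2 * V"] that by (simp add: abs_le_iff V0_def)
    finally show ?thesis by simp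
  qed
  have "V < U \<and> U \<le> 2 * V \<and> U - V \<ge> g * V / ln V \<and>
       \<bar>(zeta_moment U - zeta_moment V) - (U - V) * ln V\<bar> \<le> K * (U - V)"
    if V: "V \<ge> V0" and U: "\<bar>zeta_moment U - V * (ln V + \<kappa>)\<bar> \<le> C * sqrt V" for U V
  proof -
    have V': "V \<ge> V1" "V \<ge> T1" "V \<ge> 3" using V by (auto simp: V0_def)
    have lnV: "ln V \<ge> \<bar>m\<bar> + 2" by (rule V1(4)[OF V'(1)])
    have FV: "F V = V * (ln V + \<kappa>) - \<gamma> * V" by (simp add: F_def m_def \<gamma>_def algebra_simps)
    have D: "zeta_moment U - zeta_moment V \<ge> \<gamma> / 2 * V"
      using a[OF V] U V1(1)[OF V'(1)] unfolding FV abs_le_iff by linarith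
    moreover have "\<gamma> / 2 * V > 0" using \<gamma> V' by simp
    ultimately have "zeta_moment U > zeta_moment V" by linarith
    hence UV: "V < U" using zeta_moment_mono[of U V] by (meson not_le)
    have "U \<le> 2 * V"
    proof (rule ccontr)
      assume "\<not> U \<le> 2 * V"
      hence "F (2 * V) - c * (2 * V / ln (2 * V)) \<le> zeta_moment U"
        using a[of "2 * V"] V V' zeta_moment_mono[of "2 * V" U] by (simp add: abs_le_iff)
      thus False using V1(2)[OF V'(1)] U by (simp add: F_def abs_le_iff)
    qed
    note U2 = this
    define H where "H = U - V"
    have H: "H > 0" using UV by (simp add: H_def)
    \<comment> \<open>The first summand carries the main term \<open>H * ln V\<close>; the change of
      the logarithm across the interval contributes only O(H).\<close>
    have "F U - F V = H * (ln V + m) + U * ln (U / V)"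
      using UV V' by (simp add: F_def H_def ln_div algebra_simps)
    moreover have "0 \<le> U * ln (U / V)" using UV V' by (intro mult_nonneg_nonneg ln_ge_zero) auto
    moreover have "U * ln (U / V) \<le> 2 * H"
    proof -
      have "ln (U / V) \<le> U / V - 1" using UV V' by (intro ln_le_minus_one) auto
      also have "\<dots> = H / V" using V' by (simp add: H_def diff_divide_distrib)
      finally have "U * ln (U / V) \<le> (2 * V) * (H / V)"
        using U2 UV V' by (intro mult_mono ln_ge_zero) auto
      thus ?thesis using V' by simp
    qed
    moreover have "\<bar>H * m\<bar> = \<bar>m\<bar> * H" using H by (simp add: abs_mult)
    ultimately have FF: "\<bar>F U - F V - H * ln V\<bar> \<le> (\<bar>m\<bar> + 2) * H"
      unfolding distrib_left distrib_right by linarith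
    have "U / ln U \<le> 2 * V / ln V"
      using U2 UV V' lnV by (intro frac_le) auto
    hence "c * (U / ln U) \<le> c * (2 * V / ln V)" using c(1) by (intro mult_left_mono) auto
    also have "\<dots> = 2 * (c * (V / ln V))" by simp
    moreover have "3 * c * (V / ln V) = 3 * (c * (V / ln V))" by simp
    moreover have "\<bar>zeta_moment U - F U\<bar> \<le> c * (U / ln U)" using V UV by (intro a) linarith
    ultimately have err: "\<bar>(zeta_moment U - zeta_moment V) - (F U - F V)\<bar> \<le> 3 * c * (V / ln V)"
      using a[OF V] by linarith
    have HV: "H \<ge> g * V / ln V"
    proof -
      have "\<gamma> / 2 * V \<le> (H * ln V + (\<bar>m\<bar> + 2) * H) + \<gamma> / 4 * V"
        using D FF err V1(3)[OF V'(1)] by linarith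
      moreover have "(\<bar>m\<bar> + 2) * H \<le> ln V * H" using lnV H by (intro mult_right_mono) auto
      ultimately have "g * V \<le> H * ln V" by (simp add: g_def mult.commute)
      thus ?thesis using lnV by (subst pos_divide_le_eq) auto
    qed
    \<comment> \<open>The remainder of order \<open>V / ln V\<close> is O(H) by the lower bound for
      \<open>H\<close>; this is where the precision of the mean square is used up.\<close>
    have "3 * c * (V / ln V) \<le> 3 * c / g * H"
    proof -
      have "3 * c / g * (g * V / ln V) \<le> 3 * c / g * H"
        using HV c(1) g by (intro mult_left_mono) auto
      thus ?thesis using g by simp
    qed
    hence "\<bar>(zeta_moment U - zeta_moment V) - H * ln V\<bar> \<le> K * H"
      using FF err unfolding K_def distrib_right by linarith
    thus ?thesis using UV U2 HV by (simp add: H_def)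
  qed
  moreover have "V0 \<ge> 3" by (simp add: V0_def)
  ultimately show ?thesis using that[of K g V0] K g twice by blast
qed

section \<open>The quotient and its iteration\<close>

text \<open>The lower bound on \<open>L\<close> keeps \<open>I\<close> above
  \<open>c * H / 2\<close>. In \<open>c * D - I * L\<close> the main terms cancel, and the relative
  error \<open>S / L\<close> of \<open>I\<close> times \<open>L\<close> is bounded.\<close>

lemma ratio_bound:
  fixes D I H L c K S :: real
  assumes "c > 0" "H > 0" "L > 0" "K \<ge> 0" "S \<ge> 0" "L \<ge> 2 * S / c"
    and D: "\<bar>D - H * L\<bar> \<le> K * H" and I: "\<bar>I - c * H\<bar> \<le> S * (H / L)"
  shows "\<bar>D / I - 1 / c * L\<bar> \<le> 2 * (c * K + S) / c\<^sup>2"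
proof -
  have "S / L \<le> c / 2" using assms(1,3,6) by (simp add: field_simps)
  hence "S / L * H \<le> c / 2 * H" using assms(2) by (intro mult_right_mono) auto
  moreover have "S * (H / L) = S / L * H" by simp
  ultimately have "I \<ge> c * H - c / 2 * H" using I unfolding abs_le_iff by linarith
  hence I2: "I \<ge> c * H / 2" by (simp add: mult.commute)
  have "c * H / 2 > 0" using assms(1,2) by simp
  hence I0: "I > 0" using I2 by linarith
  have "c * D - I * L = c * (D - H * L) - L * (I - c * H)" by (simp add: algebra_simps)
  hence "\<bar>c * D - I * L\<bar> \<le> \<bar>c * (D - H * L)\<bar> + \<bar>L * (I - c * H)\<bar>"
    by (simp only: abs_triangle_ineq4)
  also have "\<dots> = c * \<bar>D - H * L\<bar> + L * \<bar>I - c * H\<bar>" using assms by (simp add: abs_mult)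
  also have "\<dots> \<le> c * (K * H) + L * (S * (H / L))"
    using D I assms by (intro add_mono mult_left_mono) auto
  also have "\<dots> = (c * K + S) * H" using assms by (simp add: algebra_simps)
  finally have num: "\<bar>c * D - I * L\<bar> \<le> (c * K + S) * H" .
  have "D / I - 1 / c * L = (c * D - I * L) / (c * I)" using I0 assms(1) by (simp add: field_simps)
  hence "\<bar>D / I - 1 / c * L\<bar> = \<bar>c * D - I * L\<bar> / (c * I)" using I0 assms(1) by (simp add: abs_mult)
  also have "\<dots> \<le> ((c * K + S) * H) / (c * (c * H / 2))"
    using num I2 assms by (intro frac_le mult_left_mono mult_pos_pos mult_nonneg_nonneg) auto
  also have "\<dots> = 2 * (c * K + S) / c\<^sup>2" using assms by (simp add: power2_eq_square)
  finally show ?thesis .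
qed

text \<open>One estimate, uniform in every left endpoint \<open>V \<ge> V3\<close>, serves for all
  \<open>r\<close>, because the reverse iterates tend to infinity.\<close>

theorem theorem2:
  fixes \<phi>\<^sub>1 :: "real \<Rightarrow> real" and T\<^sub>0 c :: real and k l :: nat
  assumes "jacobs_ladder T\<^sub>0 \<phi>\<^sub>1"
    and "k \<ge> 1" and "l \<ge> 1"
    and "selberg_constant l c"
  shows "\<forall>r\<in>{1..k}.
    (\<lambda>T. integral {reverse_iterate T\<^sub>0 \<phi>\<^sub>1 (r - 1) T..reverse_iterate T\<^sub>0 \<phi>\<^sub>1 r T}
             (\<lambda>t. (cmod (zeta (Complex (1/2) t)))\<^sup>2) /
         integral {reverse_iterate T\<^sub>0 \<phi>\<^sub>1 (r - 1) T..reverse_iterate T\<^sub>0 \<phi>\<^sub>1 r T}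
             (\<lambda>t. \<bar>S1 t\<bar> ^ (2 * l))
         - 1 / c * ln (reverse_iterate T\<^sub>0 \<phi>\<^sub>1 (r - 1) T)) \<in> O[at_top](\<lambda>_. 1)"
proof -
  from assms(1) obtain y0 \<mu> \<phi> where T0: "T\<^sub>0 > 0" and \<mu>: "admissible y0 \<mu>"
    and \<phi>: "\<And>T. T \<ge> T\<^sub>0 \<Longrightarrow> \<phi> T \<ge> y0"
      "\<And>T. T \<ge> T\<^sub>0 \<Longrightarrow> integral {0..\<mu> (\<phi> T)} (\<lambda>t. (hardy_Z t)\<^sup>2 * exp (of_real (- (2 / \<phi> T) * t))) =
            integral {0..T} (\<lambda>t. (hardy_Z t)\<^sup>2)"
      "\<And>T. T \<ge> T\<^sub>0 \<Longrightarrow> \<phi>\<^sub>1 T = \<phi> T / 2"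
    unfolding jacobs_ladder_def by blast
  have y0: "y0 > 1" and \<mu>_ge: "\<And>y. y \<ge> y0 \<Longrightarrow> \<mu> y \<ge> 7 * y * ln y"
    and \<mu>_mono: "\<And>y y'. y0 \<le> y \<Longrightarrow> y \<le> y' \<Longrightarrow> \<mu> y \<le> \<mu> y'"
    using \<mu> by (auto simp: admissible_def mono_on_def)
  \<comment> \<open>The ladder equation reads \<open>G (\<phi> T) = zeta_moment T\<close>; as
    \<open>G\<close> is strictly increasing, it can be inverted.\<close>
  define G where "G = (\<lambda>y. truncated_laplace (\<mu> y) y)"
  have G_mono: "G y < G y'" if "y0 \<le> y" "y < y'" for y y'
  proof -
    have "7 * y * ln y > 0" using that y0 by simp
    thus ?thesis
      unfolding G_def using that y0 \<mu>_ge[of y] \<mu>_mono[of y y']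
      by (intro truncated_laplace_strict_mono) linarith+
  qed
  have G_\<phi>: "G (\<phi> T) = zeta_moment T" if "T \<ge> T\<^sub>0" for T
  proof -
    have "complex_of_real (G (\<phi> T)) = of_real (zeta_moment T)"
      using \<phi>(2)[OF that] unfolding truncated_laplace_hardy zeta_moment_hardy G_def .
    thus ?thesis by (simp only: of_real_eq_iff)
  qed
  obtain \<kappa> where \<kappa>: "(\<lambda>T. zeta_moment T - T * (ln T + \<kappa> + euler_mascheroni - 1)) \<in> O(\<lambda>T. T / ln T)"
    "(\<lambda>V. zeta_laplace V - V * (ln V + \<kappa>)) \<in> O(sqrt)"
    using zeta_moment_asymp by blast
  obtain C V1 where C: "C > 0" and V1: "V1 \<ge> 1"
    "\<And>V m. V \<ge> V1 \<Longrightarrow> m \<ge> 7 * (2 * V) * ln (2 * V) \<Longrightarrow>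
       \<bar>truncated_laplace m (2 * V) - V * (ln V + \<kappa>)\<bar> \<le> C * sqrt V"
    using zeta_laplace_truncated_asymp[OF \<kappa>(2)] by blast
  obtain K g V2 where K: "K > 0" "g > 0" and V2: "V2 \<ge> 3"
    "\<And>U V. V \<ge> V2 \<Longrightarrow> \<bar>zeta_moment U - V * (ln V + \<kappa>)\<bar> \<le> C * sqrt V \<Longrightarrow>
       V < U \<and> U \<le> 2 * V \<and> U - V \<ge> g * V / ln V \<and>
       \<bar>(zeta_moment U - zeta_moment V) - (U - V) * ln V\<bar> \<le> K * (U - V)"
    "\<And>V. V \<ge> V2 \<Longrightarrow> V * (ln V + \<kappa>) + C * sqrt V \<le> zeta_moment (2 * V)"
    using ladder_interval[OF \<kappa>(1) C] by blast
  have c: "c > 0" using assms(4) by (simp add: selberg_constant_def)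
  \<comment> \<open>Selberg's formula is used with \<open>a = 3/4\<close>: above 1/2, and below 1 so
    that \<open>V powr a\<close> is eventually smaller than the length of order
    \<open>V / ln V\<close>.\<close>
  have "1/2 < (3/4 :: real) \<and> (3/4 :: real) \<le> 1" by simp
  then obtain S T3 where S: "\<And>T H. T \<ge> T3 \<Longrightarrow> T powr (3/4) \<le> H \<Longrightarrow> H \<le> T \<Longrightarrow>
      \<bar>integral {T..T+H} (\<lambda>t. \<bar>S1 t\<bar> ^ (2*l)) - c * H\<bar> \<le> S * (H / ln T)"
    using assms(4) unfolding selberg_constant_def by blast
  define S' where "S' = \<bar>S\<bar>"
  define inv\<phi> where "inv\<phi> = inv_into {T\<^sub>0..} \<phi>\<^sub>1"
  have "eventually (\<lambda>V::real. V * (ln V + \<kappa>) - C * sqrt V > zeta_moment T\<^sub>0) at_top"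
    "eventually (\<lambda>V::real. V powr (3/4) \<le> g * V / ln V) at_top"
    "eventually (\<lambda>V::real. ln V \<ge> 2 * S' / c) at_top"
    using K(2) by real_asymp+
  hence "eventually (\<lambda>V::real. (V * (ln V + \<kappa>) - C * sqrt V > zeta_moment T\<^sub>0 \<and>
      V powr (3/4) \<le> g * V / ln V \<and> ln V \<ge> 2 * S' / c) \<and> V \<ge> V1 \<and> V \<ge> V2 \<and> V \<ge> T3 \<and> 2 * V \<ge> y0 \<and> V \<ge> T\<^sub>0) at_top"
  proof (intro eventually_conj eventually_ge_at_top)
    show "eventually (\<lambda>V::real. 2 * V \<ge> y0) at_top" by real_asymp
  qed
  then obtain V3 where V3: "\<And>V. V \<ge> V3 \<Longrightarrow> (V * (ln V + \<kappa>) - C * sqrt V > zeta_moment T\<^sub>0 \<and>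
      V powr (3/4) \<le> g * V / ln V \<and> ln V \<ge> 2 * S' / c) \<and> V \<ge> V1 \<and> V \<ge> V2 \<and> V \<ge> T3 \<and> 2 * V \<ge> y0 \<and> V \<ge> T\<^sub>0"
    unfolding eventually_at_top_linorder by blast
  have step: "V < inv\<phi> V \<and> \<bar>integral {V..inv\<phi> V} zeta_sq / integral {V..inv\<phi> V} (\<lambda>t. \<bar>S1 t\<bar> ^ (2 * l)) - 1 / c * ln V\<bar>
      \<le> 2 * (c * K + S') / c\<^sup>2"
    if V: "V \<ge> V3" for V
  proof -
    note V' = V3[OF V]
    have G_bound: "\<bar>G (2 * V) - V * (ln V + \<kappa>)\<bar> \<le> C * sqrt V"
      unfolding G_def using V' \<mu>_ge[of "2 * V"] by (intro V1(2)) auto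
    have int: "V < U \<and> U \<le> 2 * V \<and> U - V \<ge> g * V / ln V \<and>
       \<bar>(zeta_moment U - zeta_moment V) - (U - V) * ln V\<bar> \<le> K * (U - V)" if "zeta_moment U = G (2 * V)" for U
      using V' G_bound that by (intro V2(2)) auto
    have V0: "V > 0" using V' V1(1) by linarith
    \<comment> \<open>\<open>inv_into\<close> behaves as an inverse only on the image of
      \<open>\<phi>\<^sub>1\<close>, so a preimage of \<open>V\<close> is produced by continuity of
      \<open>zeta_moment\<close>; injectivity of \<open>G\<close> then shows that its ladder value
      is \<open>V\<close>.\<close>
    have "\<exists>U\<ge>T\<^sub>0. U \<le> 2 * V \<and> zeta_moment U = G (2 * V)"
    proof (rule IVT')
      show "zeta_moment T\<^sub>0 \<le> G (2 * V)" using V' G_bound by (simp add: abs_le_iff)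
      show "G (2 * V) \<le> zeta_moment (2 * V)"
        using V2(3)[of V] V' G_bound by (simp add: abs_le_iff)
      show "T\<^sub>0 \<le> 2 * V" using V' V0 by linarith
      have "continuous_on {0..2 * V} zeta_moment"
        unfolding zeta_moment_def by (intro indefinite_integral_continuous_1 zeta_sq_integrable_on)
      thus "continuous_on {T\<^sub>0..2 * V} zeta_moment"
        by (rule continuous_on_subset) (use T0 in auto)
    qed
    then obtain U' where U': "U' \<ge> T\<^sub>0" "zeta_moment U' = G (2 * V)" by blast
    have "\<phi> U' = 2 * V"
    proof (rule ccontr)
      assume "\<phi> U' \<noteq> 2 * V"
      moreover have "G (\<phi> U') = G (2 * V)" using G_\<phi>[OF U'(1)] U'(2) by simp
      ultimately show False
        using G_mono[of "\<phi> U'" "2 * V"] G_mono[of "2 * V" "\<phi> U'"] \<phi>(1)[OF U'(1)] V'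
        by (cases "\<phi> U' < 2 * V") auto
    qed
    hence "V \<in> \<phi>\<^sub>1 ` {T\<^sub>0..}" using \<phi>(3)[OF U'(1)] U'(1) by (intro image_eqI[of _ _ U']) auto
    hence inv: "\<phi>\<^sub>1 (inv\<phi> V) = V" "inv\<phi> V \<ge> T\<^sub>0"
      unfolding inv\<phi>_def using inv_into_into[of V \<phi>\<^sub>1 "{T\<^sub>0..}"] by (auto simp: f_inv_into_f)
    \<comment> \<open>From here on the preimage selected by \<open>inv_into\<close> is used; the
      estimates depend only on its ladder value.\<close>
    define U where "U = inv\<phi> V"
    have "\<phi> U = 2 * V" using inv \<phi>(3)[OF inv(2)] by (simp add: U_def)
    hence "zeta_moment U = G (2 * V)" using G_\<phi>[OF inv(2)] by (simp add: U_def)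
    note U = int[OF this]
    have "V powr (3/4) \<le> U - V" using U V' by linarith
    hence "\<bar>integral {V..V + (U - V)} (\<lambda>t. \<bar>S1 t\<bar> ^ (2*l)) - c * (U - V)\<bar> \<le> S * ((U - V) / ln V)"
      using U V' by (intro S) auto
    also have "\<dots> \<le> S' * ((U - V) / ln V)"
      using U V' V2(1) by (intro mult_right_mono) (auto simp: S'_def)
    finally have I: "\<bar>integral {V..U} (\<lambda>t. \<bar>S1 t\<bar> ^ (2*l)) - c * (U - V)\<bar> \<le> S' * ((U - V) / ln V)" by simp
    have "integral {V..U} zeta_sq = zeta_moment U - zeta_moment V"
      using zeta_moment_add[of V U] U V0 by simp
    hence D: "\<bar>integral {V..U} zeta_sq - (U - V) * ln V\<bar> \<le> K * (U - V)" using U by simp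
    have "\<bar>integral {V..U} zeta_sq / integral {V..U} (\<lambda>t. \<bar>S1 t\<bar> ^ (2 * l)) - 1 / c * ln V\<bar> \<le> 2 * (c * K + S') / c\<^sup>2"
      using U V' V2(1) K c by (intro ratio_bound[OF _ _ _ _ _ _ D I]) (auto simp: S'_def)
    thus ?thesis using U by (simp add: U_def)
  qed
  have at_top: "filterlim (reverse_iterate T\<^sub>0 \<phi>\<^sub>1 r) at_top at_top" for r
  proof (induction r)
    case 0
    have "reverse_iterate T\<^sub>0 \<phi>\<^sub>1 0 = (\<lambda>T. T)" by (auto simp: reverse_iterate_def)
    thus ?case by (simp add: filterlim_ident)
  next
    case (Suc r)
    have "eventually (\<lambda>T. reverse_iterate T\<^sub>0 \<phi>\<^sub>1 r T \<ge> V3) at_top"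
      using Suc by (simp add: filterlim_at_top)
    \<comment> \<open>Each further iterate exceeds the previous one by \<open>step\<close>, so
      divergence is inherited.\<close>
    hence "eventually (\<lambda>T. reverse_iterate T\<^sub>0 \<phi>\<^sub>1 r T \<le> reverse_iterate T\<^sub>0 \<phi>\<^sub>1 (Suc r) T) at_top"
      by eventually_elim (use step in \<open>auto simp: reverse_iterate_def inv\<phi>_def less_imp_le\<close>)
    thus ?case by (rule filterlim_at_top_mono[OF Suc])
  qed
  show ?thesis
  proof
    fix r assume "r \<in> {1..k}"
    then obtain q where r: "r = Suc q" by (cases r) auto
    have "eventually (\<lambda>T. reverse_iterate T\<^sub>0 \<phi>\<^sub>1 q T \<ge> V3) at_top"
      using at_top[of q] by (simp add: filterlim_at_top)
    hence "eventually (\<lambda>T. norm (integral {reverse_iterate T\<^sub>0 \<phi>\<^sub>1 q T..reverse_iterate T\<^sub>0 \<phi>\<^sub>1 (Suc q) T} zeta_sq /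
         integral {reverse_iterate T\<^sub>0 \<phi>\<^sub>1 q T..reverse_iterate T\<^sub>0 \<phi>\<^sub>1 (Suc q) T} (\<lambda>t. \<bar>S1 t\<bar> ^ (2 * l))
         - 1 / c * ln (reverse_iterate T\<^sub>0 \<phi>\<^sub>1 q T)) \<le> 2 * (c * K + S') / c\<^sup>2 * norm (1::real)) at_top"
      by eventually_elim (use step in \<open>auto simp: reverse_iterate_def inv\<phi>_def\<close>)
    thus "(\<lambda>T. integral {reverse_iterate T\<^sub>0 \<phi>\<^sub>1 (r - 1) T..reverse_iterate T\<^sub>0 \<phi>\<^sub>1 r T}
             (\<lambda>t. (cmod (zeta (Complex (1/2) t)))\<^sup>2) /
         integral {reverse_iterate T\<^sub>0 \<phi>\<^sub>1 (r - 1) T..reverse_iterate T\<^sub>0 \<phi>\<^sub>1 r T}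
             (\<lambda>t. \<bar>S1 t\<bar> ^ (2 * l))
         - 1 / c * ln (reverse_iterate T\<^sub>0 \<phi>\<^sub>1 (r - 1) T)) \<in> O[at_top](\<lambda>_. 1)"
      unfolding r diff_Suc_1 zeta_sq_def [abs_def, symmetric] by (rule bigoI)
  qed
qed

end
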